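(* Let $X$ be a finite connected simplicial complex whose fundamental group $\pi_1(X)$ is amenable. Then for all integers $k\geq 0$ we have $V^k_{hyp}(X)=0$.
   Context: Differential forms on a simplicial complex $X$: a $k$-form $\omega\in\Omega^k(X)$ consists of a smooth $k$-form $\omega_\sigma$ on every simplex $\sigma\subset X$ such that $\omega_\sigma|_\tau=\omega_\tau$ whenever $\tau\subset\sigma$ is a subsimplex; $\Omega^{-1}(X)=0$. With the exterior derivative (taken simplexwise) these form the de Rham complex of $X$, whose cohomology is naturally isomorphic to the real singular cohomology $H^k(X;\mathbb{R})$. A Riemannian metric $g$ on $X$ consists of a Riemannian metric $g_\sigma$ on every simplex $\sigma$ such that $g_\sigma|_\tau=g_\tau$ for $\tau\subset\sigma$. A form is bounded with respect to $g$ if the pointwise norms of all its components $\omega_\sigma$ with respect to $g_\sigma$ are bounded by one constant independent of $\sigma$. Hyperbolic classes: let $X$ be a finite simplicial complex with universal covering $p\colon\tilde X\to X$ (with the lifted simplicial structure). A class $w\in H^k(X;\mathbb{R})$ is called hyperbolic if the pullback $p^*\omega$ of a representing closed $k$-form $\omega\in\Omega^k(X)$ has a primitive $\alpha\in\Omega^{k-1}(\tilde X)$ (that is, $d\alpha=p^*\omega$) which is bounded with respect to the lift to $\tilde X$ of some Riemannian metric on $X$. This does not depend on the choice of the metric or of the representing form. $V^k_{hyp}(X)\subset H^k(X;\mathbb{R})$ denotes the subspace of all hyperbolic classes. *)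

theory Defs
  imports "HOL-Analysis.Analysis" "HOL-Algebra.Group"
begin

section \<open>Smooth functions on simplices\<close>

primrec Ck_on :: "nat \<Rightarrow> 'a::euclidean_space set \<Rightarrow> ('a \<Rightarrow> real) \<Rightarrow> bool" where
  "Ck_on 0 U f \<longleftrightarrow> continuous_on U f"
| "Ck_on (Suc n) U f \<longleftrightarrow>
     (\<forall>x\<in>U. f differentiable (at x)) \<and> (\<forall>v. Ck_on n U (\<lambda>x. frechet_derivative f (at x) v))"

text \<open>Smoothness on a closed simplex, possibly of positive codimension, means that there is a
  smooth extension to an open neighbourhood in the ambient space.\<close>

definition smooth_on :: "'a::euclidean_space set \<Rightarrow> ('a \<Rightarrow> real) \<Rightarrow> bool" where
  "smooth_on S f \<longleftrightarrow>
     (\<exists>U F. open U \<and> S \<subseteq> U \<and> (\<forall>n. Ck_on n U F) \<and> (\<forall>x\<in>S. F x = f x))"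

text \<open>The tangent space, at each of its points, of a convex set \<open>S\<close>: the direction space of the
  affine hull of \<open>S\<close>.\<close>

definition tangent :: "'a::real_vector set \<Rightarrow> 'a set" where
  "tangent S = span {y - x | x y. x \<in> S \<and> y \<in> S}"


section \<open>Differential forms\<close>

text \<open>Forms are defined simultaneously for a finite complex \<open>X\<close> and for its coverings. A space with
  a simplicial structure is given by a set \<open>D\<close> of simplices (subsets of the space) and a map \<open>p\<close> to
  a Euclidean space whose restriction to each \<open>s \<in> D\<close> is a homeomorphism onto an affine
  simplex \<open>p ` s\<close>. For \<open>X\<close> itself, \<open>p\<close> is the identity.

  A form \<open>\<omega>\<close> has a component \<open>\<omega> s\<close> on each \<open>s \<in> D\<close>, written in the affine coordinates that \<open>p\<close>
  provides: \<open>\<omega> s x vs\<close> is its value at the point over \<open>x \<in> p ` s\<close> on the list \<open>vs\<close> of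
  vectors tangent to \<open>p ` s\<close>. Values at all other arguments are required to be 0, so that
  equality of functions is equality of forms. The degree is an integer, and there is only the
  zero form in negative degrees.\<close>

type_synonym ('a, 'b) form = "'b set \<Rightarrow> 'a \<Rightarrow> 'a list \<Rightarrow> real"

definition alternating_form :: "'a::real_vector set \<Rightarrow> int \<Rightarrow> ('a list \<Rightarrow> real) \<Rightarrow> bool" where
  "alternating_form V k f \<longleftrightarrow>
     (\<forall>vs. \<not> (int (length vs) = k \<and> set vs \<subseteq> V) \<longrightarrow> f vs = 0) \<and>
     (\<forall>vs i u w a b. int (length vs) = k \<and> set vs \<subseteq> V \<and> i < length vs \<and> u \<in> V \<and> w \<in> V \<longrightarrow>
        f (vs[i := a *\<^sub>R u + b *\<^sub>R w]) = a * f (vs[i := u]) + b * f (vs[i := w])) \<and>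
     (\<forall>vs i j. int (length vs) = k \<and> set vs \<subseteq> V \<and> i < j \<and> j < length vs \<and> vs ! i = vs ! j \<longrightarrow>
        f vs = 0)"

definition zero_form :: "('a, 'b) form" where
  "zero_form = (\<lambda>s x vs. 0)"

definition forms :: "'b set set \<Rightarrow> ('b \<Rightarrow> 'a::euclidean_space) \<Rightarrow> int \<Rightarrow> ('a, 'b) form set" where
  "forms D p k = {\<omega>.
     (\<forall>s x. \<not> (s \<in> D \<and> x \<in> p ` s) \<longrightarrow> \<omega> s x = (\<lambda>vs. 0)) \<and>
     (\<forall>s\<in>D. \<forall>x\<in>p ` s. alternating_form (tangent (p ` s)) k (\<omega> s x)) \<and>
     (\<forall>s\<in>D. \<forall>vs. set vs \<subseteq> tangent (p ` s) \<longrightarrow> smooth_on (p ` s) (\<lambda>x. \<omega> s x vs)) \<and>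
     (\<forall>s\<in>D. \<forall>t\<in>D. t \<subseteq> s \<longrightarrow>
        (\<forall>x\<in>p ` t. \<forall>vs. set vs \<subseteq> tangent (p ` t) \<longrightarrow> \<omega> s x vs = \<omega> t x vs))}"

text \<open>The exterior derivative in affine coordinates, with the vectors \<open>vs\<close> extended to constant
  vector fields (whose Lie brackets vanish). The Frechet derivative within \<open>p ` s\<close> is used
  only on tangent vectors of \<open>p ` s\<close>, on which it is uniquely determined.\<close>

definition ext_deriv :: "'b set set \<Rightarrow> ('b \<Rightarrow> 'a::euclidean_space) \<Rightarrow> ('a, 'b) form \<Rightarrow> ('a, 'b) form"
  where
  "ext_deriv D p \<omega> = (\<lambda>s x vs.
     if s \<in> D \<and> x \<in> p ` s \<and> set vs \<subseteq> tangent (p ` s)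
     then \<Sum>i<length vs. (-1) ^ i *
       frechet_derivative (\<lambda>y. \<omega> s y (take i vs @ drop (Suc i) vs)) (at x within p ` s) (vs ! i)
     else 0)"

definition closed_forms :: "'b set set \<Rightarrow> ('b \<Rightarrow> 'a::euclidean_space) \<Rightarrow> int \<Rightarrow> ('a, 'b) form set"
  where
  "closed_forms D p k = {\<omega> \<in> forms D p k. ext_deriv D p \<omega> = zero_form}"

definition cohomologous ::
  "'b set set \<Rightarrow> ('b \<Rightarrow> 'a::euclidean_space) \<Rightarrow> int \<Rightarrow> (('a, 'b) form \<times> ('a, 'b) form) set" where
  "cohomologous D p k = {(\<omega>, \<omega>'). \<omega> \<in> closed_forms D p k \<and> \<omega>' \<in> closed_forms D p k \<and>
     (\<exists>\<beta>\<in>forms D p (k - 1). ext_deriv D p \<beta> = (\<lambda>s x vs. \<omega>' s x vs - \<omega> s x vs))}"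

definition cohomology :: "'b set set \<Rightarrow> ('b \<Rightarrow> 'a::euclidean_space) \<Rightarrow> int \<Rightarrow> ('a, 'b) form set set"
  where
  "cohomology D p k = closed_forms D p k // cohomologous D p k"

definition cohomology_zero :: "'b set set \<Rightarrow> ('b \<Rightarrow> 'a::euclidean_space) \<Rightarrow> int \<Rightarrow> ('a, 'b) form set"
  where
  "cohomology_zero D p k = cohomologous D p k `` {zero_form}"


section \<open>Riemannian metrics and bounded forms\<close>

definition riemannian_metric ::
  "'a::euclidean_space set set \<Rightarrow> ('a set \<Rightarrow> 'a \<Rightarrow> 'a \<Rightarrow> 'a \<Rightarrow> real) \<Rightarrow> bool" where
  "riemannian_metric K g \<longleftrightarrow>
     (\<forall>S\<in>K. \<forall>x\<in>S.
        (\<forall>u\<in>tangent S. \<forall>v\<in>tangent S. g S x u v = g S x v u) \<and>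
        (\<forall>u\<in>tangent S. \<forall>v\<in>tangent S. \<forall>w\<in>tangent S. \<forall>a b.
           g S x (a *\<^sub>R u + b *\<^sub>R v) w = a * g S x u w + b * g S x v w) \<and>
        (\<forall>u\<in>tangent S. u \<noteq> 0 \<longrightarrow> g S x u u > 0)) \<and>
     (\<forall>S\<in>K. \<forall>u\<in>tangent S. \<forall>v\<in>tangent S. smooth_on S (\<lambda>x. g S x u v)) \<and>
     (\<forall>S\<in>K. \<forall>R\<in>K. R \<subseteq> S \<longrightarrow>
        (\<forall>x\<in>R. \<forall>u\<in>tangent R. \<forall>v\<in>tangent R. g S x u v = g R x u v))"

text \<open>The norm, with respect to the inner product \<open>h\<close> on \<open>V\<close>, of an alternating form \<open>f\<close> on \<open>V\<close>.
  Lists \<open>vs\<close> whose length is not the degree of \<open>f\<close> contribute the value 0.\<close>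

definition form_norm ::
  "'a::euclidean_space set \<Rightarrow> ('a \<Rightarrow> 'a \<Rightarrow> real) \<Rightarrow> ('a list \<Rightarrow> real) \<Rightarrow> real" where
  "form_norm V h f = (SUP vs\<in>{vs. \<forall>v\<in>set vs. v \<in> V \<and> h v v \<le> 1}. \<bar>f vs\<bar>)"

definition bounded_form ::
  "'b set set \<Rightarrow> ('b \<Rightarrow> 'a::euclidean_space) \<Rightarrow> ('b set \<Rightarrow> 'a \<Rightarrow> 'a \<Rightarrow> 'a \<Rightarrow> real) \<Rightarrow>
     ('a, 'b) form \<Rightarrow> bool" where
  "bounded_form D p h \<alpha> \<longleftrightarrow>
     (\<exists>C. \<forall>s\<in>D. \<forall>x\<in>p ` s. form_norm (tangent (p ` s)) (h s x) (\<alpha> s x) \<le> C)"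


section \<open>Universal coverings and hyperbolic classes\<close>

text \<open>A simply connected set is path-connected in the library's sense, but may be empty; it is not
  if \<open>X\<close> is nonempty.\<close>

definition universal_covering ::
  "'b::topological_space set \<Rightarrow> ('b \<Rightarrow> 'a::topological_space) \<Rightarrow> 'a set \<Rightarrow> bool" where
  "universal_covering Xt p X \<longleftrightarrow> covering_space Xt p X \<and> simply_connected Xt"

text \<open>The lifted simplicial structure: the simplices of the covering space are the sheets over the
  simplices of \<open>K\<close>, i.e. the images of the lifts of the inclusions of simplices.\<close>

definition lifted_simplices ::
  "'a::topological_space set set \<Rightarrow> 'b::topological_space set \<Rightarrow> ('b \<Rightarrow> 'a) \<Rightarrow> 'b set set" where
  "lifted_simplices K Xt p = {s. s \<subseteq> Xt \<and> (\<exists>S\<in>K. \<exists>q. homeomorphism s S p q)}"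

text \<open>In the coordinates given by \<open>p\<close>, the map \<open>p\<close> is the identity on each lifted simplex, so that
  pulling back (forms or metrics) only reindexes the components.\<close>

definition pullback_form ::
  "'a::topological_space set set \<Rightarrow> 'b::topological_space set \<Rightarrow> ('b \<Rightarrow> 'a) \<Rightarrow>
     ('a, 'a) form \<Rightarrow> ('a, 'b) form" where
  "pullback_form K Xt p \<omega> = (\<lambda>s. if s \<in> lifted_simplices K Xt p then \<omega> (p ` s) else (\<lambda>x vs. 0))"

definition lifted_metric ::
  "('b \<Rightarrow> 'a) \<Rightarrow> ('a set \<Rightarrow> 'a \<Rightarrow> 'a \<Rightarrow> 'a \<Rightarrow> real) \<Rightarrow> 'b set \<Rightarrow> 'a \<Rightarrow> 'a \<Rightarrow> 'a \<Rightarrow> real" where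
  "lifted_metric p g = (\<lambda>s. g (p ` s))"

definition hyperbolic_classes ::
  "'a::euclidean_space set set \<Rightarrow> 'b::topological_space set \<Rightarrow> ('b \<Rightarrow> 'a) \<Rightarrow> int \<Rightarrow>
     ('a, 'a) form set set" where
  "hyperbolic_classes K Xt p k = {w \<in> cohomology K id k.
     \<exists>\<omega>\<in>w. \<exists>\<alpha>\<in>forms (lifted_simplices K Xt p) p (k - 1).
       ext_deriv (lifted_simplices K Xt p) p \<alpha> = pullback_form K Xt p \<omega> \<and>
       (\<exists>g. riemannian_metric K g \<and>
            bounded_form (lifted_simplices K Xt p) p (lifted_metric p g) \<alpha>)}"


section \<open>Fundamental groups and amenability\<close>

definition loops_at :: "'a::topological_space set \<Rightarrow> 'a \<Rightarrow> (real \<Rightarrow> 'a) set" where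
  "loops_at X x0 = {c. path c \<and> path_image c \<subseteq> X \<and> pathstart c = x0 \<and> pathfinish c = x0}"

definition loop_homotopy ::
  "'a::topological_space set \<Rightarrow> 'a \<Rightarrow> ((real \<Rightarrow> 'a) \<times> (real \<Rightarrow> 'a)) set" where
  "loop_homotopy X x0 =
     {(c, c'). c \<in> loops_at X x0 \<and> c' \<in> loops_at X x0 \<and> homotopic_paths X c c'}"

definition fundamental_group :: "'a::topological_space set \<Rightarrow> 'a \<Rightarrow> (real \<Rightarrow> 'a) set monoid" where
  "fundamental_group X x0 =
     \<lparr>carrier = loops_at X x0 // loop_homotopy X x0,
      mult = (\<lambda>A B. \<Union>c\<in>A. \<Union>c'\<in>B. loop_homotopy X x0 `` {c +++ c'}),
      one = loop_homotopy X x0 `` {\<lambda>t. x0}\<rparr>"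

text \<open>Amenability of a discrete group: there is a left-invariant mean \<open>m\<close> on the bounded real
  functions. Positivity forces \<open>m f\<close> to depend only on the restriction of \<open>f\<close> to the carrier.\<close>

definition amenable :: "('g, 'm) monoid_scheme \<Rightarrow> bool" where
  "amenable G \<longleftrightarrow> (\<exists>m :: ('g \<Rightarrow> real) \<Rightarrow> real.
     (\<forall>f h a b. bounded (f ` carrier G) \<and> bounded (h ` carrier G) \<longrightarrow>
        m (\<lambda>x. a * f x + b * h x) = a * m f + b * m h) \<and>
     (\<forall>f. bounded (f ` carrier G) \<and> (\<forall>x\<in>carrier G. 0 \<le> f x) \<longrightarrow> 0 \<le> m f) \<and>
     m (\<lambda>x. 1) = 1 \<and>
     (\<forall>f. \<forall>a\<in>carrier G. bounded (f ` carrier G) \<longrightarrow> m (\<lambda>x. f (a \<otimes>\<^bsub>G\<^esub> x)) = m f))"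

end

theory Submission
  imports Defs
begin

text \<open>Let \<open>\<alpha>\<close> be a bounded primitive of the lifted form. Its average over the fibres need not be
  smooth, since derivatives of \<open>\<alpha>\<close> are not controlled. On every simplex, however, the contractions
  to the vertices and the barycentric coordinates yield a homotopy operator \<open>h\<close>, compatible with
  passing to faces, such that \<open>\<alpha> = d h \<alpha> + h d \<alpha> + P \<alpha>\<close>, where \<open>P\<close> has finite rank and
  coefficients given by iterated integrals of \<open>\<alpha>\<close>. So \<open>h d \<alpha> + P \<alpha>\<close> is another primitive, in which
  \<open>h d \<alpha>\<close> already lives on \<open>X\<close> and only the bounded coefficients of \<open>P \<alpha>\<close> have to be averaged.
  The invariant mean on the fundamental group induces means on all fibres that are invariant under
  parallel transport, and this invariance makes the averaged coefficients compatible with faces.\<close>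

section \<open>Smooth functions on convex sets\<close>

text \<open>The obstacle is to commute a mean with the exterior derivative: an invariant mean is
  only finitely additive and need not pass through limits. For the finite sums in \<open>P\<close>
  this is harmless. Over a fixed simplex write \<open>P \<alpha>\<close> as a sum of numbers c_J
  times fixed forms W_J. For every lift of the simplex one has d h \<omega> + (sum of c_J d W_J) =
  \<omega>, where only the c_J depend on the lift. At each point and list of vectors this is an
  affine equation in finitely many numbers, so a linear normalised mean preserves it. The c_J are
  bounded over all lifts because the contractions integrate \<alpha> along segments, on vectors of
  bounded length, and never differentiate it. Degree 0 is separate, since a primitive would have
  degree -1.\<close>

lemma Ck_on_subset: "Ck_on n U f \<Longrightarrow> V \<subseteq> U \<Longrightarrow> Ck_on n V f"
  by (induct n arbitrary: f) (auto intro: continuous_on_subset)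

lemma Ck_on_cong:
  assumes "open U" "\<And>x. x \<in> U \<Longrightarrow> f x = g x" "Ck_on n U f"
  shows "Ck_on n U g"
  using assms(2,3)
proof (induct n arbitrary: f g)
  case 0
  then show ?case by (metis Ck_on.simps(1) continuous_on_cong)
next
  case (Suc n)
  have 1: "frechet_derivative f (at x) = frechet_derivative g (at x)" if "x \<in> U" for x
    using Suc.prems assms(1) that
    by (intro frechet_derivative_transform_within_open) (auto intro: Suc.prems)
  have 2: "g differentiable (at x)" if "x \<in> U" for x
    using Suc.prems that has_derivative_transform_within_open[OF _ assms(1) that, of f _ UNIV g]
    unfolding differentiable_def by (metis Ck_on.simps(2) differentiable_def)
  have "Ck_on n U (\<lambda>x. frechet_derivative g (at x) v)" for v
    by (rule Suc.hyps[of "\<lambda>x. frechet_derivative f (at x) v"]) (use 1 Suc.prems in auto)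
  with 2 show ?case by simp
qed

lemma Ck_on_Suc_has_derivative:
  "Ck_on (Suc n) U f \<Longrightarrow> x \<in> U \<Longrightarrow> (f has_derivative frechet_derivative f (at x)) (at x)"
  by (simp add: frechet_derivative_works[THEN iffD1])

text \<open>Any explicitly known derivative will do: at points of an open set it coincides with the
  choice made by \<open>frechet_derivative\<close>, and \<open>Ck_on_cong\<close> exchanges the
  two.\<close>

lemma Ck_on_SucI:
  assumes "open U" "\<And>x. x \<in> U \<Longrightarrow> (f has_derivative f' x) (at x)" "\<And>v. Ck_on n U (\<lambda>x. f' x v)"
  shows "Ck_on (Suc n) U f"
proof -
  have "f' x = frechet_derivative f (at x)" if "x \<in> U" for x
    using assms(2)[OF that] by (rule frechet_derivative_at)
  then have "Ck_on n U (\<lambda>x. frechet_derivative f (at x) v)" for v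
    by (intro Ck_on_cong[OF assms(1) _ assms(3)]) simp
  then show ?thesis using assms(2) by (auto simp: differentiable_def)
qed

text \<open>The recursion of \<open>Ck_on\<close> asks for continuity only at the bottom, so passing
  down one order needs an induction, whose base is that differentiability implies
  continuity.\<close>

lemma Ck_on_SucD: "Ck_on (Suc n) U f \<Longrightarrow> Ck_on n U f"
proof (induct n arbitrary: f)
  case 0
  then show ?case
    by (auto intro!: differentiable_imp_continuous_on simp: differentiable_on_def
      differentiable_at_withinI)
next
  case (Suc n)
  then show ?case by (metis Ck_on.simps(2))
qed

lemma Ck_on_const: "Ck_on n U (\<lambda>x. c)"
  by (induct n arbitrary: c) auto

lemma Ck_on_bounded_linear:
  assumes "bounded_linear l" "open U"
  shows "Ck_on n U l"
proof (cases n)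
  case 0
  then show ?thesis using assms by (simp add: linear_continuous_on)
next
  case (Suc m)
  show ?thesis unfolding Suc
    by (rule Ck_on_SucI[of U l "\<lambda>x. l"])
      (auto simp: assms Ck_on_const bounded_linear_imp_has_derivative)
qed

lemma Ck_on_add:
  assumes "open U" "Ck_on n U f" "Ck_on n U g"
  shows "Ck_on n U (\<lambda>x. f x + g x)"
  using assms(2,3)
proof (induct n arbitrary: f g)
  case 0
  then show ?case by (simp add: continuous_on_add)
next
  case (Suc n)
  show ?case
    by (rule Ck_on_SucI[OF assms(1) has_derivative_add[OF Ck_on_Suc_has_derivative[OF Suc.prems(1)]
          Ck_on_Suc_has_derivative[OF Suc.prems(2)]] Suc.hyps]) (use Suc.prems in auto)
qed

lemma Ck_on_mult:
  assumes "open U" "Ck_on n U f" "Ck_on n U g"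
  shows "Ck_on n U (\<lambda>x. f x * g x)"
  using assms(2,3)
proof (induct n arbitrary: f g)
  case 0
  then show ?case by (simp add: continuous_on_mult)
next
  case (Suc n)
  have "Ck_on n U f" "Ck_on n U g" using Suc.prems Ck_on_SucD by blast+
  then show ?case
    by (intro Ck_on_SucI[OF assms(1) has_derivative_mult[OF Ck_on_Suc_has_derivative[OF Suc.prems(1)]
          Ck_on_Suc_has_derivative[OF Suc.prems(2)]] Ck_on_add[OF assms(1) Suc.hyps Suc.hyps]])
      (use Suc.prems in auto)
qed

section \<open>Derivatives within a convex set in tangent directions\<close>

definition tderiv :: "'a::euclidean_space set \<Rightarrow> ('a \<Rightarrow> real) \<Rightarrow> 'a \<Rightarrow> 'a \<Rightarrow> real" where
  "tderiv S f x = frechet_derivative f (at x within S)"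

text \<open>Restriction to the segment from \<open>x\<close> to a point \<open>y\<close> of
  \<open>S\<close> reduces the claim to uniqueness of one-sided derivatives on an interval, so
  boundary points are no exception. The vectors \<open>y - x\<close> with \<open>x\<close> fixed
  already span the tangent space, because b - a = (b - x) - (a - x).\<close>

lemma has_derivative_unique_tangent:
  fixes S :: "'a::euclidean_space set" and f :: "'a \<Rightarrow> real"
  assumes S: "convex S" "x \<in> S" "v \<in> tangent S"
    and D: "(f has_derivative D) (at x within S)" "(f has_derivative D') (at x within S)"
  shows "D v = D' v"
proof -
  have 1: "D (y - x) = D' (y - x)" if "y \<in> S" for y
  proof -
    have v: "((\<lambda>t. f (x + t *\<^sub>R (y - x))) has_vector_derivative E (y - x)) (at 0 within cbox 0 1)"
      if "(f has_derivative E) (at x within S)" for E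
    proof -
      have im: "(\<lambda>t. x + t *\<^sub>R (y - x)) ` cbox 0 1 \<subseteq> S"
        using S \<open>y \<in> S\<close> by (auto simp: algebra_simps convex_alt)
      have "((\<lambda>t. x + t *\<^sub>R (y - x)) has_derivative (\<lambda>t. t *\<^sub>R (y - x))) (at 0 within cbox 0 1)"
        by (auto intro!: derivative_eq_intros)
      from has_derivative_in_compose2[OF _ im, where g=f and g'="\<lambda>z. E" and x=0]
      have "((\<lambda>t. f (x + t *\<^sub>R (y - x))) has_derivative (\<lambda>t. E (t *\<^sub>R (y - x)))) (at 0 within cbox 0 1)"
        using has_derivative_in_compose[OF \<open>(_ has_derivative _) (at 0 within cbox 0 1)\<close>, of f E]
          has_derivative_subset[OF that im] by simp
      moreover have "linear E" using that by (rule has_derivative_linear)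
      ultimately show ?thesis by (simp add: has_vector_derivative_def linear_cmul)
    qed
    show ?thesis
      using vector_derivative_unique_within_closed_interval[OF _ _ v[OF D(1)] v[OF D(2)]] by simp
  qed
  have l: "linear D" "linear D'" using D has_derivative_linear by blast+
  have 2: "D w = D' w" if w: "w \<in> {y - x |x y. x \<in> S \<and> y \<in> S}" for w
  proof -
    obtain a b where "w = b - a" "a \<in> S" "b \<in> S" using w by blast
    then have "w = (b - x) - (a - x)" by simp
    then show ?thesis using 1 \<open>a \<in> S\<close> \<open>b \<in> S\<close> l by (metis linear_diff)
  qed
  show ?thesis
    using linear_eq_on[OF l, of v] S(3) 2 unfolding tangent_def by blast
qed

lemma tderiv_eqI:
  assumes "convex S" "x \<in> S" "v \<in> tangent S" "(f has_derivative D) (at x within S)"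
  shows "tderiv S f x v = D v"
  unfolding tderiv_def
  by (rule has_derivative_unique_tangent[OF assms(1-3) frechet_derivative_works[THEN iffD1] assms(4)])
    (use assms(4) in \<open>auto simp: differentiable_def\<close>)

text \<open>True for every \<open>v\<close>, tangent or not: both functions have the same set of
  derivatives within \<open>S\<close>, hence the choice operator selects the same one.\<close>

lemma tderiv_cong:
  assumes "x \<in> S" "\<And>y. y \<in> S \<Longrightarrow> f y = g y"
  shows "tderiv S f x v = tderiv S g x v"
proof -
  have "(f has_derivative D) (at x within S) \<longleftrightarrow> (g has_derivative D) (at x within S)" for D
    using has_derivative_transform[of x S f g D] has_derivative_transform[of x S g f D] assms by auto
  then show ?thesis unfolding tderiv_def frechet_derivative_def by simp
qed

lemma smooth_onE:
  assumes "smooth_on S f"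
  obtains U F where "open U" "S \<subseteq> U" "\<And>n. Ck_on n U F" "\<And>x. x \<in> S \<Longrightarrow> F x = f x"
  using assms unfolding smooth_on_def by blast

lemma smooth_onI:
  "open U \<Longrightarrow> S \<subseteq> U \<Longrightarrow> (\<And>n. Ck_on n U F) \<Longrightarrow> (\<And>x. x \<in> S \<Longrightarrow> F x = f x) \<Longrightarrow> smooth_on S f"
  unfolding smooth_on_def by blast

lemma smooth_on_cong: "smooth_on S f \<Longrightarrow> (\<And>x. x \<in> S \<Longrightarrow> f x = g x) \<Longrightarrow> smooth_on S g"
  unfolding smooth_on_def by fastforce

lemma smooth_on_has_derivative:
  assumes "smooth_on S f" "x \<in> S"
  shows "(f has_derivative tderiv S f x) (at x within S)"
proof -
  obtain U F where U: "open U" "S \<subseteq> U" "\<And>n. Ck_on n U F" "\<And>x. x \<in> S \<Longrightarrow> F x = f x"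
    using smooth_onE[OF assms(1)] by metis
  have "(F has_derivative frechet_derivative F (at x)) (at x within S)"
    using Ck_on_Suc_has_derivative[OF U(3)[of "Suc 0"], of x] U(2) assms(2)
    by (meson has_derivative_at_withinI subsetD)
  then have "(f has_derivative frechet_derivative F (at x)) (at x within S)"
    using has_derivative_transform[of x S f F] U(4) assms(2) by auto
  then show ?thesis unfolding tderiv_def
    by (intro frechet_derivative_works[THEN iffD1]) (auto simp: differentiable_def)
qed

text \<open>Moves computations to an open set, where derivatives are unique. The restriction to
  tangent vectors is the price, since other directional derivatives depend on the extension.\<close>

lemma tderiv_extension:
  assumes "convex S" "x \<in> S" "v \<in> tangent S" "S \<subseteq> U" "Ck_on (Suc 0) U F" "\<And>x. x \<in> S \<Longrightarrow> F x = f x"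
  shows "tderiv S f x v = frechet_derivative F (at x) v"
proof (rule tderiv_eqI[OF assms(1-3)])
  have "(F has_derivative frechet_derivative F (at x)) (at x within S)"
    using Ck_on_Suc_has_derivative[OF assms(5), of x] assms(2,4)
    by (meson has_derivative_at_withinI subsetD)
  then show "(f has_derivative frechet_derivative F (at x)) (at x within S)"
    using has_derivative_transform[of x S f F] assms(6) assms(2) by auto
qed

lemma smooth_on_continuous: "smooth_on S f \<Longrightarrow> continuous_on S f"
  by (meson continuous_on_eq_continuous_within has_derivative_continuous smooth_on_has_derivative)

lemma smooth_on_tderiv:
  assumes "convex S" "v \<in> tangent S" "smooth_on S f"
  shows "smooth_on S (\<lambda>x. tderiv S f x v)"
proof -
  obtain U F where U: "open U" "S \<subseteq> U" "\<And>n. Ck_on n U F" "\<And>x. x \<in> S \<Longrightarrow> F x = f x"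
    using smooth_onE[OF assms(3)] by metis
  show ?thesis
  proof (rule smooth_onI[OF U(1,2)])
    show "Ck_on n U (\<lambda>x. frechet_derivative F (at x) v)" for n
      using U(3)[of "Suc n"] by simp
  qed (use tderiv_extension[OF assms(1) _ assms(2) U(2) U(3) U(4)] in auto)
qed

lemma smooth_on_const: "smooth_on S (\<lambda>x. c)"
  by (rule smooth_onI[of UNIV _ "\<lambda>x. c"]) (auto simp: Ck_on_const)

lemma smooth_on_linear: "linear l \<Longrightarrow> smooth_on S l"
  by (rule smooth_onI[of UNIV _ l]) (auto simp: Ck_on_bounded_linear linear_conv_bounded_linear)

lemma smooth_on_add:
  assumes "smooth_on S f" "smooth_on S g"
  shows "smooth_on S (\<lambda>x. f x + g x)"
proof -
  obtain U F where U: "open U" "S \<subseteq> U" "\<And>n. Ck_on n U F" "\<And>x. x \<in> S \<Longrightarrow> F x = f x"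
    using smooth_onE[OF assms(1)] by metis
  obtain V G where V: "open V" "S \<subseteq> V" "\<And>n. Ck_on n V G" "\<And>x. x \<in> S \<Longrightarrow> G x = g x"
    using smooth_onE[OF assms(2)] by metis
  show ?thesis
    by (rule smooth_onI[of "U \<inter> V" _ "\<lambda>x. F x + G x"])
      (use U V in \<open>auto intro!: Ck_on_add open_Int intro: Ck_on_subset[OF _ Int_lower1]
        Ck_on_subset[OF _ Int_lower2]\<close>)
qed

lemma smooth_on_mult:
  assumes "smooth_on S f" "smooth_on S g"
  shows "smooth_on S (\<lambda>x. f x * g x)"
proof -
  obtain U F where U: "open U" "S \<subseteq> U" "\<And>n. Ck_on n U F" "\<And>x. x \<in> S \<Longrightarrow> F x = f x"
    using smooth_onE[OF assms(1)] by metis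
  obtain V G where V: "open V" "S \<subseteq> V" "\<And>n. Ck_on n V G" "\<And>x. x \<in> S \<Longrightarrow> G x = g x"
    using smooth_onE[OF assms(2)] by metis
  show ?thesis
    by (rule smooth_onI[of "U \<inter> V" _ "\<lambda>x. F x * G x"])
      (use U V in \<open>auto intro!: Ck_on_mult open_Int intro: Ck_on_subset[OF _ Int_lower1]
        Ck_on_subset[OF _ Int_lower2]\<close>)
qed

lemma smooth_on_cmult: "smooth_on S f \<Longrightarrow> smooth_on S (\<lambda>x. c * f x)"
  by (intro smooth_on_mult smooth_on_const)

lemma smooth_on_diff: "smooth_on S f \<Longrightarrow> smooth_on S g \<Longrightarrow> smooth_on S (\<lambda>x. f x - g x)"
  using smooth_on_add[of S f "\<lambda>x. (-1) * g x"] smooth_on_cmult[of S g "-1"] by simp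

lemma smooth_on_sum:
  "(\<And>i. i \<in> I \<Longrightarrow> smooth_on S (f i)) \<Longrightarrow> smooth_on S (\<lambda>x. \<Sum>i\<in>I. f i x)"
  by (induct I rule: infinite_finite_induct) (auto intro: smooth_on_const smooth_on_add)

lemma tderiv_linear: "smooth_on S f \<Longrightarrow> x \<in> S \<Longrightarrow> linear (tderiv S f x)"
  using smooth_on_has_derivative has_derivative_linear by blast

lemma tderiv_const: "convex S \<Longrightarrow> x \<in> S \<Longrightarrow> v \<in> tangent S \<Longrightarrow> tderiv S (\<lambda>x. c) x v = 0"
  by (rule tderiv_eqI) auto

lemma tderiv_of_linear: "convex S \<Longrightarrow> x \<in> S \<Longrightarrow> v \<in> tangent S \<Longrightarrow> linear l \<Longrightarrow> tderiv S l x v = l v"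
  by (rule tderiv_eqI) (auto intro: bounded_linear_imp_has_derivative simp: linear_conv_bounded_linear)

lemma tderiv_add:
  assumes "convex S" "x \<in> S" "v \<in> tangent S" "smooth_on S f" "smooth_on S g"
  shows "tderiv S (\<lambda>x. f x + g x) x v = tderiv S f x v + tderiv S g x v"
  using tderiv_eqI[OF assms(1-3) has_derivative_add[OF smooth_on_has_derivative[OF assms(4,2)]
    smooth_on_has_derivative[OF assms(5,2)]]] .

lemma tderiv_diff:
  assumes "convex S" "x \<in> S" "v \<in> tangent S" "smooth_on S f" "smooth_on S g"
  shows "tderiv S (\<lambda>x. f x - g x) x v = tderiv S f x v - tderiv S g x v"
  using tderiv_eqI[OF assms(1-3) has_derivative_diff[OF smooth_on_has_derivative[OF assms(4,2)]
    smooth_on_has_derivative[OF assms(5,2)]]] .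

lemma tderiv_mult:
  assumes "convex S" "x \<in> S" "v \<in> tangent S" "smooth_on S f" "smooth_on S g"
  shows "tderiv S (\<lambda>x. f x * g x) x v = f x * tderiv S g x v + tderiv S f x v * g x"
  using tderiv_eqI[OF assms(1-3) has_derivative_mult[OF smooth_on_has_derivative[OF assms(4,2)]
    smooth_on_has_derivative[OF assms(5,2)]]] .

lemma tderiv_cmult:
  assumes "convex S" "x \<in> S" "v \<in> tangent S" "smooth_on S f"
  shows "tderiv S (\<lambda>x. c * f x) x v = c * tderiv S f x v"
  using tderiv_mult[OF assms(1-3) smooth_on_const assms(4)] tderiv_const[OF assms(1-3)] by simp

lemma tderiv_sum:
  assumes "convex S" "x \<in> S" "v \<in> tangent S" "\<And>i. i \<in> I \<Longrightarrow> smooth_on S (f i)"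
  shows "tderiv S (\<lambda>x. \<Sum>i\<in>I. f i x) x v = (\<Sum>i\<in>I. tderiv S (f i) x v)"
  using assms(4)
proof (induct I rule: infinite_finite_induct)
  case (insert i I)
  then show ?case
    by (simp add: tderiv_add[OF assms(1-3)] smooth_on_sum)
qed (auto simp: tderiv_const[OF assms(1-3)])

lemma subspace_tangent: "subspace (tangent S)"
  unfolding tangent_def by simp

lemma diff_in_tangent: "x \<in> S \<Longrightarrow> y \<in> S \<Longrightarrow> x - y \<in> tangent S"
  unfolding tangent_def by (intro span_base) blast

lemma tangent_mono: "T \<subseteq> S \<Longrightarrow> tangent T \<subseteq> tangent S"
  unfolding tangent_def by (intro span_mono) blast

section \<open>Symmetry of second derivatives and radial integrals\<close>

lemma has_real_derivative_along:
  fixes F :: "'a::euclidean_space \<Rightarrow> real"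
  assumes "(F has_derivative D) (at (a + r *\<^sub>R v))"
  shows "((\<lambda>r. F (a + r *\<^sub>R v)) has_real_derivative D v) (at r)"
proof -
  have "((\<lambda>r. a + r *\<^sub>R v) has_derivative (\<lambda>r. r *\<^sub>R v)) (at r)"
    by (auto intro!: derivative_eq_intros)
  from has_derivative_compose[OF this assms] show ?thesis
    unfolding has_field_derivative_def
    by (rule has_derivative_eq_rhs) (simp add: fun_eq_iff linear_cmul[OF has_derivative_linear[OF
      assms]])
qed

text \<open>The mean value theorem, applied first in direction \<open>v\<close> and then in
  direction \<open>w\<close>. The point of this form is that the second difference on the left is
  symmetric in \<open>v\<close> and \<open>w\<close>, while the derivative on the right is not
  visibly so.\<close>

lemma second_difference_mvt:
  fixes F :: "'a::euclidean_space \<Rightarrow> real"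
  assumes C: "Ck_on (Suc (Suc 0)) U F" and t: "0 < t"
    and U: "\<And>s r. s \<in> {0..t} \<Longrightarrow> r \<in> {0..t} \<Longrightarrow> x + s *\<^sub>R v + r *\<^sub>R w \<in> U"
  shows "\<exists>s r. s \<in> {0..t} \<and> r \<in> {0..t} \<and>
    F (x + t *\<^sub>R v + t *\<^sub>R w) - F (x + t *\<^sub>R v) - F (x + t *\<^sub>R w) + F x =
    t * t * frechet_derivative (\<lambda>y. frechet_derivative F (at y) v) (at (x + s *\<^sub>R v + r *\<^sub>R w)) w"
proof -
  let ?G = "\<lambda>y. frechet_derivative F (at y) v"
  let ?g = "\<lambda>s. F ((x + t *\<^sub>R w) + s *\<^sub>R v) - F (x + s *\<^sub>R v)"
  have D1: "((\<lambda>s. F (a + s *\<^sub>R v)) has_real_derivative ?G (a + s *\<^sub>R v)) (at s)"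
    if "a + s *\<^sub>R v \<in> U" for a s
    using has_real_derivative_along[OF Ck_on_Suc_has_derivative[OF C that]] .
  have D2: "((\<lambda>r. ?G (a + r *\<^sub>R w)) has_real_derivative frechet_derivative ?G (at (a + r *\<^sub>R w))
    w) (at r)"
    if "a + r *\<^sub>R w \<in> U" for a r
    by (rule has_real_derivative_along[OF Ck_on_Suc_has_derivative[OF _ that, of 0]]) (use C in auto)
  have U1: "(x + t *\<^sub>R w) + s *\<^sub>R v \<in> U" "x + s *\<^sub>R v \<in> U" if "s \<in> {0..t}" for s
    using U[OF that, of t] U[OF that, of 0] t by (simp_all add: algebra_simps)
  obtain s where s: "0 < s" "s < t"
    "?g t - ?g 0 = (t - 0) * (?G ((x + t *\<^sub>R w) + s *\<^sub>R v) - ?G (x + s *\<^sub>R v))"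
  proof -
    have "(?g has_real_derivative ?G ((x + t *\<^sub>R w) + s *\<^sub>R v) - ?G (x + s *\<^sub>R v)) (at s)"
      if "0 \<le> s" "s \<le> t" for s
      by (rule DERIV_diff[OF D1 D1]) (use U1[of s] that in auto)
    then have "\<exists>z. 0 < z \<and> z < t \<and> ?g t - ?g 0 = (t - 0) * (?G ((x + t *\<^sub>R w) + z *\<^sub>R v) - ?G (x +
      z *\<^sub>R v))"
      by (rule MVT2[OF t])
    then show thesis using that by blast
  qed
  have U2: "(x + s *\<^sub>R v) + r *\<^sub>R w \<in> U" if "r \<in> {0..t}" for r
    using U[of s r] s that by simp
  obtain r where r: "0 < r" "r < t"
    "?G ((x + s *\<^sub>R v) + t *\<^sub>R w) - ?G ((x + s *\<^sub>R v) + 0 *\<^sub>R w) =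
      (t - 0) * frechet_derivative ?G (at ((x + s *\<^sub>R v) + r *\<^sub>R w)) w"
  proof -
    have "((\<lambda>r. ?G ((x + s *\<^sub>R v) + r *\<^sub>R w)) has_real_derivative
        frechet_derivative ?G (at ((x + s *\<^sub>R v) + r *\<^sub>R w)) w) (at r)" if "0 \<le> r" "r \<le> t" for r
      by (rule D2) (use U2[of r] that in auto)
    then have "\<exists>z. 0 < z \<and> z < t \<and> ?G ((x + s *\<^sub>R v) + t *\<^sub>R w) - ?G ((x + s *\<^sub>R v) + 0 *\<^sub>R w) =
      (t - 0) * frechet_derivative ?G (at ((x + s *\<^sub>R v) + z *\<^sub>R w)) w"
      by (rule MVT2[OF t])
    then show thesis using that by blast
  qed
  show ?thesis
  proof (intro exI conjI)
    show "s \<in> {0..t}" "r \<in> {0..t}" using s r by auto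
    have "x + t *\<^sub>R w + s *\<^sub>R v = x + s *\<^sub>R v + t *\<^sub>R w" "x + t *\<^sub>R w + t *\<^sub>R v = x + t *\<^sub>R v + t *\<^sub>R w"
      by (simp_all add: algebra_simps)
    then show "F (x + t *\<^sub>R v + t *\<^sub>R w) - F (x + t *\<^sub>R v) - F (x + t *\<^sub>R w) + F x =
      t * t * frechet_derivative ?G (at (x + s *\<^sub>R v + r *\<^sub>R w)) w"
      using s(3) r(3) by (simp add: algebra_simps)
  qed
qed

text \<open>The same second difference, expanded in both orders, equates the two mixed derivatives
  at points arbitrarily close to \<open>x\<close>. If they differed at \<open>x\<close>, their
  continuity would keep them apart nearby.\<close>

lemma frechet_derivative_symmetric:
  fixes F :: "'a::euclidean_space \<Rightarrow> real"
  assumes C: "Ck_on (Suc (Suc 0)) U F" and U: "open U" "x \<in> U"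
  shows "frechet_derivative (\<lambda>y. frechet_derivative F (at y) v) (at x) w =
         frechet_derivative (\<lambda>y. frechet_derivative F (at y) w) (at x) v"
proof (rule ccontr)
  let ?A = "\<lambda>z. frechet_derivative (\<lambda>y. frechet_derivative F (at y) v) (at z) w"
  let ?B = "\<lambda>z. frechet_derivative (\<lambda>y. frechet_derivative F (at y) w) (at z) v"
  assume ne: "?A x \<noteq> ?B x"
  \<comment> \<open>Half the gap, so that two errors below \<open>e\<close> cannot close it.\<close>
  define e where "e = \<bar>?A x - ?B x\<bar> / 2"
  have e: "e > 0" using ne by (simp add: e_def)
  have cont: "continuous_on U ?A" "continuous_on U ?B" using C by auto
  obtain d1 where d1: "d1 > 0" "\<And>z. z \<in> U \<Longrightarrow> dist z x < d1 \<Longrightarrow> dist (?A z) (?A x) < e"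
    using cont(1)[unfolded continuous_on_iff, rule_format, OF U(2) e] by blast
  obtain d2 where d2: "d2 > 0" "\<And>z. z \<in> U \<Longrightarrow> dist z x < d2 \<Longrightarrow> dist (?B z) (?B x) < e"
    using cont(2)[unfolded continuous_on_iff, rule_format, OF U(2) e] by blast
  obtain d3 where d3: "d3 > 0" "ball x d3 \<subseteq> U" using U openE by blast
  define d where "d = min d1 (min d2 d3)"
  \<comment> \<open>Keeps the whole parallelogram with sides \<open>t *\<^sub>R v\<close> and
    \<open>t *\<^sub>R w\<close> inside the ball of radius \<open>d\<close>; the summand 1 covers
    the case that both vectors are 0.\<close>
  define t where "t = d / (2 * (norm v + norm w + 1))"
  have d: "d > 0" "d \<le> d1" "d \<le> d2" "d \<le> d3" using d1 d2 d3 by (auto simp: d_def)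
  have nz: "norm v + norm w + 1 > 0" by (smt (verit) norm_ge_zero)
  then have t: "t > 0" using d by (simp add: t_def)
  have tb: "t * (norm v + norm w) < d"
  proof -
    have "t * (norm v + norm w + 1) = d / 2" using nz unfolding t_def by (simp add: divide_simps
      algebra_simps del: distrib_left_numeral) 
    moreover have "t * (norm v + norm w) \<le> t * (norm v + norm w + 1)" using t by simp
    ultimately show ?thesis using d(1) by linarith
  qed
  have near: "dist (x + s *\<^sub>R v + r *\<^sub>R w) x < d" if "s \<in> {0..t}" "r \<in> {0..t}" for s r
  proof -
    have "dist (x + s *\<^sub>R v + r *\<^sub>R w) x \<le> \<bar>s\<bar> * norm v + \<bar>r\<bar> * norm w"
      using norm_triangle_ineq[of "s *\<^sub>R v" "r *\<^sub>R w"] by (simp add: dist_norm add.assoc)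
    also have "\<dots> \<le> t * norm v + t * norm w"
      using that by (intro add_mono mult_right_mono) auto
    finally show ?thesis using tb by (simp add: algebra_simps)
  qed
  have inU: "x + s *\<^sub>R v + r *\<^sub>R w \<in> U" if "s \<in> {0..t}" "r \<in> {0..t}" for s r
    using near[OF that] d d3 by (auto simp: dist_commute)
  have inU': "x + s *\<^sub>R w + r *\<^sub>R v \<in> U" if "s \<in> {0..t}" "r \<in> {0..t}" for s r
    using inU[OF that(2,1)] by (simp add: algebra_simps)
  obtain s r where sr: "s \<in> {0..t}" "r \<in> {0..t}"
    "F (x + t *\<^sub>R v + t *\<^sub>R w) - F (x + t *\<^sub>R v) - F (x + t *\<^sub>R w) + F x =
      t * t * ?A (x + s *\<^sub>R v + r *\<^sub>R w)"
    using second_difference_mvt[OF C t inU] by auto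
  obtain s' r' where sr': "s' \<in> {0..t}" "r' \<in> {0..t}"
    "F (x + t *\<^sub>R w + t *\<^sub>R v) - F (x + t *\<^sub>R w) - F (x + t *\<^sub>R v) + F x =
      t * t * ?B (x + s' *\<^sub>R w + r' *\<^sub>R v)"
    using second_difference_mvt[OF C t inU'] by auto
  have sw: "x + t *\<^sub>R w + t *\<^sub>R v = x + t *\<^sub>R v + t *\<^sub>R w" "x + s' *\<^sub>R w + r' *\<^sub>R v =
    x + r' *\<^sub>R v + s' *\<^sub>R w"
    by (simp_all add: algebra_simps)
  have "t * t * ?A (x + s *\<^sub>R v + r *\<^sub>R w) = t * t * ?B (x + r' *\<^sub>R v + s' *\<^sub>R w)"
    using sr(3) sr'(3) unfolding sw by linarith
  then have "?A (x + s *\<^sub>R v + r *\<^sub>R w) = ?B (x + r' *\<^sub>R v + s' *\<^sub>R w)"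
    using t by simp
  moreover have "dist (?A (x + s *\<^sub>R v + r *\<^sub>R w)) (?A x) < e"
    using d1(2)[OF inU[OF sr(1,2)]] near[OF sr(1,2)] d by simp
  moreover have "dist (?B (x + r' *\<^sub>R v + s' *\<^sub>R w)) (?B x) < e"
    using d2(2)[OF inU[OF sr'(2,1)]] near[OF sr'(2,1)] d by simp
  ultimately have "\<bar>?A x - ?B x\<bar> < e + e" unfolding dist_real_def by linarith
  then show False by (simp add: e_def)
qed

lemma tderiv_symmetric:
  assumes S: "convex S" "x \<in> S" "v \<in> tangent S" "w \<in> tangent S" "smooth_on S f"
  shows "tderiv S (\<lambda>y. tderiv S f y v) x w = tderiv S (\<lambda>y. tderiv S f y w) x v"
proof -
  obtain U F where U: "open U" "S \<subseteq> U" "\<And>n. Ck_on n U F" "\<And>x. x \<in> S \<Longrightarrow> F x = f x"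
    using smooth_onE[OF S(5)] by metis
  have *: "tderiv S (\<lambda>y. tderiv S f y a) x b = frechet_derivative (\<lambda>y. frechet_derivative F (at y)
    a) (at x) b"
    if "a \<in> tangent S" "b \<in> tangent S" for a b
  proof (rule tderiv_extension[OF S(1,2) that(2) U(2)])
    show "Ck_on (Suc 0) U (\<lambda>y. frechet_derivative F (at y) a)"
      using U(3)[of "Suc (Suc 0)"] by (metis Ck_on.simps(2))
    show "frechet_derivative F (at z) a = tderiv S f z a" if "z \<in> S" for z
      using tderiv_extension[OF S(1) that \<open>a \<in> tangent S\<close> U(2) U(3) U(4)] by simp
  qed
  have "x \<in> U" using S(2) U(2) by blast
  then show ?thesis
    unfolding *[OF S(3,4)] *[OF S(4,3)] by (rule frechet_derivative_symmetric[OF U(3) U(1)])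
qed

text \<open>The contraction to \<open>e\<close> at time t scales each vector by t, so pulling back a
  form leaves a factor t for every vector other than the radial one; \<open>m\<close> counts
  these.\<close>

definition radial_int :: "nat \<Rightarrow> 'a::euclidean_space \<Rightarrow> ('a \<Rightarrow> real) \<Rightarrow> 'a \<Rightarrow> real" where
  "radial_int m e f x = integral {0..1} (\<lambda>t. t ^ m * f (e + t *\<^sub>R (x - e)))"

lemma segment_in_convex: "convex S \<Longrightarrow> e \<in> S \<Longrightarrow> x \<in> S \<Longrightarrow> t \<in> {0..1} \<Longrightarrow> e + t *\<^sub>R (x - e) \<in> S"
  by (auto simp: algebra_simps convex_alt)

lemma radial_int_cong:
  assumes "convex S" "e \<in> S" "x \<in> S" "\<And>y. y \<in> S \<Longrightarrow> f y = g y"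
  shows "radial_int m e f x = radial_int m e g x"
  unfolding radial_int_def
  by (intro integral_cong) (simp add: assms segment_in_convex)

lemma continuous_on_radial:
  fixes f :: "'a::euclidean_space \<Rightarrow> 'b::real_normed_vector"
  assumes "convex S" "e \<in> S" "continuous_on S f"
  shows "continuous_on (S \<times> {0..1}) (\<lambda>(x, t). (t::real) ^ m *\<^sub>R f (e + t *\<^sub>R (x - e)))"
  unfolding split_beta
  by (intro continuous_intros continuous_on_compose2[OF assms(3)]) (auto simp: assms segment_in_convex)

lemma radial_integrable:
  fixes S :: "'a::euclidean_space set"
  assumes "convex S" "e \<in> S" "continuous_on S f" "x \<in> S"
  shows "(\<lambda>t. t ^ m * (f (e + t *\<^sub>R (x - e)) :: real)) integrable_on {0..1}"
proof -
  have "continuous_on {0..1} (\<lambda>t. t ^ m * f (e + t *\<^sub>R (x - e)))"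
    by (intro continuous_intros continuous_on_compose2[OF assms(3), of "{0..1}"
      "\<lambda>t. e + t *\<^sub>R (x - e)"])
      (auto simp: assms segment_in_convex)
  then show ?thesis by (rule integrable_continuous_interval)
qed

lemma radial_int_add:
  assumes "convex S" "e \<in> S" "x \<in> S" "continuous_on S f" "continuous_on S g"
  shows "radial_int m e (\<lambda>y. f y + g y) x = radial_int m e f x + radial_int m e g x"
  unfolding radial_int_def
  using integral_add[OF radial_integrable[OF assms(1,2,4,3)] radial_integrable[OF assms(1,2,5,3)]]
  by (simp add: algebra_simps)

lemma radial_int_cmult: "radial_int m e (\<lambda>y. c * f y) x = c * radial_int m e f x"
  unfolding radial_int_def using integral_mult_right[of "{0..1}" c]
  by (simp add: algebra_simps)

text \<open>Differentiation under the integral sign. The Leibniz rule wants the derivative as a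
  continuous map into the bounded linear maps, hence the detour through \<open>B\<close>. The inner
  derivative of e + t (x - e) contributes a factor t, which raises the weight by one.\<close>

lemma radial_int_has_derivative:
  fixes F :: "'a::euclidean_space \<Rightarrow> real"
  assumes U: "open U" "convex U" "e \<in> U" and F: "Ck_on (Suc 0) U F" and x: "x \<in> U"
  shows "(radial_int m e F has_derivative
    (\<lambda>v. radial_int (Suc m) e (\<lambda>y. frechet_derivative F (at y) v) x)) (at x)"
proof -
  define B where "B y = Blinfun (frechet_derivative F (at y))" for y
  have bl: "bounded_linear (frechet_derivative F (at y))" if "y \<in> U" for y
    using Ck_on_Suc_has_derivative[OF F that] has_derivative_bounded_linear by blast
  have B: "blinfun_apply (B y) = frechet_derivative F (at y)" if "y \<in> U" for y
    by (simp add: B_def bounded_linear_Blinfun_apply bl that)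
  have cB: "continuous_on U B"
  proof (rule continuous_on_blinfun_componentwise)
    show "continuous_on U (\<lambda>y. blinfun_apply (B y) i)" for i
      using F B continuous_on_cong[of U U "\<lambda>y. blinfun_apply (B y) i"
        "\<lambda>y. frechet_derivative F (at y) i"]
      by simp
  qed
  have cF: "continuous_on U F" using Ck_on_SucD[OF F] by simp
  have 1: "((\<lambda>z. t ^ m * F (e + t *\<^sub>R (z - e))) has_derivative blinfun_apply (t ^ Suc m *\<^sub>R B (e +
    t *\<^sub>R (z - e))))
      (at z within U)" if z: "z \<in> U" and t: "t \<in> cbox 0 1" for z t
  proof -
    have i: "e + t *\<^sub>R (z - e) \<in> U" using U z t by (intro segment_in_convex) auto
    have "((\<lambda>z. e + t *\<^sub>R (z - e)) has_derivative (\<lambda>v. t *\<^sub>R v)) (at z)"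
      by (auto intro!: derivative_eq_intros)
    from has_derivative_mult_right[OF has_derivative_compose[OF this Ck_on_Suc_has_derivative[OF F
      i]], of "t ^ m"]
    have "((\<lambda>z. t ^ m * F (e + t *\<^sub>R (z - e))) has_derivative blinfun_apply (t ^ Suc m *\<^sub>R B (e +
      t *\<^sub>R (z - e)))) (at z)"
      by (rule has_derivative_eq_rhs)
        (simp add: fun_eq_iff linear_cmul[OF bounded_linear.linear[OF bl[OF i]]] B[OF i]
          scaleR_blinfun.rep_eq)
    then show ?thesis by (rule has_derivative_at_withinI)
  qed
  have c2: "continuous_on (U \<times> cbox 0 1) (\<lambda>(x, t). t ^ Suc m *\<^sub>R B (e + t *\<^sub>R (x - e)))"
    using continuous_on_radial[OF U(2,3) cB, of "Suc m"] by (simp only: box_real)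
  have "((\<lambda>x. integral (cbox 0 1) (\<lambda>t. t ^ m * F (e + t *\<^sub>R (x - e)))) has_derivative
     blinfun_apply (integral (cbox 0 1) (\<lambda>t. t ^ Suc m *\<^sub>R B (e + t *\<^sub>R (x - e))))) (at x within U)"
    by (rule leibniz_rule[OF 1 _ c2 x U(2)]) (use radial_integrable[OF U(2,3) cF] in auto)
  moreover have "blinfun_apply (integral (cbox 0 1) (\<lambda>t. t ^ Suc m *\<^sub>R B (e + t *\<^sub>R (x - e)))) v
      = radial_int (Suc m) e (\<lambda>y. frechet_derivative F (at y) v) x" for v
  proof -
    have "continuous_on {0..1} (\<lambda>t. t ^ Suc m *\<^sub>R B (e + t *\<^sub>R (x - e)))"
      by (intro continuous_intros continuous_on_compose2[OF cB]) (auto simp: U x segment_in_convex)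
    then have "(\<lambda>t. t ^ Suc m *\<^sub>R B (e + t *\<^sub>R (x - e))) integrable_on {0..1}"
      by (rule integrable_continuous_interval)
    from integral_linear[OF this, of "\<lambda>b. blinfun_apply b v"]
    have "blinfun_apply (integral {0..1} (\<lambda>t. t ^ Suc m *\<^sub>R B (e + t *\<^sub>R (x - e)))) v =
      integral {0..1} (\<lambda>t. blinfun_apply (t ^ Suc m *\<^sub>R B (e + t *\<^sub>R (x - e))) v)"
      by (simp add: o_def blinfun.bounded_linear_left)
    also have "\<dots> = integral {0..1} (\<lambda>t. t ^ Suc m * frechet_derivative F (at (e + t *\<^sub>R (x - e))) v)"
      by (intro integral_cong) (simp add: B segment_in_convex U x scaleR_blinfun.rep_eq)
    finally show ?thesis by (simp add: radial_int_def)
  qed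
  ultimately have "((\<lambda>x. radial_int m e F x) has_derivative
     (\<lambda>v. radial_int (Suc m) e (\<lambda>y. frechet_derivative F (at y) v) x)) (at x within U)"
    unfolding radial_int_def[of m] box_real[symmetric] by (rule has_derivative_eq_rhs[OF _ ext])
  then show ?thesis using at_within_open[OF x U(1)] by simp
qed

lemma Ck_on_continuous: "Ck_on n U f \<Longrightarrow> continuous_on U f"
  by (induct n) (auto dest: Ck_on_SucD simp del: Ck_on.simps(2))

text \<open>The weight has to be arbitrary in the induction, because each derivative raises
  it.\<close>

lemma Ck_on_radial_int:
  assumes U: "open U" "convex U" "e \<in> U"
  shows "Ck_on n U F \<Longrightarrow> Ck_on n U (radial_int m e F)"
proof (induct n arbitrary: F m)
  case 0
  have "continuous_on U (\<lambda>x. integral (cbox 0 1) (\<lambda>t. t ^ m * F (e + t *\<^sub>R (x - e))))"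
    by (rule integral_continuous_on_param) (use continuous_on_radial[OF U(2,3), of F m] 0 in simp)
  then show ?case by (simp add: radial_int_def[abs_def])
next
  case (Suc n)
  have "Ck_on (Suc 0) U F"
    using Suc.prems Ck_on_continuous by fastforce
  then show ?case
    by (intro Ck_on_SucI[OF U(1) radial_int_has_derivative[OF U]] Suc.hyps) (use Suc.prems in auto)
qed

text \<open>A smooth extension lives on some open set, but a radial integral of it makes sense only
  where the segments to the base point stay. Compactness gives a ball of uniform radius around all
  points of \<open>S\<close>, and the union of these balls is a Minkowski sum of convex
  sets.\<close>

lemma convex_neighbourhood:
  fixes S :: "'a::euclidean_space set"
  assumes "compact S" "convex S" "open U" "S \<subseteq> U"
  obtains W where "open W" "convex W" "S \<subseteq> W" "W \<subseteq> U"
proof -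
  obtain r where r: "r > 0" "(\<Union>x\<in>S. ball x r) \<subseteq> U"
    using compact_subset_open_imp_ball_epsilon_subset[OF assms(1,3,4)] .
  have e: "(\<Union>x\<in>S. ball x r) = (\<Union>x\<in>S. \<Union>y\<in>ball 0 r. {x + y})"
  proof (rule equalityI; rule subsetI)
    fix z assume "z \<in> (\<Union>x\<in>S. ball x r)"
    then obtain x where "x \<in> S" "norm (z - x) < r" by (auto simp: dist_norm norm_minus_commute)
    then show "z \<in> (\<Union>x\<in>S. \<Union>y\<in>ball 0 r. {x + y})"
      by (intro UN_I[of x] UN_I[of "z - x"]) auto
  next
    fix z assume "z \<in> (\<Union>x\<in>S. \<Union>y\<in>ball 0 r. {x + y})"
    then obtain x y where "x \<in> S" "norm y < r" "z = x + y" by auto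
    then show "z \<in> (\<Union>x\<in>S. ball x r)" by (intro UN_I[of x]) (auto simp: dist_norm)
  qed
  show thesis
  proof
    show "open (\<Union>x\<in>S. ball x r)" by auto
    show "convex (\<Union>x\<in>S. ball x r)" unfolding e by (intro convex_sums assms convex_ball)
    show "S \<subseteq> (\<Union>x\<in>S. ball x r)" using r by force
  qed (fact r)
qed

lemma smooth_on_radial_int:
  assumes S: "compact S" "convex S" "e \<in> S" and f: "smooth_on S f"
  shows "smooth_on S (radial_int m e f)"
    and "x \<in> S \<Longrightarrow> v \<in> tangent S \<Longrightarrow> tderiv S (radial_int m e f) x v =
      radial_int (Suc m) e (\<lambda>y. tderiv S f y v) x"
proof -
  obtain U F where U: "open U" "S \<subseteq> U" "\<And>n. Ck_on n U F" "\<And>x. x \<in> S \<Longrightarrow> F x = f x"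
    using smooth_onE[OF f] by metis
  obtain W where W: "open W" "convex W" "S \<subseteq> W" "W \<subseteq> U"
    using convex_neighbourhood[OF S(1,2) U(1,2)] .
  have F: "Ck_on n W F" for n using U(3) W(4) Ck_on_subset by blast
  have e: "e \<in> W" using S W by auto
  have eq: "radial_int m e F x = radial_int m e f x" if "x \<in> S" for x
    by (rule radial_int_cong[OF S(2,3) that U(4)])
  show "smooth_on S (radial_int m e f)"
    by (rule smooth_onI[OF W(1,3) Ck_on_radial_int[OF W(1,2) e F] eq])
  show "tderiv S (radial_int m e f) x v = radial_int (Suc m) e (\<lambda>y. tderiv S f y v) x"
    if x: "x \<in> S" and v: "v \<in> tangent S"
  proof -
    have "(radial_int m e F has_derivative
        (\<lambda>v. radial_int (Suc m) e (\<lambda>y. frechet_derivative F (at y) v) x)) (at x within S)"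
      by (rule has_derivative_at_withinI, rule radial_int_has_derivative[OF W(1,2) e F])
        (use x W in auto)
    then have "(radial_int m e f has_derivative
        (\<lambda>v. radial_int (Suc m) e (\<lambda>y. frechet_derivative F (at y) v) x)) (at x within S)"
      using has_derivative_transform[of x S "radial_int m e f" "radial_int m e F"] eq x by auto
    then have "tderiv S (radial_int m e f) x v = radial_int (Suc m)
      e (\<lambda>y. frechet_derivative F (at y) v) x"
      by (rule tderiv_eqI[OF S(2) x v])
    also have "\<dots> = radial_int (Suc m) e (\<lambda>y. tderiv S f y v) x"
      by (rule radial_int_cong[OF S(2,3) x]) (rule tderiv_extension[OF S(2) _ v U(2) U(3) U(4),
        symmetric])
    finally show ?thesis .
  qed
qed

lemma radial_derivative:
  assumes S: "convex S" "e \<in> S" "x \<in> S" and f: "smooth_on S f" and t: "t \<in> {0..1}"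
  shows "((\<lambda>t. f (e + t *\<^sub>R (x - e))) has_vector_derivative tderiv S f (e + t *\<^sub>R (x - e))
    (x - e)) (at t within {0..1})"
proof -
  have im: "(\<lambda>t. e + t *\<^sub>R (x - e)) ` {0..1} \<subseteq> S" using S segment_in_convex by blast
  have 1: "((\<lambda>t. e + t *\<^sub>R (x - e)) has_derivative (\<lambda>t. t *\<^sub>R (x - e))) (at t within {0..1})"
    by (auto intro!: derivative_eq_intros)
  have y: "e + t *\<^sub>R (x - e) \<in> S" using segment_in_convex[OF S t] .
  have "((\<lambda>t. f (e + t *\<^sub>R (x - e))) has_derivative (\<lambda>r. tderiv S f (e + t *\<^sub>R (x - e))
    (r *\<^sub>R (x - e)))) (at t within {0..1})"
    by (rule has_derivative_in_compose[OF 1 has_derivative_subset[OF smooth_on_has_derivative[OF f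
      y] im]])
  then show ?thesis
    by (simp add: has_vector_derivative_def linear_cmul[OF tderiv_linear[OF f y]])
qed

lemma continuous_on_tderiv_radial:
  assumes S: "convex S" "e \<in> S" "x \<in> S" and f: "smooth_on S f"
  shows "continuous_on S (\<lambda>y. tderiv S f y (x - e))"
  by (intro smooth_on_continuous smooth_on_tderiv S diff_in_tangent f)

lemma radial_int_ftc_0:
  assumes S: "convex S" "e \<in> S" "x \<in> S" and f: "smooth_on S f"
  shows "radial_int 0 e (\<lambda>y. tderiv S f y (x - e)) x = f x - f e"
proof -
  have "((\<lambda>t. tderiv S f (e + t *\<^sub>R (x - e)) (x - e)) has_integral
      f (e + 1 *\<^sub>R (x - e)) - f (e + 0 *\<^sub>R (x - e))) {0..1}"
    by (rule fundamental_theorem_of_calculus) (use radial_derivative[OF S f] in auto)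
  then show ?thesis by (simp add: radial_int_def integral_unique)
qed

text \<open>The fundamental theorem for t^(m+1) f(e + t (x - e)), whose boundary term at 0 is killed
  by the power of t. With weight 0, in \<open>radial_int_ftc_0\<close>, that term survives; this is
  why cones invert the derivative in positive degree only.\<close>

lemma radial_int_ftc_Suc:
  assumes S: "convex S" "e \<in> S" "x \<in> S" and f: "smooth_on S f"
  shows "radial_int (Suc m) e (\<lambda>y. tderiv S f y (x - e)) x + real (Suc m) * radial_int m e f x = f x"
proof -
  let ?d = "\<lambda>t. tderiv S f (e + t *\<^sub>R (x - e)) (x - e)" and ?f = "\<lambda>t. f (e + t *\<^sub>R (x - e))"
  have D: "((\<lambda>t. t ^ Suc m * ?f t) has_vector_derivative t ^ Suc m * ?d t + (real (Suc m) * t ^ m)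
    * ?f t)
      (at t within {0..1})" if "t \<in> {0..1}" for t
  proof -
    have "((\<lambda>t. t ^ Suc m) has_vector_derivative real (Suc m) * t ^ m) (at t within {0..1})"
      unfolding has_real_derivative_iff_has_vector_derivative[symmetric]
      using DERIV_power[OF DERIV_ident, where n="Suc m"] by simp
    from has_vector_derivative_mult[OF this radial_derivative[OF S f that]] show ?thesis .
  qed
  have "((\<lambda>t. t ^ Suc m * ?d t + (real (Suc m) * t ^ m) * ?f t) has_integral
      1 ^ Suc m * ?f 1 - 0 ^ Suc m * ?f 0) {0..1}"
    by (rule fundamental_theorem_of_calculus) (use D in auto)
  then have 1: "integral {0..1} (\<lambda>t. t ^ Suc m * ?d t + real (Suc m) * (t ^ m * ?f t)) = f x"
    by (simp add: integral_unique mult.assoc)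
  have "integral {0..1} (\<lambda>t. t ^ Suc m * ?d t + real (Suc m) * (t ^ m * ?f t)) =
     integral {0..1} (\<lambda>t. t ^ Suc m * ?d t) + integral {0..1} (\<lambda>t. real (Suc m) * (t ^ m * ?f t))"
    by (intro integral_add integrable_on_mult_right radial_integrable[OF S(1,2) _ S(3)]
        continuous_on_tderiv_radial[OF S f] smooth_on_continuous f)
  then show ?thesis using 1
    by (simp add: radial_int_def del: of_nat_Suc)
qed

section \<open>Alternating forms and alternating sums\<close>

text \<open>A version of \<open>alternating_form\<close> suited to list induction: entries are
  addressed by splitting the list, nothing is demanded outside the domain, and only adjacent
  repetitions are tested. The general repetition follows in
  \<open>alt_form_repeated\<close>.\<close>

definition alt_form :: "'a::real_vector set \<Rightarrow> nat \<Rightarrow> ('a list \<Rightarrow> real) \<Rightarrow> bool" where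
  "alt_form V n f \<longleftrightarrow>
     (\<forall>xs ys u w a b. Suc (length xs + length ys) = n \<and> set xs \<subseteq> V \<and> set ys \<subseteq> V \<and> u \<in> V \<and> w \<in> V \<longrightarrow>
        f (xs @ (a *\<^sub>R u + b *\<^sub>R w) # ys) = a * f (xs @ u # ys) + b * f (xs @ w # ys)) \<and>
     (\<forall>xs ys u. Suc (Suc (length xs + length ys)) = n \<and> set xs \<subseteq> V \<and> set ys \<subseteq> V \<and> u \<in> V \<longrightarrow>
        f (xs @ u # u # ys) = 0)"

lemma alt_formD1:
  "alt_form V n f \<Longrightarrow> Suc (length xs + length ys) = n \<Longrightarrow> set xs \<subseteq> V \<Longrightarrow> set ys \<subseteq> V \<Longrightarrow> u \<in> V \<Longrightarrow> w \<in> V \<Longrightarrow>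
    f (xs @ (a *\<^sub>R u + b *\<^sub>R w) # ys) = a * f (xs @ u # ys) + b * f (xs @ w # ys)"
  unfolding alt_form_def by blast

lemma alt_formD2:
  "alt_form V n f \<Longrightarrow> Suc (Suc (length xs + length ys)) = n \<Longrightarrow> set xs \<subseteq> V \<Longrightarrow> set ys \<subseteq> V \<Longrightarrow> u \<in> V \<Longrightarrow>
    f (xs @ u # u # ys) = 0"
  unfolding alt_form_def by blast

lemma alt_form_add:
  assumes "alt_form V n f" "Suc (length xs + length ys) = n" "set xs \<subseteq> V" "set ys \<subseteq> V" "u \<in> V" "w \<in> V"
  shows "f (xs @ (u + w) # ys) = f (xs @ u # ys) + f (xs @ w # ys)"
  using alt_formD1[OF assms, of 1 1] by simp

lemma alt_form_scale:
  assumes "alt_form V n f" "Suc (length xs + length ys) = n" "set xs \<subseteq> V" "set ys \<subseteq> V" "u \<in> V"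
  shows "f (xs @ (c *\<^sub>R u) # ys) = c * f (xs @ u # ys)"
  using alt_formD1[OF assms assms(5), of c 0] by simp

lemma alt_form_swap:
  assumes "subspace V" "alt_form V n f" "Suc (Suc (length xs + length ys)) = n"
    "set xs \<subseteq> V" "set ys \<subseteq> V" "u \<in> V" "w \<in> V"
  shows "f (xs @ u # w # ys) = - f (xs @ w # u # ys)"
proof -
  have s: "u + w \<in> V" using assms by (simp add: subspace_add)
  have "0 = f (xs @ (u + w) # (u + w) # ys)"
    using alt_formD2[OF assms(2-5) s] by simp
  also have "\<dots> = f (xs @ u # (u + w) # ys) + f (xs @ w # (u + w) # ys)"
    by (rule alt_form_add[OF assms(2)]) (use assms s in auto)
  also have "f (xs @ u # (u + w) # ys) = f ((xs @ [u]) @ u # ys) + f ((xs @ [u]) @ w # ys)"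
    using alt_form_add[OF assms(2), of "xs @ [u]" ys u w] assms s by simp
  also have "f (xs @ w # (u + w) # ys) = f ((xs @ [w]) @ u # ys) + f ((xs @ [w]) @ w # ys)"
    using alt_form_add[OF assms(2), of "xs @ [w]" ys u w] assms s by simp
  finally show ?thesis
    using alt_formD2[OF assms(2-5), of u] alt_formD2[OF assms(2-5), of w] assms by simp
qed

text \<open>Transpositions carry the first copy of \<open>u\<close> to the second, each at the cost
  of a sign.\<close>

lemma alt_form_repeated:
  assumes "subspace V" "alt_form V n f" "u \<in> V"
  shows "Suc (Suc (length xs + length ys + length zs)) = n \<Longrightarrow> set xs \<subseteq> V \<Longrightarrow> set ys \<subseteq> V \<Longrightarrow> set zs \<subseteq> V \<Longrightarrow>
    f (xs @ u # ys @ u # zs) = 0"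
proof (induct ys arbitrary: xs)
  case Nil
  then show ?case using alt_formD2[OF assms(2), of xs zs u] assms by simp
next
  case (Cons y ys)
  have "f (xs @ u # y # (ys @ u # zs)) = - f (xs @ y # u # (ys @ u # zs))"
    by (rule alt_form_swap[OF assms(1,2)]) (use Cons.prems assms in auto)
  then show ?case using Cons.hyps[of "xs @ [y]"] Cons.prems by simp
qed

lemma alternating_form_imp_alt_form:
  assumes "alternating_form V (int n) f"
  shows "alt_form V n f"
  unfolding alt_form_def
proof (intro conjI allI impI; elim conjE)
  fix xs ys u w a b
  assume h: "Suc (length xs + length ys) = n" "set xs \<subseteq> V" "set ys \<subseteq> V" "u \<in> V" "w \<in> V"
  have "int (length (xs @ u # ys)) = int n \<and> set (xs @ u # ys) \<subseteq> V \<and>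
    length xs < length (xs @ u # ys) \<and> u \<in> V \<and> w \<in> V"
    using h by auto
  then have "f ((xs @ u # ys)[length xs := a *\<^sub>R u + b *\<^sub>R w]) =
    a * f ((xs @ u # ys)[length xs := u]) + b * f ((xs @ u # ys)[length xs := w])"
    using assms unfolding alternating_form_def by blast
  then show "f (xs @ (a *\<^sub>R u + b *\<^sub>R w) # ys) = a * f (xs @ u # ys) + b * f (xs @ w # ys)"
    by simp
next
  fix xs ys u
  assume h: "Suc (Suc (length xs + length ys)) = n" "set xs \<subseteq> V" "set ys \<subseteq> V" "u \<in> V"
  have "int (length (xs @ u # u # ys)) = int n \<and> set (xs @ u # u # ys) \<subseteq> V \<and>
    length xs < Suc (length xs) \<and>
     Suc (length xs) < length (xs @ u # u # ys) \<and> (xs @ u # u # ys) ! length xs =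
       (xs @ u # u # ys) ! Suc (length xs)"
    using h by (auto simp: nth_append)
  then show "f (xs @ u # u # ys) = 0"
    using assms unfolding alternating_form_def by blast
qed

text \<open>The cut-off supplies the value 0 that \<open>alternating_form\<close> prescribes outside
  its domain.\<close>

lemma alt_form_imp_alternating_form:
  assumes V: "subspace V" and f: "alt_form V n f"
  shows "alternating_form V (int n) (\<lambda>vs. if length vs = n \<and> set vs \<subseteq> V then f vs else 0)"
  unfolding alternating_form_def
proof (intro conjI allI impI; (elim conjE)?)
  fix vs i u w a b
  assume h: "int (length vs) = int n" "set vs \<subseteq> V" "i < length vs" "u \<in> V" "w \<in> V"
  have s: "set (take i vs) \<subseteq> V" "set (drop (Suc i) vs) \<subseteq> V"
    using h(2) set_take_subset set_drop_subset by fast+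
  have "a *\<^sub>R u + b *\<^sub>R w \<in> V" using V h by (simp add: subspace_add subspace_scale)
  then have "set (vs[i := u]) \<subseteq> V" "set (vs[i := w]) \<subseteq> V" "set (vs[i := a *\<^sub>R u + b *\<^sub>R w]) \<subseteq> V"
    using h by (auto dest!: set_update_subset_insert[THEN subsetD])
  moreover have "f (vs[i := a *\<^sub>R u + b *\<^sub>R w]) = a * f (vs[i := u]) + b * f (vs[i := w])"
    using alt_formD1[OF f _ s h(4,5)] h by (simp add: upd_conv_take_nth_drop)
  ultimately show "(if length (vs[i := a *\<^sub>R u + b *\<^sub>R w]) = n \<and> set (vs[i := a *\<^sub>R u + b *\<^sub>R w]) \<subseteq> V
       then f (vs[i := a *\<^sub>R u + b *\<^sub>R w]) else 0) =
     a * (if length (vs[i := u]) = n \<and> set (vs[i := u]) \<subseteq> V then f (vs[i := u]) else 0) +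
     b * (if length (vs[i := w]) = n \<and> set (vs[i := w]) \<subseteq> V then f (vs[i := w]) else 0)"
    using h by simp
next
  fix vs i j
  assume h: "int (length vs) = int n" "set vs \<subseteq> V" "i < j" "j < length vs" "vs ! i = vs ! j"
  let ?xs = "take i vs" and ?ys = "take (j - Suc i) (drop (Suc i) vs)" and ?zs = "drop (Suc j) vs"
  have "drop (Suc i) vs = ?ys @ drop (j - Suc i) (drop (Suc i) vs)"
    by (rule append_take_drop_id[symmetric])
  also have "drop (j - Suc i) (drop (Suc i) vs) = vs ! j # ?zs"
    using h by (simp add: Cons_nth_drop_Suc)
  finally have "vs = ?xs @ vs ! i # ?ys @ vs ! i # ?zs"
    using h(3-5) id_take_nth_drop[of i vs] by simp
  moreover have "f (?xs @ vs ! i # ?ys @ vs ! i # ?zs) = 0"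
  proof (rule alt_form_repeated[OF V f])
    show "vs ! i \<in> V" using h by auto
    show "set ?xs \<subseteq> V" "set ?zs \<subseteq> V" "set ?ys \<subseteq> V"
      using h(2) by (auto dest!: in_set_takeD in_set_dropD)
    show "Suc (Suc (length ?xs + length ?ys + length ?zs)) = n" using h by simp
  qed
  ultimately show "(if length vs = n \<and> set vs \<subseteq> V then f vs else 0) = 0"
    by simp
qed auto

text \<open>The common shape of the exterior derivative and of the product with a one-form.
  Recursion at the head of the list turns the signs into a subtraction and spares inductions the
  index arithmetic; \<open>asum_conv_sum\<close> gives the indexed form.\<close>

primrec asum :: "('a \<Rightarrow> 'a list \<Rightarrow> real) \<Rightarrow> 'a list \<Rightarrow> real" where
  "asum \<Phi> [] = 0"
| "asum \<Phi> (v # vs) = \<Phi> v vs - asum (\<lambda>u ws. \<Phi> u (v # ws)) vs"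

lemma asum_conv_sum:
  "asum \<Phi> vs = (\<Sum>i<length vs. (-1) ^ i * \<Phi> (vs ! i) (take i vs @ drop (Suc i) vs))"
proof (induct vs arbitrary: \<Phi>)
  case (Cons v vs)
  show ?case
    by (simp add: Cons sum.lessThan_Suc_shift sum_negf del: sum.lessThan_Suc)
qed simp

lemma asum_cong:
  "(\<And>u ws. u \<in> set vs \<Longrightarrow> set ws \<subseteq> set vs \<Longrightarrow> length vs = Suc (length ws) \<Longrightarrow> \<Phi> u ws = \<Psi> u ws) \<Longrightarrow>
    asum \<Phi> vs = asum \<Psi> vs"
proof (induct vs arbitrary: \<Phi> \<Psi>)
  case (Cons v vs)
  have "asum (\<lambda>u ws. \<Phi> u (v # ws)) vs = asum (\<lambda>u ws. \<Psi> u (v # ws)) vs"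
    by (rule Cons.hyps) (rule Cons.prems, auto)
  moreover have "\<Phi> v vs = \<Psi> v vs" by (rule Cons.prems) auto
  ultimately show ?case by simp
qed simp

lemma asum_add: "asum (\<lambda>u ws. \<Phi> u ws + \<Psi> u ws) vs = asum \<Phi> vs + asum \<Psi> vs"
  by (induct vs arbitrary: \<Phi> \<Psi>) auto

lemma asum_diff: "asum (\<lambda>u ws. \<Phi> u ws - \<Psi> u ws) vs = asum \<Phi> vs - asum \<Psi> vs"
  by (induct vs arbitrary: \<Phi> \<Psi>) auto

lemma asum_cmult: "asum (\<lambda>u ws. c * \<Phi> u ws) vs = c * asum \<Phi> vs"
  by (induct vs arbitrary: \<Phi>) (auto simp: algebra_simps)

lemma asum_minus: "asum (\<lambda>u ws. - \<Phi> u ws) vs = - asum \<Phi> vs"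
  using asum_cmult[of "-1"] by simp

lemma asum_zero: "asum (\<lambda>u ws. 0) vs = 0"
  by (induct vs) auto

lemma asum_sum: "asum (\<lambda>u ws. \<Sum>i\<in>I. \<Phi> i u ws) vs = (\<Sum>i\<in>I. asum (\<Phi> i) vs)"
  by (induct vs arbitrary: \<Phi>) (auto simp: sum_subtractf)

text \<open>Removing two entries in either order leaves the same list, but the second removal sees
  its position shifted by one in exactly one of the orders. Both d d = 0 and the sign in
  \<open>dform_wedge\<close> come from here.\<close>

lemma asum_antisymmetric:
  "asum (\<lambda>u. asum (\<lambda>w. \<Phi> u w)) vs = - asum (\<lambda>u. asum (\<lambda>w. \<Phi> w u)) vs"
proof (induct vs arbitrary: \<Phi>)
  case (Cons v vs)
  show ?case
    using Cons[of "\<lambda>u w zs. \<Phi> u w (v # zs)"] by (simp add: asum_diff)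
qed simp

lemma asum_append:
  "asum \<Phi> (xs @ ys) = asum (\<lambda>u ws. \<Phi> u (ws @ ys)) xs + (-1)
    ^ length xs * asum (\<lambda>u ws. \<Phi> u (xs @ ws)) ys"
  by (induct xs arbitrary: \<Phi>) auto

text \<open>For a list with two equal neighbours, every summand that removes another entry vanishes
  by \<open>alt\<close>, and the two that remove one of the neighbours agree up to opposite
  signs.\<close>

lemma alt_form_asum:
  assumes lin: "\<And>ws u w a b. length ws = n \<Longrightarrow> set ws \<subseteq> V \<Longrightarrow> u \<in> V \<Longrightarrow> w \<in> V \<Longrightarrow>
      \<Phi> (a *\<^sub>R u + b *\<^sub>R w) ws = a * \<Phi> u ws + b * \<Phi> w ws"
    and alt: "\<And>u. u \<in> V \<Longrightarrow> alt_form V n (\<Phi> u)"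
  shows "alt_form V (Suc n) (asum \<Phi>)"
  unfolding alt_form_def
proof (intro conjI allI impI; elim conjE)
  fix xs ys u w a b
  assume h: "Suc (length xs + length ys) = Suc n" "set xs \<subseteq> V" "set ys \<subseteq> V" "u \<in> V" "w \<in> V"
  let ?z = "a *\<^sub>R u + b *\<^sub>R w"
  have 1: "asum (\<lambda>r ws. \<Phi> r (ws @ ?z # ys)) xs =
     asum (\<lambda>r ws. a * \<Phi> r (ws @ u # ys) + b * \<Phi> r (ws @ w # ys)) xs"
    by (rule asum_cong, rule alt_formD1[OF alt]) (use h in auto)
  have 2: "asum (\<lambda>r ws. \<Phi> r (xs @ ?z # ws)) ys =
     asum (\<lambda>r ws. a * \<Phi> r (xs @ u # ws) + b * \<Phi> r (xs @ w # ws)) ys"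
    by (rule asum_cong, rule alt_formD1[OF alt]) (use h in auto)
  have 3: "\<Phi> ?z (xs @ ys) = a * \<Phi> u (xs @ ys) + b * \<Phi> w (xs @ ys)"
    by (rule lin) (use h in auto)
  show "asum \<Phi> (xs @ ?z # ys) = a * asum \<Phi> (xs @ u # ys) + b * asum \<Phi> (xs @ w # ys)"
    unfolding asum_append asum.simps using 1 2 3 by (simp add: asum_add asum_cmult algebra_simps)
next
  fix xs ys u
  assume h: "Suc (Suc (length xs + length ys)) = Suc n" "set xs \<subseteq> V" "set ys \<subseteq> V" "u \<in> V"
  have 1: "asum (\<lambda>r ws. \<Phi> r (ws @ u # u # ys)) xs = asum (\<lambda>r ws. 0) xs"
    by (rule asum_cong, rule alt_formD2[OF alt]) (use h in auto)
  have 2: "asum (\<lambda>r ws. \<Phi> r (xs @ u # u # ws)) ys = asum (\<lambda>r ws. 0) ys"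
    by (rule asum_cong, rule alt_formD2[OF alt]) (use h in auto)
  show "asum \<Phi> (xs @ u # u # ys) = 0"
    unfolding asum_append asum.simps using 1 2 by (simp add: asum_zero)
qed

text \<open>The entry removed at position i is put back in front, which takes i transpositions;
  their sign cancels the sign of the summand, so all summands are equal. This produces the degree as
  a factor in the cone formula.\<close>

lemma asum_insert:
  assumes V: "subspace V" and f: "alt_form V n f"
  shows "length xs + length vs = n \<Longrightarrow> set xs \<subseteq> V \<Longrightarrow> set vs \<subseteq> V \<Longrightarrow>
    asum (\<lambda>u ws. f (xs @ u # ws)) vs = real (length vs) * f (xs @ vs)"
proof (induct vs arbitrary: xs)
  case (Cons v vs)
  have "asum (\<lambda>u ws. f (xs @ u # v # ws)) vs = asum (\<lambda>u ws. - f ((xs @ [v]) @ u # ws)) vs"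
    by (intro asum_cong) (use Cons.prems in \<open>auto intro!: alt_form_swap[OF V f]\<close>)
  then show ?case
    using Cons.hyps[of "xs @ [v]"] Cons.prems by (simp add: asum_minus algebra_simps)
qed simp

lemma alt_form_Cons:
  assumes f: "alt_form V (Suc n) f" and e: "e \<in> V"
  shows "alt_form V n (\<lambda>vs. f (e # vs))"
  unfolding alt_form_def
proof (intro conjI allI impI; elim conjE)
  fix xs ys u w a b
  assume "Suc (length xs + length ys) = n" "set xs \<subseteq> V" "set ys \<subseteq> V" "u \<in> V" "w \<in> V"
  then show "f (e # xs @ (a *\<^sub>R u + b *\<^sub>R w) # ys) = a * f (e # xs @ u # ys) + b * f (e # xs @ w # ys)"
    using alt_formD1[OF f, of "e # xs" ys u w a b] e by simp
next
  fix xs ys u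
  assume "Suc (Suc (length xs + length ys)) = n" "set xs \<subseteq> V" "set ys \<subseteq> V" "u \<in> V"
  then show "f (e # xs @ u # u # ys) = 0"
    using alt_formD2[OF f, of "e # xs" ys u] e by simp
qed

lemma alt_form_lincomb:
  assumes "alt_form V n f" "alt_form V n g"
  shows "alt_form V n (\<lambda>vs. a * f vs + b * g vs)"
  using assms unfolding alt_form_def by (auto simp: algebra_simps)

lemma alt_form_zero: "alt_form V n (\<lambda>vs. 0)"
  unfolding alt_form_def by simp

lemma alt_form_sum:
  "(\<And>i. i \<in> I \<Longrightarrow> alt_form V n (f i)) \<Longrightarrow> alt_form V n (\<lambda>vs. \<Sum>i\<in>I. f i vs)"
proof (induct I rule: infinite_finite_induct)
  case (insert i I)
  then show ?case using alt_form_lincomb[of V n "f i" "\<lambda>vs. \<Sum>i\<in>I. f i vs" 1 1] by simp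
qed (auto simp: alt_form_zero)

section \<open>Lifting to coverings\<close>

lemma evenly_coveredE:
  assumes "covering_space Xt p X" "x \<in> X"
  obtains N \<V> where "x \<in> N" "openin (top_of_set X) N" "\<Union>\<V> = Xt \<inter> p -` N"
    "\<And>u. u \<in> \<V> \<Longrightarrow> openin (top_of_set Xt) u" "pairwise disjnt \<V>"
    "\<And>u. u \<in> \<V> \<Longrightarrow> \<exists>q. homeomorphism u N p q"
proof -
  have "\<exists>N. x \<in> N \<and> openin (top_of_set X) N \<and> (\<exists>\<V>. \<Union>\<V> = Xt \<inter> p -` N \<and>
      (\<forall>u\<in>\<V>. openin (top_of_set Xt) u) \<and> pairwise disjnt \<V> \<and> (\<forall>u\<in>\<V>. \<exists>q. homeomorphism u N p q))"
    using assms unfolding covering_space_def by (elim conjE) (erule bspec)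
  then show thesis by (elim exE conjE) (rule that, auto)
qed

text \<open>Agreement of the lifts is a locally constant property. Near a point each lift stays in
  one sheet over an evenly covered set: a common sheet forces agreement by injectivity, and
  different sheets exclude it because they are disjoint, which takes the place of a separation axiom
  on \<open>Xt\<close>.\<close>

lemma covering_lift_unique:
  fixes g1 g2 :: "'c::topological_space \<Rightarrow> 'b::topological_space"
  assumes cov: "covering_space Xt p X" and T: "connected T"
    and g1: "continuous_on T g1" "g1 ` T \<subseteq> Xt" and g2: "continuous_on T g2" "g2 ` T \<subseteq> Xt"
    and eq: "\<And>x. x \<in> T \<Longrightarrow> p (g1 x) = p (g2 x)"
    and a: "a \<in> T" "g1 a = g2 a" and x: "x \<in> T"
  shows "g1 x = g2 x"
proof -
  have loc: "eventually (\<lambda>y. (g1 z = g2 z) = (g1 y = g2 y)) (at z within T)" if z: "z \<in> T" for z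
  proof -
    have "p (g1 z) \<in> X" using covering_space_imp_surjective[OF cov] g1(2) z by blast
    then obtain N \<V> where "p (g1 z) \<in> N" "openin (top_of_set X) N" and N: "\<Union>\<V> = Xt \<inter> p -` N"
      "\<And>u. u \<in> \<V> \<Longrightarrow> openin (top_of_set Xt) u" "pairwise disjnt \<V>"
      "\<And>u. u \<in> \<V> \<Longrightarrow> \<exists>q. homeomorphism u N p q"
      by (rule evenly_coveredE[OF cov]) blast
    have "g1 z \<in> \<Union>\<V>" "g2 z \<in> \<Union>\<V>" using \<open>p (g1 z) \<in> N\<close> N(1) eq[OF z] g1(2) g2(2) z by auto
    then obtain u1 u2 where u: "u1 \<in> \<V>" "g1 z \<in> u1" "u2 \<in> \<V>" "g2 z \<in> u2" by blast
    obtain O1 where O1: "open O1" "u1 = Xt \<inter> O1" using N(2)[OF u(1)] by (auto simp: openin_open)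
    obtain O2 where O2: "open O2" "u2 = Xt \<inter> O2" using N(2)[OF u(3)] by (auto simp: openin_open)
    have inT: "eventually (\<lambda>y. y \<in> T) (at z within T)" by (simp add: eventually_at_filter)
    have e1: "eventually (\<lambda>y. g1 y \<in> O1) (at z within T)"
      using g1(1) z O1 u(2) by (intro topological_tendstoD[where l="g1 z"])
        (auto simp: continuous_on_def)
    have e2: "eventually (\<lambda>y. g2 y \<in> O2) (at z within T)"
      using g2(1) z O2 u(4) by (intro topological_tendstoD[where l="g2 z"])
        (auto simp: continuous_on_def)
    have mem: "eventually (\<lambda>y. y \<in> T \<and> g1 y \<in> u1 \<and> g2 y \<in> u2) (at z within T)"
      using inT e1 e2 by eventually_elim (use O1(2) O2(2) g1(2) g2(2) in auto)
    show ?thesis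
    proof (cases "u1 = u2")
      case True
      obtain q where "homeomorphism u1 N p q" using N(4)[OF u(1)] by blast
      then have inj: "\<And>a b. a \<in> u1 \<Longrightarrow> b \<in> u1 \<Longrightarrow> p a = p b \<Longrightarrow> a = b"
        by (metis homeomorphism_apply1)
      have "g1 z = g2 z" using inj u True eq[OF z] by blast
      then show ?thesis using inj True eq by (intro eventually_mono[OF mem]) blast
    next
      case False
      then have "disjnt u1 u2" using N(3) u unfolding pairwise_def by blast
      then have d: "\<And>a b. a \<in> u1 \<Longrightarrow> b \<in> u2 \<Longrightarrow> a \<noteq> b" by (auto simp: disjnt_def)
      have "g1 z \<noteq> g2 z" using d u by blast
      then show ?thesis using d by (intro eventually_mono[OF mem]) blast
    qed
  qed
  have "(g1 a = g2 a) = (g1 x = g2 x)"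
    by (rule connected_local_const[OF T a(1) x]) (use loc in blast)
  then show ?thesis using a by simp
qed

text \<open>Prescribing the lift at an arbitrary point, not at a fixed base point, is what allows
  lifts over pieces to be continued from one piece into the next.\<close>

definition liftable :: "'b::topological_space set \<Rightarrow> ('b \<Rightarrow> 'a) \<Rightarrow> ('c::topological_space \<Rightarrow> 'a)
  \<Rightarrow> 'c set \<Rightarrow> bool" where
  "liftable Xt p f A \<longleftrightarrow> (\<forall>c\<in>A. \<forall>y\<in>Xt. p y = f c \<longrightarrow>
     (\<exists>g. continuous_on A g \<and> g ` A \<subseteq> Xt \<and> g c = y \<and> (\<forall>z\<in>A. p (g z) = f z)))"

text \<open>A lift over one piece fixes the value at a common point, from which the other piece is
  lifted; the two agree on the connected intersection by uniqueness.\<close>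

lemma liftable_Un:
  assumes cov: "covering_space Xt p X" and AB: "closed A" "closed B" "connected (A \<inter> B)" "A \<inter> B \<noteq> {}"
    and l: "liftable Xt p f A" "liftable Xt p f B"
  shows "liftable Xt p f (A \<union> B)"
proof -
  have one: "\<exists>g. continuous_on (A \<union> B) g \<and> g ` (A \<union> B) \<subseteq> Xt \<and> g c = y \<and> (\<forall>z\<in>A \<union> B. p (g z) = f z)"
    if AB: "closed A" "closed B" "connected (A \<inter> B)" "A \<inter> B \<noteq> {}"
      and l: "liftable Xt p f A" "liftable Xt p f B" and c: "c \<in> A" "y \<in> Xt" "p y = f c" for A B c y
  proof -
    obtain g where g: "continuous_on A g" "g ` A \<subseteq> Xt" "g c = y" "\<And>z. z \<in> A \<Longrightarrow> p (g z) = f z"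
      using l(1) c unfolding liftable_def by meson
    obtain w where w: "w \<in> A" "w \<in> B" using AB by auto
    have "g w \<in> Xt" "p (g w) = f w" using g w by auto
    then obtain h where h: "continuous_on B h" "h ` B \<subseteq> Xt" "h w = g w" "\<And>z. z \<in> B \<Longrightarrow> p (h z) = f z"
      using l(2) w unfolding liftable_def by meson
    have agree: "g x = h x" if "x \<in> A \<inter> B" for x
      by (rule covering_lift_unique[OF cov AB(3) _ _ _ _ _ _ _ that, of g h w])
        (use g h w in \<open>auto intro: continuous_on_subset\<close>)
    have "continuous_on (A \<union> B) (\<lambda>x. if x \<in> A then g x else h x)"
      by (rule continuous_on_cases) (use AB g h agree in auto)
    then show ?thesis
      by (intro exI[of _ "\<lambda>x. if x \<in> A then g x else h x"]) (use g h c in auto)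
  qed
  show ?thesis
    unfolding liftable_def
  proof (intro ballI impI)
    fix c y assume c: "c \<in> A \<union> B" "y \<in> Xt" "p y = f c"
    show "\<exists>g. continuous_on (A \<union> B) g \<and> g ` (A \<union> B) \<subseteq> Xt \<and> g c = y \<and> (\<forall>z\<in>A \<union> B. p (g z) = f z)"
    proof (cases "c \<in> A")
      case True then show ?thesis using one[OF AB l True c(2,3)] by blast
    next
      case False
      then have "c \<in> B" using c by blast
      moreover have "connected (B \<inter> A)" "B \<inter> A \<noteq> {}" using AB(3,4) by (simp_all add: Int_commute)
      ultimately show ?thesis using one[OF AB(2,1) _ _ l(2,1) _ c(2,3)] by (simp add: Un_commute)
    qed
  qed
qed

lemma liftable_evenly_covered:
  assumes N: "\<Union>\<V> = Xt \<inter> p -` N" "\<And>u. u \<in> \<V> \<Longrightarrow> \<exists>q. homeomorphism u N p q"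
    and f: "continuous_on A f" "f ` A \<subseteq> N"
  shows "liftable Xt p f A"
  unfolding liftable_def
proof (intro ballI impI)
  fix c y assume c: "c \<in> A" "y \<in> Xt" "p y = f c"
  then have "y \<in> \<Union>\<V>" using N(1) f(2) by auto
  then obtain u q where u: "u \<in> \<V>" "y \<in> u" and q: "homeomorphism u N p q" using N(2) by blast
  show "\<exists>g. continuous_on A g \<and> g ` A \<subseteq> Xt \<and> g c = y \<and> (\<forall>z\<in>A. p (g z) = f z)"
  proof (intro exI[of _ "q \<circ> f"] conjI ballI)
    show "continuous_on A (q \<circ> f)"
      using f q by (intro continuous_on_compose) (auto simp: homeomorphism_def intro:
        continuous_on_subset)
    have "u \<subseteq> Xt" using u N(1) by blast
    moreover have "q ` N = u" using q by (simp add: homeomorphism_def)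
    ultimately show "(q \<circ> f) ` A \<subseteq> Xt" using f(2) by auto
    show "(q \<circ> f) c = y" using c(3) q u(2) by (metis comp_apply homeomorphism_apply1)
    show "p ((q \<circ> f) z) = f z" if "z \<in> A" for z
      using that f(2) q by (auto simp: homeomorphism_def)
  qed
qed

text \<open>Existence by bisection: cutting along hyperplanes orthogonal to the coordinate axes keeps all
  pieces and their intersections convex, so that lifts over small pieces can be glued.\<close>

lemma covering_lift_exists:
  fixes C :: "'c::euclidean_space set" and p :: "'b::topological_space \<Rightarrow> 'a::topological_space"
  assumes cov: "covering_space Xt p X" and C: "compact C" "convex C"
    and f: "continuous_on C f" "f ` C \<subseteq> X"
  shows "liftable Xt p f C"
proof (cases "C = {}")
  case True
  then show ?thesis by (simp add: liftable_def)
next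
  case False
  define E where "E N \<longleftrightarrow> (\<exists>\<V>. \<Union>\<V> = Xt \<inter> p -` N \<and> (\<forall>u\<in>\<V>. \<exists>q. homeomorphism u N p q))" for N
  define \<C> where "\<C> = {U. open U \<and> (\<exists>N. E N \<and> f ` (C \<inter> U) \<subseteq> N)}"
  have cover: "\<exists>U\<in>\<C>. c \<in> U" if c: "c \<in> C" for c
  proof -
    have "f c \<in> X" using f(2) c by blast
    then obtain N \<V> where N: "f c \<in> N" "openin (top_of_set X) N" "\<Union>\<V> = Xt \<inter> p -` N"
      "\<And>u. u \<in> \<V> \<Longrightarrow> \<exists>q. homeomorphism u N p q"
      by (rule evenly_coveredE[OF cov]) blast
    obtain O1 where O1: "open O1" "N = X \<inter> O1" using N(2) by (auto simp: openin_open)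
    obtain U where U: "open U" "U \<inter> C = f -` O1 \<inter> C"
      using f(1) O1(1) unfolding continuous_on_open_invariant by meson
    have "f ` (C \<inter> U) \<subseteq> N" using U O1 f(2) by blast
    moreover have "E N" unfolding E_def by (intro exI[of _ \<V>] conjI ballI N(3,4))
    ultimately have "U \<in> \<C>" unfolding \<C>_def using U(1) by blast
    moreover have "c \<in> U" using U(2) c N(1) O1(2) by blast
    ultimately show ?thesis by blast
  qed
  obtain \<delta> where d: "0 < \<delta>" "\<And>A. A \<subseteq> C \<Longrightarrow> diameter A < \<delta> \<Longrightarrow> \<exists>U\<in>\<C>. A \<subseteq> U"
  proof (rule Lebesgue_number_lemma[OF C(1), of \<C>])
    show "\<C> \<noteq> {}" "C \<subseteq> \<Union>\<C>" using cover False by blast+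
    show "open B" if "B \<in> \<C>" for B using that by (simp add: \<C>_def)
  qed (rule that)
  \<comment> \<open>A set of width at most \<open>e\<close> in each coordinate has diameter at most
    \<open>DIM('c) * e\<close>, which is half of the Lebesgue number.\<close>
  define e where "e = \<delta> / (2 * real DIM('c))"
  have e: "e > 0" using d(1) by (simp add: e_def)
  have small: "liftable Xt p f A" if A: "A \<subseteq> C" "\<And>b. b \<in> Basis \<Longrightarrow> \<exists>u. \<forall>x\<in>A. x \<bullet> b \<in> {u..u + e}" for A
  proof -
    have "norm (x - y) \<le> real DIM('c) * e" if xy: "x \<in> A" "y \<in> A" for x y
    proof -
      have "norm (x - y) \<le> (\<Sum>b\<in>Basis. \<bar>(x - y) \<bullet> b\<bar>)" by (rule norm_le_l1)
      also have "\<dots> \<le> (\<Sum>b\<in>(Basis::'c set). e)"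
      proof (rule sum_mono)
        fix b :: 'c assume "b \<in> Basis"
        then obtain u where "\<forall>x\<in>A. x \<bullet> b \<in> {u..u + e}" using A(2) by blast
        then have "u \<le> x \<bullet> b" "x \<bullet> b \<le> u + e" "u \<le> y \<bullet> b" "y \<bullet> b \<le> u + e" using xy by auto
        then show "\<bar>(x - y) \<bullet> b\<bar> \<le> e" by (simp add: inner_diff_left abs_le_iff)
      qed
      finally show ?thesis by simp
    qed
    then have "diameter A \<le> real DIM('c) * e"
      using e by (intro diameter_le) auto
    also have "\<dots> < \<delta>" using d(1) by (simp add: e_def)
    finally obtain U where "U \<in> \<C>" "A \<subseteq> U" using d(2)[OF A(1)] by blast
    then obtain N where N: "E N" "f ` A \<subseteq> N"
      using A(1) unfolding \<C>_def by blast
    obtain \<V> where V: "\<Union>\<V> = Xt \<inter> p -` N" "\<forall>u\<in>\<V>. \<exists>q. homeomorphism u N p q"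
      using N(1) unfolding E_def by (elim exE conjE)
    show ?thesis
      by (rule liftable_evenly_covered[OF V(1) bspec[OF V(2)] continuous_on_subset[OF f(1) A(1)] N(2)])
  qed
  \<comment> \<open>\<open>F\<close> collects the coordinates in which the piece has not yet been
    cut down to width \<open>e\<close>.\<close>
  have main: "liftable Xt p f A"
    if "finite F" "F \<subseteq> Basis" "closed A" "convex A" "A \<subseteq> C"
      "\<And>b. b \<in> Basis - F \<Longrightarrow> \<exists>u. \<forall>x\<in>A. x \<bullet> b \<in> {u..u + e}" for F and A
    using that
  proof (induct F arbitrary: A rule: finite_induct)
    case empty
    then show ?case by (intro small) auto
  next
    case (insert b F)
    \<comment> \<open>Bisection in the single coordinate \<open>b\<close>: a slab of width
      \<open>2 ^ Suc n * e\<close> is cut into two of width \<open>2 ^ n * e\<close>.\<close>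
    have step: "liftable Xt p f B" if "closed B" "convex B" "B \<subseteq> A"
      "\<forall>x\<in>B. x \<bullet> b \<in> {u..u + 2 ^ n * e}" for B n u
      using that
    proof (induct n arbitrary: B u)
      case 0
      show ?case
      proof (rule insert.hyps(3))
        fix b' assume b': "b' \<in> Basis - F"
        show "\<exists>u. \<forall>x\<in>B. x \<bullet> b' \<in> {u..u + e}"
        proof (cases "b' = b")
          case True then show ?thesis using 0 by auto
        next
          case False
          then have "\<exists>u. \<forall>x\<in>A. x \<bullet> b' \<in> {u..u + e}" using insert.prems(5)[of b'] b' by auto
          then show ?thesis using 0(3) by blast
        qed
      qed (use insert.prems 0 in auto)
    next
      case (Suc n)
      let ?m = "u + 2 ^ n * e"
      let ?A = "B \<inter> {x. b \<bullet> x \<le> ?m}" and ?B = "B \<inter> {x. b \<bullet> x \<ge> ?m}"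
      have cl: "closed ?A" "closed ?B" "convex ?A" "convex ?B"
        using Suc.prems by (auto intro!: closed_Int convex_Int closed_halfspace_le closed_halfspace_ge
            convex_halfspace_le convex_halfspace_ge)
      have un: "?A \<union> ?B = B" by auto
      have lA: "liftable Xt p f ?A"
        by (rule Suc.hyps[OF cl(1,3), of u]) (use Suc.prems in \<open>auto simp: inner_commute\<close>)
      have lB: "liftable Xt p f ?B"
        by (rule Suc.hyps[OF cl(2,4), of ?m]) (use Suc.prems in \<open>auto simp: inner_commute mult_ac
          add_ac\<close>)
      show ?case
      \<comment> \<open>Gluing needs a common point. It lies on the cutting hyperplane, and the
        intermediate value property provides it when both halves are inhabited.\<close>
      proof (cases "?A = {} \<or> ?B = {}")
        case True
        then show ?thesis using lA lB un by (metis sup_bot.left_neutral sup_bot.right_neutral)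
      next
        case False
        then obtain x y where "x \<in> ?A" "y \<in> ?B" by blast
        then obtain z where "z \<in> B" "b \<bullet> z = ?m"
          using connected_ivt_hyperplane[of B x y b ?m] convex_connected[OF Suc.prems(2)] by auto
        then have "?A \<inter> ?B \<noteq> {}" by auto
        then show ?thesis
          using liftable_Un[OF cov cl(1,2) convex_connected[OF convex_Int[OF cl(3,4)]] _ lA lB]
            un by simp
      qed
    qed
    have "bounded A" using C(1) insert.prems(4) bounded_subset compact_imp_bounded by blast
    then obtain M where M: "\<And>x. x \<in> A \<Longrightarrow> norm x \<le> M" unfolding bounded_iff by blast
    obtain n where n: "2 * M / e < 2 ^ n" using real_arch_pow[of 2 "2 * M / e"] by auto
    have "x \<bullet> b \<in> {-M..-M + 2 ^ n * e}" if "x \<in> A" for x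
    proof -
      have "\<bar>x \<bullet> b\<bar> \<le> M" using Basis_le_norm[of b x] M[OF that] insert.prems(1) by auto
      moreover have "2 * M < 2 ^ n * e" using n e by (simp add: field_simps)
      ultimately show ?thesis by auto
    qed
    then show ?case using step[OF insert.prems(2,3), of "-M" n] by blast
  qed
  show ?thesis
    by (rule main[of Basis]) (use C in \<open>auto simp: compact_imp_closed\<close>)
qed

section \<open>Parallel transport along paths\<close>

definition transport :: "'b::topological_space set \<Rightarrow> ('b \<Rightarrow> 'a) \<Rightarrow> (real \<Rightarrow> 'a) \<Rightarrow> 'b \<Rightarrow> 'b" where
  "transport Xt p q y = (SOME z. \<exists>r. path r \<and> path_image r \<subseteq> Xt \<and> pathstart r = y \<and> pathfinish r = z \<and>
     (\<forall>t\<in>{0..1}. p (r t) = q t))"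

lemma covering_path_lift:
  fixes p :: "'b::topological_space \<Rightarrow> 'a::topological_space"
  assumes cov: "covering_space Xt p X" and q: "path q" "path_image q \<subseteq> X" and y: "y \<in> Xt" "p y =
    pathstart q"
  obtains r where "path r" "path_image r \<subseteq> Xt" "pathstart r = y" "\<And>t. t \<in> {0..1} \<Longrightarrow> p (r t) = q t"
proof -
  have "liftable Xt p q {0..1}"
    by (rule covering_lift_exists[OF cov]) (use q in \<open>auto simp: path_def path_image_def\<close>)
  moreover have "(0::real) \<in> {0..1}" by simp
  moreover have "p y = q 0" using y(2) by (simp add: pathstart_def)
  ultimately have "\<exists>g. continuous_on {0..1} g \<and> g ` {0..1} \<subseteq> Xt \<and> g 0 = y \<and> (\<forall>z\<in>{0..1}. p (g z) = q z)"
    using y(1) unfolding liftable_def by blast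
  then show thesis using that unfolding path_def path_image_def pathstart_def by blast
qed

text \<open>Later transports are computed by exhibiting some lift of the path; uniqueness of lifts
  makes its end the chosen value.\<close>

lemma transport_eq:
  assumes cov: "covering_space Xt p X"
    and r: "path r" "path_image r \<subseteq> Xt" "\<And>t. t \<in> {0..1} \<Longrightarrow> p (r t) = q t"
  shows "transport Xt p q (pathstart r) = pathfinish r"
  unfolding transport_def
proof (rule some_equality)
  show "\<exists>s. path s \<and> path_image s \<subseteq> Xt \<and> pathstart s = pathstart r \<and> pathfinish s = pathfinish r \<and>
     (\<forall>t\<in>{0..1}. p (s t) = q t)" using r by blast
  fix z assume "\<exists>s. path s \<and> path_image s \<subseteq> Xt \<and> pathstart s = pathstart r \<and> pathfinish s = z \<and>
     (\<forall>t\<in>{0..1}. p (s t) = q t)"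
  then obtain s where s: "path s" "path_image s \<subseteq> Xt" "pathstart s = pathstart r" "pathfinish s = z"
    "\<And>t. t \<in> {0..1} \<Longrightarrow> p (s t) = q t" by blast
  have "s 1 = r 1"
    by (rule covering_lift_unique[OF cov, of "{0..1}" s r 0])
      (use r s in \<open>auto simp: path_def path_image_def pathstart_def\<close>)
  then show "z = pathfinish r" using s(4) by (simp add: pathfinish_def)
qed

lemma transport_mem:
  assumes cov: "covering_space Xt p X" and q: "path q" "path_image q \<subseteq> X" and y: "y \<in> Xt" "p y =
    pathstart q"
  shows "transport Xt p q y \<in> Xt" "p (transport Xt p q y) = pathfinish q"
proof -
  obtain r where r: "path r" "path_image r \<subseteq> Xt" "pathstart r = y" "\<And>t. t \<in> {0..1} \<Longrightarrow> p (r t) = q t"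
    using covering_path_lift[OF assms] by metis
  have "transport Xt p q y = pathfinish r" using transport_eq[OF cov r(1,2,4)] r(3) by simp
  then show "transport Xt p q y \<in> Xt" "p (transport Xt p q y) = pathfinish q"
    using r(2) r(4)[of 1] by (auto simp: pathfinish_def path_image_def)
qed

lemma transport_join:
  assumes cov: "covering_space Xt p X" and q: "path q" "path_image q \<subseteq> X" and y: "y \<in> Xt" "p y =
    pathstart q"
    and q': "path q'" "path_image q' \<subseteq> X" "pathstart q' = pathfinish q"
  shows "transport Xt p (q +++ q') y = transport Xt p q' (transport Xt p q y)"
proof -
  obtain r where r: "path r" "path_image r \<subseteq> Xt" "pathstart r = y" "\<And>t. t \<in> {0..1} \<Longrightarrow> p (r t) = q t"
    using covering_path_lift[OF cov q y] by metis
  have e: "transport Xt p q y = pathfinish r" using transport_eq[OF cov r(1,2,4)] r(3) by simp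
  have y': "pathfinish r \<in> Xt" "p (pathfinish r) = pathstart q'"
    using transport_mem[OF cov q y] e q'(3) by auto
  obtain r' where r': "path r'" "path_image r' \<subseteq> Xt" "pathstart r' = pathfinish r"
    "\<And>t. t \<in> {0..1} \<Longrightarrow> p (r' t) = q' t"
    using covering_path_lift[OF cov q'(1,2) y'] by metis
  have e': "transport Xt p q' (pathfinish r) = pathfinish r'"
    using transport_eq[OF cov r'(1,2,4)] r'(3) by simp
  have "transport Xt p (q +++ q') (pathstart (r +++ r')) = pathfinish (r +++ r')"
  proof (rule transport_eq[OF cov])
    show "path (r +++ r')" using r r' by simp
    show "path_image (r +++ r') \<subseteq> Xt" using r r' by (simp add: subset_path_image_join)
    show "p ((r +++ r') t) = (q +++ q') t" if "t \<in> {0..1}" for t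
      using that r(4)[of "2 * t"] r'(4)[of "2 * t - 1"] by (auto simp: joinpaths_def)
  qed
  then show ?thesis using e e' r(3) by simp
qed

lemma transport_reversepath:
  assumes cov: "covering_space Xt p X" and q: "path q" "path_image q \<subseteq> X" and y: "y \<in> Xt" "p y =
    pathstart q"
  shows "transport Xt p (reversepath q) (transport Xt p q y) = y"
proof -
  obtain r where r: "path r" "path_image r \<subseteq> Xt" "pathstart r = y" "\<And>t. t \<in> {0..1} \<Longrightarrow> p (r t) = q t"
    using covering_path_lift[OF cov q y] by metis
  have e: "transport Xt p q y = pathfinish r" using transport_eq[OF cov r(1,2,4)] r(3) by simp
  have "transport Xt p (reversepath q) (pathstart (reversepath r)) = pathfinish (reversepath r)"
  proof (rule transport_eq[OF cov])
    show "path (reversepath r)" "path_image (reversepath r) \<subseteq> Xt" using r by simp_all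
    show "p (reversepath r t) = reversepath q t" if "t \<in> {0..1}" for t
      using r(4)[of "1 - t"] that by (simp add: reversepath_def)
  qed
  then show ?thesis using e r(3) by simp
qed

text \<open>The homotopy is a map on a square and lifts as a whole, starting at a corner. The two
  sides on which the homotopy fixes the endpoints lift to constant paths, so the lifts of
  \<open>q\<close> and \<open>q'\<close> start and end together.\<close>

lemma transport_homotopic:
  fixes p :: "'b::topological_space \<Rightarrow> 'a::topological_space"
  assumes cov: "covering_space Xt p X" and hom: "homotopic_paths X q q'" and y: "y \<in> Xt" "p y =
    pathstart q"
  shows "transport Xt p q y = transport Xt p q' y"
proof -
  obtain h :: "real \<times> real \<Rightarrow> 'a" where h: "continuous_on ({0..1} \<times> {0..1}) h"
    "h \<in> ({0..1} \<times> {0..1}) \<rightarrow> X"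
    "\<And>x. x \<in> {0..1} \<Longrightarrow> h (0, x) = q x" "\<And>x. x \<in> {0..1} \<Longrightarrow> h (1, x) = q' x"
    "\<And>t. t \<in> {0..1} \<Longrightarrow> pathstart (h \<circ> Pair t) = pathstart q"
    "\<And>t. t \<in> {0..1} \<Longrightarrow> pathfinish (h \<circ> Pair t) = pathfinish q"
    using hom unfolding homotopic_paths by blast
  have h0: "h (t, 0) = q 0" and h1: "h (t, 1) = q 1" if "t \<in> {0..1}" for t
    using h(5,6)[OF that] by (auto simp: pathstart_def pathfinish_def)
  have "liftable Xt p h ({0..1::real} \<times> {0..1::real})"
    by (rule covering_lift_exists[OF cov]) (use h in \<open>auto intro: compact_Times convex_Times\<close>)
  then have "\<exists>k. continuous_on ({0..1::real} \<times> {0..1::real}) k \<and> k ` ({0..1} \<times> {0..1}) \<subseteq> Xt \<and>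
    k (0, 0) = y \<and>
      (\<forall>z\<in>{0..1} \<times> {0..1}. p (k z) = h z)"
    unfolding liftable_def using y h(3)[of 0] by (auto simp: pathstart_def)
  then obtain k where k: "continuous_on ({0..1::real} \<times> {0..1::real}) k"
    "k ` ({0..1} \<times> {0..1}) \<subseteq> Xt" "k (0, 0) = y"
    "\<And>t s. t \<in> {0..1} \<Longrightarrow> s \<in> {0..1} \<Longrightarrow> p (k (t, s)) = h (t, s)" by force
  have kX: "k (t, s) \<in> Xt" if "t \<in> {0..1}" "s \<in> {0..1}" for t s using k(2) that by blast
  have ct: "continuous_on {0..1} (\<lambda>s. k (t, s))" if "t \<in> {0..1}" for t
    by (rule continuous_on_compose2[OF k(1)]) (use that in \<open>auto intro!: continuous_intros\<close>)
  have cs: "continuous_on {0..1} (\<lambda>t. k (t, s))" if "s \<in> {0..1}" for s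
    by (rule continuous_on_compose2[OF k(1)]) (use that in \<open>auto intro!: continuous_intros\<close>)
  have c0: "k (1, 0) = k (0, 0)"
    by (rule covering_lift_unique[OF cov, of "{0..1}" "\<lambda>t. k (t, 0)" "\<lambda>t. k (0, 0)" 0 1])
      (use cs kX k(4) h0 in \<open>auto\<close>)
  have c1: "k (1, 1) = k (0, 1)"
    by (rule covering_lift_unique[OF cov, of "{0..1}" "\<lambda>t. k (t, 1)" "\<lambda>t. k (0, 1)" 0 1])
      (use cs kX k(4) h1 in \<open>auto\<close>)
  have 0: "transport Xt p q (pathstart (\<lambda>s. k (0, s))) = pathfinish (\<lambda>s. k (0, s))"
    by (rule transport_eq[OF cov]) (use ct kX k(4) h(3) in \<open>auto simp: path_def path_image_def\<close>)
  have 1: "transport Xt p q' (pathstart (\<lambda>s. k (1, s))) = pathfinish (\<lambda>s. k (1, s))"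
    by (rule transport_eq[OF cov]) (use ct kX k(4) h(4) in \<open>auto simp: path_def path_image_def\<close>)
  show ?thesis using 0 1 c0 c1 k(3) by (simp add: pathstart_def pathfinish_def)
qed

section \<open>Transport-invariant means and sheets\<close>

definition fibre :: "'b set \<Rightarrow> ('b \<Rightarrow> 'a) \<Rightarrow> 'a \<Rightarrow> 'b set" where
  "fibre Xt p b = {y \<in> Xt. p y = b}"

lemma transport_in_fibre:
  assumes "covering_space Xt p X" "path q" "path_image q \<subseteq> X" "y \<in> fibre Xt p (pathstart q)"
  shows "transport Xt p q y \<in> fibre Xt p (pathfinish q)"
  using transport_mem[OF assms(1-3)] assms(4) by (auto simp: fibre_def)

lemma loop_homotopy_refl: "c \<in> loops_at X x0 \<Longrightarrow> (c, c) \<in> loop_homotopy X x0"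
  by (simp add: loop_homotopy_def loops_at_def)

lemma reversepath_loop: "c \<in> loops_at X x0 \<Longrightarrow> reversepath c \<in> loops_at X x0"
  by (simp add: loops_at_def)

lemma join_loop: "c \<in> loops_at X x0 \<Longrightarrow> d \<in> loops_at X x0 \<Longrightarrow> c +++ d \<in> loops_at X x0"
  by (simp add: loops_at_def subset_path_image_join)

text \<open>The orbit map of \<open>y0\<close> from the fundamental group to the fibre. It is
  defined on arbitrary sets of loops; on homotopic loops the choice does not matter by
  \<open>endpoint_eq\<close>.\<close>

definition endpoint :: "'b::topological_space set \<Rightarrow> ('b \<Rightarrow> 'a::topological_space)
  \<Rightarrow> 'b \<Rightarrow> (real \<Rightarrow> 'a) set \<Rightarrow> 'b" where
  "endpoint Xt p y0 A = transport Xt p (reversepath (SOME c. c \<in> A)) y0"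

text \<open>Stated for any nonempty set of loops homotopic to \<open>c\<close>, so that it applies
  to a product in the fundamental group, a union of classes, before that union is recognised as a
  class.\<close>

lemma endpoint_eq:
  assumes cov: "covering_space Xt p X" and y0: "y0 \<in> fibre Xt p x0"
    and c: "c \<in> loops_at X x0" and A: "A \<noteq> {}" "\<And>d. d \<in> A \<Longrightarrow> (c, d) \<in> loop_homotopy X x0"
  shows "endpoint Xt p y0 A = transport Xt p (reversepath c) y0"
proof -
  define d where "d = (SOME c. c \<in> A)"
  have "d \<in> A" unfolding d_def using A(1) by (simp add: some_in_eq)
  then have "homotopic_paths X c d" using A(2) unfolding loop_homotopy_def by blast
  then have "homotopic_paths X (reversepath c) (reversepath d)"
    by (simp add: homotopic_paths_reversepath)
  then have "transport Xt p (reversepath c) y0 = transport Xt p (reversepath d) y0"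
    by (rule transport_homotopic[OF cov]) (use y0 c in \<open>auto simp: fibre_def loops_at_def\<close>)
  then show ?thesis by (simp add: endpoint_def d_def)
qed

lemma carrierE:
  assumes "A \<in> carrier (fundamental_group X x0)"
  obtains c where "c \<in> loops_at X x0" "A = loop_homotopy X x0 `` {c}"
  using assms unfolding fundamental_group_def by (auto elim: quotientE)

lemma endpoint_class:
  assumes "covering_space Xt p X" "y0 \<in> fibre Xt p x0" "c \<in> loops_at X x0"
  shows "endpoint Xt p y0 (loop_homotopy X x0 `` {c}) = transport Xt p (reversepath c) y0"
  by (rule endpoint_eq[OF assms]) (use loop_homotopy_refl[OF assms(3)] in auto)

lemma endpoint_in_fibre:
  assumes "covering_space Xt p X" "y0 \<in> fibre Xt p x0" "A \<in> carrier (fundamental_group X x0)"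
  shows "endpoint Xt p y0 A \<in> fibre Xt p x0"
proof -
  obtain c where c: "c \<in> loops_at X x0" "A = loop_homotopy X x0 `` {c}" using carrierE[OF assms(3)] .
  show ?thesis
    unfolding c(2) endpoint_class[OF assms(1,2) c(1)]
    using transport_in_fibre[OF assms(1), of "reversepath c"
      y0] c(1) assms(2) by (simp add: loops_at_def)
qed

text \<open>Left multiplication becomes transport because the endpoint is defined with the reversed loop.\<close>

lemma endpoint_mult:
  assumes cov: "covering_space Xt p X" and y0: "y0 \<in> fibre Xt p x0" and l: "l \<in> loops_at X x0"
    and A: "A \<in> carrier (fundamental_group X x0)"
  shows "endpoint Xt p y0 (loop_homotopy X x0 `` {reversepath l} \<otimes>\<^bsub>fundamental_group X x0\<^esub> A) =
    transport Xt p l (endpoint Xt p y0 A)"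
proof -
  obtain c where c: "c \<in> loops_at X x0" "A = loop_homotopy X x0 `` {c}" using carrierE[OF A] .
  let ?P = "loop_homotopy X x0 `` {reversepath l} \<otimes>\<^bsub>fundamental_group X x0\<^esub> A"
  have P: "?P = (\<Union>a\<in>loop_homotopy X x0 `` {reversepath l}. \<Union>b\<in>A. loop_homotopy X x0 `` {a +++ b})"
    by (simp add: fundamental_group_def)
  have rl: "reversepath l \<in> loops_at X x0" using reversepath_loop[OF l] .
  have j: "reversepath l +++ c \<in> loops_at X x0" using join_loop[OF rl c(1)] .
  have "endpoint Xt p y0 ?P = transport Xt p (reversepath (reversepath l +++ c)) y0"
  proof (rule endpoint_eq[OF cov y0 j])
    have "reversepath l +++ c \<in> ?P"
      unfolding P unfolding c(2) using loop_homotopy_refl[OF rl] loop_homotopy_refl[OF c(1)]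
        loop_homotopy_refl[OF j] by blast
    then show "?P \<noteq> {}" by blast
    fix d assume "d \<in> ?P"
    then obtain a b where ab: "(reversepath l, a) \<in> loop_homotopy X x0" "(c, b) \<in> loop_homotopy X x0"
      "(a +++ b, d) \<in> loop_homotopy X x0"
      unfolding P unfolding c(2) by blast
    have "homotopic_paths X (reversepath l +++ c) (a +++ b)"
      by (rule homotopic_paths_join)
        (use ab rl c(1) in \<open>auto simp: loop_homotopy_def loops_at_def\<close>)
    then have "homotopic_paths X (reversepath l +++ c) d"
      using ab(3) homotopic_paths_trans unfolding loop_homotopy_def by blast
    then show "(reversepath l +++ c, d) \<in> loop_homotopy X x0"
      using j ab(3) unfolding loop_homotopy_def by blast
  qed
  also have "reversepath (reversepath l +++ c) = reversepath c +++ l"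
    using l c(1) by (simp add: reversepath_joinpaths loops_at_def)
  also have "transport Xt p (reversepath c +++ l) y0 =
    transport Xt p l (transport Xt p (reversepath c) y0)"
    by (rule transport_join[OF cov]) (use l c(1) y0 in \<open>auto simp: loops_at_def fibre_def\<close>)
  also have "transport Xt p (reversepath c) y0 = endpoint Xt p y0 A"
    using endpoint_class[OF cov y0 c(1)] c(2) by simp
  finally show ?thesis .
qed

text \<open>With chosen paths \<open>u b\<close> from the base point, functions on the fibre over
  \<open>b\<close> are pulled back to the group along the orbit map followed by transport along
  \<open>u b\<close>. A path \<open>q\<close> from a to b closes up with \<open>u a\<close> and
  \<open>u b\<close> to a loop, and transport along this loop is a left translation of the group, to
  which the mean is blind.\<close>

lemma amenable_imp_transport_invariant_mean:
  fixes p :: "'b::topological_space \<Rightarrow> 'a::topological_space"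
  assumes cov: "covering_space Xt p X" and X: "path_connected X" "x0 \<in> X"
    and am: "amenable (fundamental_group X x0)"
  obtains M :: "'a \<Rightarrow> ('b \<Rightarrow> real) \<Rightarrow> real" where
    "\<And>b f h c d. b \<in> X \<Longrightarrow> bounded (f ` fibre Xt p b) \<Longrightarrow> bounded (h ` fibre Xt p b) \<Longrightarrow>
      M b (\<lambda>y. c * f y + d * h y) = c * M b f + d * M b h"
    "\<And>b f h. b \<in> X \<Longrightarrow> bounded (f ` fibre Xt p b) \<Longrightarrow> (\<And>y. y \<in> fibre Xt p b \<Longrightarrow> f y = h y) \<Longrightarrow> M b f = M b h"
    "\<And>b. b \<in> X \<Longrightarrow> M b (\<lambda>y. 1) = 1"
    "\<And>q f. path q \<Longrightarrow> path_image q \<subseteq> X \<Longrightarrow> bounded (f ` fibre Xt p (pathfinish q)) \<Longrightarrow>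
      M (pathstart q) (\<lambda>y. f (transport Xt p q y)) = M (pathfinish q) f"
proof -
  let ?G = "fundamental_group X x0"
  obtain y0 where y0: "y0 \<in> fibre Xt p x0"
    using covering_space_imp_surjective[OF cov] X(2) unfolding fibre_def by blast
  obtain m :: "((real \<Rightarrow> 'a) set \<Rightarrow> real) \<Rightarrow> real" where m:
    "\<forall>f h a b. bounded (f ` carrier ?G) \<and> bounded (h ` carrier ?G) \<longrightarrow>
        m (\<lambda>x. a * f x + b * h x) = a * m f + b * m h"
    "\<forall>f. bounded (f ` carrier ?G) \<and> (\<forall>x\<in>carrier ?G. 0 \<le> f x) \<longrightarrow> 0 \<le> m f"
    "m (\<lambda>x. 1) = 1"
    "\<forall>f. \<forall>a\<in>carrier ?G. bounded (f ` carrier ?G) \<longrightarrow> m (\<lambda>x. f (a \<otimes>\<^bsub>?G\<^esub> x)) = m f"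
    using am unfolding amenable_def by blast
  have lin: "m (\<lambda>x. a * f x + b * h x) = a * m f + b * m h"
    if "bounded (f ` carrier ?G)" "bounded (h ` carrier ?G)" for f h a b
    using m(1) that by blast
  have pos: "0 \<le> m f" if "bounded (f ` carrier ?G)" "\<And>x. x \<in> carrier ?G \<Longrightarrow> 0 \<le> f x" for f
    using m(2) that by blast
  note one = m(3)
  have inv: "m (\<lambda>x. f (a \<otimes>\<^bsub>?G\<^esub> x)) = m f" if "a \<in> carrier ?G" "bounded (f ` carrier ?G)" for f a
    using m(4) that by blast
  \<comment> \<open>Positivity is applied to the differences in both orders, each of which vanishes
    on the carrier.\<close>
  have cong: "m f = m h" if b: "bounded (f ` carrier ?G)" and e: "\<And>x. x \<in> carrier ?G \<Longrightarrow> f x = h x"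
    for f h
  proof -
    have im: "f ` carrier ?G = h ` carrier ?G" using e by (intro image_cong) auto
    have b': "bounded (h ` carrier ?G)" using b im by simp
    have z: "(\<lambda>x. 1 * f x + (-1) * h x) ` carrier ?G \<subseteq> {0}"
      "(\<lambda>x. 1 * h x + (-1) * f x) ` carrier ?G \<subseteq> {0}"
      using e by auto
    have "0 \<le> m (\<lambda>x. 1 * f x + (-1) * h x)"
      by (rule pos) (use z(1) e in \<open>auto intro: bounded_subset[of "{0}"]\<close>)
    moreover have "0 \<le> m (\<lambda>x. 1 * h x + (-1) * f x)"
      by (rule pos) (use z(2) e in \<open>auto intro: bounded_subset[of "{0}"]\<close>)
    ultimately show ?thesis unfolding lin[OF b b'] lin[OF b' b] by simp
  qed
  define u where "u b = (SOME q. path q \<and> path_image q \<subseteq> X \<and> pathstart q = x0 \<and> pathfinish q = b)" for b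
  have u: "path (u b)" "path_image (u b) \<subseteq> X" "pathstart (u b) = x0" "pathfinish (u b) = b"
    if "b \<in> X" for b
  proof -
    have "\<exists>q. path q \<and> path_image q \<subseteq> X \<and> pathstart q = x0 \<and> pathfinish q = b"
      using X that unfolding path_connected_def by blast
    then have "path (u b) \<and> path_image (u b) \<subseteq> X \<and> pathstart (u b) = x0 \<and> pathfinish (u b) = b"
      unfolding u_def by (rule someI_ex)
    then show "path (u b)" "path_image (u b) \<subseteq> X" "pathstart (u b) = x0" "pathfinish (u b) = b" by auto
  qed
  let ?\<phi> = "endpoint Xt p y0"
  define e where "e b A = transport Xt p (u b) (?\<phi> A)" for b A
  have phi: "?\<phi> A \<in> fibre Xt p x0" if "A \<in> carrier ?G" for A
    using endpoint_in_fibre[OF cov y0 that] .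
  have e: "e b A \<in> fibre Xt p b" if "b \<in> X" "A \<in> carrier ?G" for b A
    using transport_in_fibre[OF cov u(1,2)[OF that(1)], of "?\<phi> A"] phi[OF that(2)] u(3,4)[OF that(1)]
    by (simp add: e_def)
  define M where "M b f = m (\<lambda>A. f (e b A))" for b f
  have bd: "bounded ((\<lambda>A. f (e b A)) ` carrier ?G)" if "b \<in> X" "bounded (f ` fibre Xt p b)"
    for b and f :: "'b \<Rightarrow> real"
    by (rule bounded_subset[OF that(2)]) (use e[OF that(1)] in auto)
  show thesis
  proof (rule that[of M])
    fix b c d and f h :: "'b \<Rightarrow> real" assume "b \<in> X" "bounded (f ` fibre Xt p b)"
      "bounded (h ` fibre Xt p b)"
    then show "M b (\<lambda>y. c * f y + d * h y) = c * M b f + d * M b h"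
      unfolding M_def by (intro lin bd)
  next
    fix b and f h :: "'b \<Rightarrow> real" assume "b \<in> X" "bounded (f ` fibre Xt p b)"
      "\<And>y. y \<in> fibre Xt p b \<Longrightarrow> f y = h y"
    then show "M b f = M b h" unfolding M_def by (intro cong bd) (use e in auto)
  next
    fix b show "M b (\<lambda>y. 1) = 1" unfolding M_def by (rule one)
  next
    fix q and f :: "'b \<Rightarrow> real" assume q: "path q" "path_image q \<subseteq> X"
      and f: "bounded (f ` fibre Xt p (pathfinish q))"
    define a b where "a = pathstart q" and "b = pathfinish q"
    have ab: "a \<in> X" "b \<in> X" using q by (auto simp: a_def b_def)
    define l where "l = (u a +++ q) +++ reversepath (u b)"
    have paq: "path (u a +++ q)" "path_image (u a +++ q) \<subseteq> X" "pathstart (u a +++ q) = x0"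
      "pathfinish (u a +++ q) = b"
      using u[OF ab(1)] q by (auto simp: a_def b_def subset_path_image_join)
    have l: "l \<in> loops_at X x0"
      using u[OF ab(2)] paq by (auto simp: l_def loops_at_def subset_path_image_join)
    have tl: "transport Xt p (u b) (transport Xt p l y) = transport Xt p q (transport Xt p (u a) y)"
      if y: "y \<in> fibre Xt p x0" for y
    proof -
      have 1: "transport Xt p (u a +++ q) y = transport Xt p q (transport Xt p (u a) y)"
        by (rule transport_join[OF cov]) (use u[OF ab(1)] q y in \<open>auto simp: fibre_def a_def\<close>)
      have m1: "transport Xt p (u a +++ q) y \<in> fibre Xt p b"
        using transport_in_fibre[OF cov paq(1,2), of y] paq(3,4) y by simp
      have 2: "transport Xt p l y = transport Xt p (reversepath (u b)) (transport Xt p (u a +++ q) y)"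
        unfolding l_def
        by (rule transport_join[OF cov]) (use u[OF ab(2)] paq y in \<open>auto simp: fibre_def\<close>)
      have "transport Xt p (reversepath (reversepath (u b))) (transport Xt p (reversepath (u b))
        (transport Xt p (u a +++ q) y))
          = transport Xt p (u a +++ q) y"
        by (rule transport_reversepath[OF cov]) (use u[OF ab(2)] m1 in \<open>auto simp: fibre_def\<close>)
      then show ?thesis using 1 2 by simp
    qed
    let ?h = "\<lambda>A. f (e b A)" and ?c = "loop_homotopy X x0 `` {reversepath l}"
    have c: "?c \<in> carrier ?G" unfolding fundamental_group_def using reversepath_loop[OF l]
      by (simp add: quotientI)
    \<comment> \<open>In terms of the group, composition with the transport along \<open>q\<close>
      has become left multiplication by the class of the reversed loop.\<close>
    have *: "f (transport Xt p q (e a A)) = ?h (?c \<otimes>\<^bsub>?G\<^esub> A)" if A: "A \<in> carrier ?G" for A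
      unfolding e_def endpoint_mult[OF cov y0 l A] tl[OF phi[OF A]] ..
    have f': "bounded (f ` fibre Xt p b)" using f by (simp add: b_def)
    have bq: "bounded ((\<lambda>A. f (transport Xt p q (e a A))) ` carrier ?G)"
    proof (rule bounded_subset[OF f'], clarify)
      fix A assume A: "A \<in> carrier ?G"
      have "transport Xt p q (e a A) \<in> fibre Xt p b"
        using transport_in_fibre[OF cov q] e[OF ab(1) A] by (simp add: a_def b_def)
      then show "f (transport Xt p q (e a A)) \<in> f ` fibre Xt p b" by blast
    qed
    have "M a (\<lambda>y. f (transport Xt p q y)) = m (\<lambda>A. ?h (?c \<otimes>\<^bsub>?G\<^esub> A))"
      unfolding M_def by (rule cong[OF bq *])
    also have "\<dots> = M b f" unfolding M_def by (rule inv[OF c bd[OF ab(2) f']])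
    finally show "M (pathstart q) (\<lambda>y. f (transport Xt p q y)) = M (pathfinish q) f"
      by (simp add: a_def b_def)
  qed
qed

section \<open>Sheets over simplices and their faces\<close>

definition sheet :: "'b::topological_space set \<Rightarrow> ('b \<Rightarrow> 'a::topological_space)
  \<Rightarrow> 'a set \<Rightarrow> 'b \<Rightarrow> 'b set" where
  "sheet Xt p S y = (SOME s. s \<subseteq> Xt \<and> y \<in> s \<and> (\<exists>q. homeomorphism s S p q))"

text \<open>The sheet is the image of a lift of the inclusion of \<open>S\<close>, which exists
  since \<open>S\<close> is compact and convex.\<close>

lemma sheet_ex:
  fixes p :: "'b::topological_space \<Rightarrow> 'a::euclidean_space"
  assumes cov: "covering_space Xt p X" and S: "compact S" "convex S" "S \<subseteq> X"
    and y: "y \<in> Xt" "p y \<in> S"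
  shows "\<exists>s. s \<subseteq> Xt \<and> y \<in> s \<and> (\<exists>q. homeomorphism s S p q)"
proof -
  have "liftable Xt p (\<lambda>x. x) S"
    by (rule covering_lift_exists[OF cov S(1,2)]) (use S in \<open>auto\<close>)
  then have "\<exists>g. continuous_on S g \<and> g ` S \<subseteq> Xt \<and> g (p y) = y \<and> (\<forall>z\<in>S. p (g z) = z)"
    using y unfolding liftable_def by blast
  then obtain g where g: "continuous_on S g" "g ` S \<subseteq> Xt" "g (p y) = y" "\<And>z. z \<in> S \<Longrightarrow> p (g z) = z"
    by blast
  have "homeomorphism (g ` S) S p g"
    unfolding homeomorphism_def
    using g continuous_on_subset[OF covering_space_imp_continuous[OF cov] g(2)]
      by (auto simp: image_image)
  moreover have "y \<in> g ` S" using g(3) y(2) by (metis image_eqI)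
  ultimately show ?thesis using g(2) by blast
qed

lemma sheet_unique:
  fixes p :: "'b::topological_space \<Rightarrow> 'a::topological_space"
  assumes cov: "covering_space Xt p X" and S: "connected S"
    and s: "s \<subseteq> Xt" "y \<in> s" "homeomorphism s S p q" and s': "s' \<subseteq> Xt" "y \<in> s'" "homeomorphism s' S p q'"
  shows "s = s'"
proof -
  have i: "q ` S = s" "q' ` S = s'" using s s' by (auto simp: homeomorphism_def)
  have py: "p y \<in> S" using s by (auto simp: homeomorphism_def)
  have "q x = q' x" if "x \<in> S" for x
    by (rule covering_lift_unique[OF cov S, of q q' "p y"])
      (use s s' i py that in \<open>auto simp: homeomorphism_def\<close>)
  then show ?thesis using i by (metis image_cong)
qed

lemma sheet_eq:
  fixes p :: "'b::topological_space \<Rightarrow> 'a::topological_space"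
  assumes cov: "covering_space Xt p X" and S: "connected S" and s: "s \<subseteq> Xt" "y \<in> s"
    "homeomorphism s S p q"
  shows "sheet Xt p S y = s"
  unfolding sheet_def
proof (rule some_equality)
  show "s \<subseteq> Xt \<and> y \<in> s \<and> (\<exists>q. homeomorphism s S p q)" using s by blast
  fix s' assume "s' \<subseteq> Xt \<and> y \<in> s' \<and> (\<exists>q. homeomorphism s' S p q)"
  then show "s' = s" using sheet_unique[OF cov S] s by blast
qed

text \<open>The segment from \<open>b\<close> to \<open>b'\<close> runs inside \<open>S\<close>, so
  its lift stays in the sheet of \<open>S\<close> and ends at the point of that sheet over
  \<open>b'\<close>. Hence transport between base points matches each sheet over \<open>S\<close>
  with the sheet over \<open>T\<close> contained in it.\<close>

lemma sheet_face:
  fixes p :: "'b::topological_space \<Rightarrow> 'a::euclidean_space"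
  assumes cov: "covering_space Xt p X" and S: "compact S" "convex S" "S \<subseteq> X"
    and T: "convex T" "T \<subseteq> S" and b: "b \<in> S" "b' \<in> T" and y: "y \<in> fibre Xt p b"
  shows "sheet Xt p T (transport Xt p (linepath b b') y) \<subseteq> sheet Xt p S y"
proof -
  obtain s q where s: "s \<subseteq> Xt" "y \<in> s" "homeomorphism s S p q"
    using sheet_ex[OF cov S, of y] y b by (auto simp: fibre_def)
  have q: "continuous_on S q" "q ` S = s" "\<And>x. x \<in> S \<Longrightarrow> p (q x) = x" "\<And>z. z \<in> s \<Longrightarrow> q (p z) = z"
    using s(3) by (auto simp: homeomorphism_def)
  have seg: "linepath b b' t \<in> S" if "t \<in> {0..1}" for t
    using S(2) T b that by (auto simp: linepath_def convex_alt)
  have "transport Xt p (linepath b b') (pathstart (q \<circ> linepath b b')) = pathfinish (q \<circ> linepath b b')"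
  proof (rule transport_eq[OF cov])
    show "path (q \<circ> linepath b b')"
      by (intro path_continuous_image continuous_on_subset[OF q(1)])
        (use seg in \<open>auto simp: path_image_def\<close>)
    show "path_image (q \<circ> linepath b b') \<subseteq> Xt" using seg q(2) s(1) by (auto simp: path_image_def)
    show "p ((q \<circ> linepath b b') t) = linepath b b' t" if "t \<in> {0..1}" for t
      using q(3)[OF seg[OF that]] by simp
  qed
  moreover have "pathstart (q \<circ> linepath b b') = y"
    using q(4)[OF s(2)] y by (simp add: pathstart_compose fibre_def)
  ultimately have tr: "transport Xt p (linepath b b') y = q b'" by (simp add: pathfinish_compose)
  have h: "homeomorphism (q ` T) T p q"
    using s(3) T(2) by (force simp: homeomorphism_def image_image intro: continuous_on_subset)
  have "sheet Xt p T (q b') = q ` T"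
    by (rule sheet_eq[OF cov convex_connected[OF T(1)] _ _ h]) (use T(2) b q(2) s(1) in auto)
  moreover have "sheet Xt p S y = s"
    by (rule sheet_eq[OF cov convex_connected[OF S(2)] s])
  ultimately show ?thesis using tr q(2) T(2) by auto
qed

section \<open>Differential forms on a convex set\<close>

text \<open>Smoothness is demanded for constant vectors only. Where a vector moves with the point,
  as in \<open>vcone\<close>, multilinearity and a basis reduce to this case.\<close>

definition form_on :: "'a::euclidean_space set \<Rightarrow> nat \<Rightarrow> ('a \<Rightarrow> 'a list \<Rightarrow> real) \<Rightarrow> bool" where
  "form_on S n \<beta> \<longleftrightarrow> (\<forall>x\<in>S. alt_form (tangent S) n (\<beta> x)) \<and>
     (\<forall>vs. length vs = n \<and> set vs \<subseteq> tangent S \<longrightarrow> smooth_on S (\<lambda>x. \<beta> x vs))"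

definition dform :: "'a::euclidean_space set \<Rightarrow> ('a \<Rightarrow> 'a list \<Rightarrow> real) \<Rightarrow> 'a \<Rightarrow> 'a list \<Rightarrow> real" where
  "dform S \<beta> x vs = asum (\<lambda>u ws. tderiv S (\<lambda>y. \<beta> y ws) x u) vs"

definition wedge :: "('a \<Rightarrow> real) \<Rightarrow> ('a \<Rightarrow> 'a list \<Rightarrow> real) \<Rightarrow> 'a \<Rightarrow> 'a list \<Rightarrow> real" where
  "wedge l \<beta> x vs = asum (\<lambda>u ws. l u * \<beta> x ws) vs"

text \<open>The Poincare homotopy operator for the straight contraction to \<open>e\<close>: the
  velocity \<open>x - e\<close> is inserted in front, and each of the other vectors contributes one
  factor t.\<close>

definition vcone :: "'a::euclidean_space \<Rightarrow> ('a \<Rightarrow> 'a list \<Rightarrow> real) \<Rightarrow> 'a \<Rightarrow> 'a list \<Rightarrow> real" where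
  "vcone e \<beta> x vs = radial_int (length vs) e (\<lambda>y. \<beta> y ((x - e) # vs)) x"

lemma form_on_alt: "form_on S n \<beta> \<Longrightarrow> x \<in> S \<Longrightarrow> alt_form (tangent S) n (\<beta> x)"
  by (simp add: form_on_def)

lemma form_on_smooth: "form_on S n \<beta> \<Longrightarrow> length vs = n \<Longrightarrow> set vs \<subseteq> tangent S \<Longrightarrow> smooth_on S (\<lambda>x. \<beta> x vs)"
  by (simp add: form_on_def)

lemma form_on_sum:
  "(\<And>i. i \<in> I \<Longrightarrow> form_on S n (\<beta> i)) \<Longrightarrow> form_on S n (\<lambda>x vs. \<Sum>i\<in>I. \<beta> i x vs)"
  unfolding form_on_def by (auto intro: alt_form_sum smooth_on_sum)

lemma form_on_add:
  "form_on S n \<beta> \<Longrightarrow> form_on S n \<gamma> \<Longrightarrow> form_on S n (\<lambda>x vs. \<beta> x vs + \<gamma> x vs)"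
  unfolding form_on_def using alt_form_lincomb[where a=1 and b=1] by (fastforce intro: smooth_on_add)

lemma form_on_diff:
  "form_on S n \<beta> \<Longrightarrow> form_on S n \<gamma> \<Longrightarrow> form_on S n (\<lambda>x vs. \<beta> x vs - \<gamma> x vs)"
  unfolding form_on_def using alt_form_lincomb[where a=1 and b="-1"]
    by (fastforce intro: smooth_on_diff)

lemma form_on_mult:
  assumes "smooth_on S f" "form_on S n \<beta>"
  shows "form_on S n (\<lambda>x vs. f x * \<beta> x vs)"
proof -
  have "alt_form (tangent S) n (\<lambda>vs. f x * \<beta> x vs)" if "x \<in> S" for x
    using alt_form_lincomb[OF form_on_alt[OF assms(2) that] alt_form_zero, of "f x" 0] by simp
  then show ?thesis using assms unfolding form_on_def by (auto intro: smooth_on_mult)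
qed

lemma form_on_cmult: "form_on S n \<beta> \<Longrightarrow> form_on S n (\<lambda>x vs. c * \<beta> x vs)"
  by (rule form_on_mult[OF smooth_on_const])

lemma smooth_on_asum:
  "(\<And>u ws. u \<in> set vs \<Longrightarrow> set ws \<subseteq> set vs \<Longrightarrow> length vs = Suc (length ws) \<Longrightarrow> smooth_on S (\<lambda>y. \<Phi> y u ws)) \<Longrightarrow>
    smooth_on S (\<lambda>y. asum (\<Phi> y) vs)"
proof (induct vs arbitrary: \<Phi>)
  case (Cons v vs)
  have "smooth_on S (\<lambda>y. asum (\<lambda>u ws. \<Phi> y u (v # ws)) vs)"
    by (rule Cons.hyps) (rule Cons.prems, auto)
  moreover have "smooth_on S (\<lambda>y. \<Phi> y v vs)" by (rule Cons.prems) auto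
  ultimately show ?case by (simp add: smooth_on_diff)
qed (simp add: smooth_on_const)

lemma tderiv_asum:
  assumes S: "convex S" "x \<in> S" "v \<in> tangent S"
  shows "(\<And>u ws. u \<in> set vs \<Longrightarrow> set ws \<subseteq> set vs \<Longrightarrow> length vs = Suc (length ws) \<Longrightarrow>
    smooth_on S (\<lambda>y. \<Phi> y u ws)) \<Longrightarrow>
    tderiv S (\<lambda>y. asum (\<Phi> y) vs) x v = asum (\<lambda>u ws. tderiv S (\<lambda>y. \<Phi> y u ws) x v) vs"
proof (induct vs arbitrary: \<Phi>)
  case (Cons w vs)
  have 1: "tderiv S (\<lambda>y. asum (\<lambda>u ws. \<Phi> y u (w # ws)) vs) x v =
    asum (\<lambda>u ws. tderiv S (\<lambda>y. \<Phi> y u (w # ws)) x v) vs"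
    by (rule Cons.hyps) (rule Cons.prems, auto)
  have 2: "smooth_on S (\<lambda>y. asum (\<lambda>u ws. \<Phi> y u (w # ws)) vs)"
    by (rule smooth_on_asum) (rule Cons.prems, auto)
  have 3: "smooth_on S (\<lambda>y. \<Phi> y w vs)" by (rule Cons.prems) auto
  show ?case using tderiv_diff[OF S 3 2] 1 by simp
qed (simp add: tderiv_const[OF S])

lemma radial_int_diff:
  assumes "convex S" "e \<in> S" "x \<in> S" "continuous_on S f" "continuous_on S g"
  shows "radial_int m e (\<lambda>y. f y - g y) x = radial_int m e f x - radial_int m e g x"
  using radial_int_add[OF assms(1-4), of "\<lambda>y. (-1) * g y" m] radial_int_cmult[of m e "-1" g x] assms(5)
  by (simp add: continuous_on_minus)

lemma radial_int_asum:
  assumes S: "convex S" "e \<in> S" "x \<in> S"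
  shows "(\<And>u ws. u \<in> set vs \<Longrightarrow> set ws \<subseteq> set vs \<Longrightarrow> length vs = Suc (length ws) \<Longrightarrow>
    smooth_on S (\<lambda>y. \<Phi> y u ws)) \<Longrightarrow>
    radial_int m e (\<lambda>y. asum (\<Phi> y) vs) x = asum (\<lambda>u ws. radial_int m e (\<lambda>y. \<Phi> y u ws) x) vs"
proof (induct vs arbitrary: \<Phi>)
  case Nil
  then show ?case by (simp add: radial_int_def)
next
  case (Cons w vs)
  have 1: "radial_int m e (\<lambda>y. asum (\<lambda>u ws. \<Phi> y u (w # ws)) vs) x =
    asum (\<lambda>u ws. radial_int m e (\<lambda>y. \<Phi> y u (w # ws)) x) vs"
    by (rule Cons.hyps) (rule Cons.prems, auto)
  have 2: "smooth_on S (\<lambda>y. asum (\<lambda>u ws. \<Phi> y u (w # ws)) vs)"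
    by (rule smooth_on_asum) (rule Cons.prems, auto)
  have 3: "smooth_on S (\<lambda>y. \<Phi> y w vs)" by (rule Cons.prems) auto
  show ?case using radial_int_diff[OF S smooth_on_continuous[OF 3] smooth_on_continuous[OF 2]] 1 by simp
qed

lemma radial_int_sum:
  assumes S: "convex S" "e \<in> S" "x \<in> S" and f: "\<And>i. i \<in> I \<Longrightarrow> continuous_on S (f i)"
  shows "radial_int m e (\<lambda>y. \<Sum>i\<in>I. f i y) x = (\<Sum>i\<in>I. radial_int m e (f i) x)"
  using f
proof (induct I rule: infinite_finite_induct)
  case (insert i I)
  then show ?case
    by (simp add: radial_int_add[OF S] continuous_on_sum)
qed (simp_all add: radial_int_def)

lemma dform_cong:
  assumes "x \<in> S" "set vs \<subseteq> tangent S"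
    "\<And>y ws. y \<in> S \<Longrightarrow> length vs = Suc (length ws) \<Longrightarrow> set ws \<subseteq> tangent S \<Longrightarrow> \<beta> y ws = \<gamma> y ws"
  shows "dform S \<beta> x vs = dform S \<gamma> x vs"
  unfolding dform_def
  by (intro asum_cong tderiv_cong[OF assms(1)] assms(3)) (use assms(2) in auto)

lemma wedge_cong:
  assumes "\<And>u. u \<in> set vs \<Longrightarrow> l u = l' u"
    "\<And>ws. length vs = Suc (length ws) \<Longrightarrow> set ws \<subseteq> set vs \<Longrightarrow> \<beta> x ws = \<gamma> x ws"
  shows "wedge l \<beta> x vs = wedge l' \<gamma> x vs"
  unfolding wedge_def by (rule asum_cong) (use assms in auto)

lemma form_on_wedge:
  assumes l: "linear l" and f: "form_on S n \<beta>"
  shows "form_on S (Suc n) (wedge l \<beta>)"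
  unfolding form_on_def
proof (intro conjI ballI allI impI)
  fix x assume x: "x \<in> S"
  show "alt_form (tangent S) (Suc n) (wedge l \<beta> x)"
    unfolding wedge_def[abs_def]
  proof (rule alt_form_asum)
    show "alt_form (tangent S) n (\<lambda>ws. l u * \<beta> x ws)" for u
      using alt_form_lincomb[OF form_on_alt[OF f x] alt_form_zero, of "l u" 0] by simp
  qed (simp add: linear_add[OF l] linear_cmul[OF l] algebra_simps)
next
  fix vs assume vs: "length vs = Suc n \<and> set vs \<subseteq> tangent S"
  show "smooth_on S (\<lambda>x. wedge l \<beta> x vs)"
    unfolding wedge_def
    by (rule smooth_on_asum, rule smooth_on_cmult, rule form_on_smooth[OF f]) (use vs in auto)
qed

text \<open>The one-form \<open>l\<close> is constant and therefore closed; the sign is the one from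
  exchanging two removals.\<close>

lemma dform_wedge:
  assumes S: "convex S" "x \<in> S" and vs: "set vs \<subseteq> tangent S"
    and sm: "\<And>ws. length vs = Suc (Suc (length ws)) \<Longrightarrow> set ws \<subseteq> tangent S \<Longrightarrow> smooth_on S (\<lambda>y. \<beta> y ws)"
  shows "dform S (wedge l \<beta>) x vs = - wedge l (dform S \<beta>) x vs"
proof -
  have "dform S (wedge l \<beta>) x vs = asum (\<lambda>u. asum (\<lambda>w zs. l w * tderiv S (\<lambda>y. \<beta> y zs) x u)) vs"
    unfolding dform_def wedge_def
  proof (rule asum_cong)
    fix u ws assume h: "u \<in> set vs" "set ws \<subseteq> set vs" "length vs = Suc (length ws)"
    have u: "u \<in> tangent S" using h vs by auto
    have s: "smooth_on S (\<lambda>y. \<beta> y zs)" if "set zs \<subseteq> set ws" "length ws = Suc (length zs)" for zs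
      by (rule sm) (use that h vs in auto)
    have "tderiv S (\<lambda>y. asum (\<lambda>u ws. l u * \<beta> y ws) ws) x u =
      asum (\<lambda>w zs. tderiv S (\<lambda>y. l w * \<beta> y zs) x u) ws"
      by (rule tderiv_asum[OF S u]) (auto intro!: smooth_on_cmult s)
    also have "\<dots> = asum (\<lambda>w zs. l w * tderiv S (\<lambda>y. \<beta> y zs) x u) ws"
      by (rule asum_cong) (auto intro!: tderiv_cmult[OF S u] s)
    finally show "tderiv S (\<lambda>y. asum (\<lambda>u ws. l u * \<beta> y ws) ws) x u =
      asum (\<lambda>w zs. l w * tderiv S (\<lambda>y. \<beta> y zs) x u) ws" .
  qed
  also have "\<dots> = - asum (\<lambda>u. asum (\<lambda>w zs. l u * tderiv S (\<lambda>y. \<beta> y zs) x w)) vs"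
    by (rule asum_antisymmetric)
  also have "asum (\<lambda>u. asum (\<lambda>w zs. l u * tderiv S (\<lambda>y. \<beta> y zs) x w)) vs = wedge l (dform S \<beta>) x vs"
    unfolding wedge_def dform_def by (rule asum_cong, rule asum_cmult)
  finally show ?thesis .
qed

text \<open>Second derivatives are symmetric in the two removed vectors, whereas the double
  alternating sum is antisymmetric, so it equals its own negative.\<close>

lemma dform_dform:
  assumes S: "convex S" "x \<in> S" and vs: "set vs \<subseteq> tangent S"
    and sm: "\<And>ws. length vs = Suc (Suc (length ws)) \<Longrightarrow> set ws \<subseteq> tangent S \<Longrightarrow> smooth_on S (\<lambda>y. \<beta> y ws)"
  shows "dform S (dform S \<beta>) x vs = 0"
proof -
  let ?D = "\<lambda>u w zs. tderiv S (\<lambda>y. tderiv S (\<lambda>y. \<beta> y zs) y w) x u"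
  have "dform S (dform S \<beta>) x vs = asum (\<lambda>u. asum (\<lambda>w zs. ?D u w zs)) vs"
    unfolding dform_def
  proof (rule asum_cong)
    fix u ws assume h: "u \<in> set vs" "set ws \<subseteq> set vs" "length vs = Suc (length ws)"
    have u: "u \<in> tangent S" using h vs by auto
    show "tderiv S (\<lambda>y. asum (\<lambda>u ws. tderiv S (\<lambda>y. \<beta> y ws) y u) ws) x u = asum (\<lambda>w zs. ?D u w zs) ws"
    proof (rule tderiv_asum[OF S u])
      fix w zs assume z: "w \<in> set ws" "set zs \<subseteq> set ws" "length ws = Suc (length zs)"
      show "smooth_on S (\<lambda>y. tderiv S (\<lambda>y. \<beta> y zs) y w)"
        by (rule smooth_on_tderiv[OF S(1)], use z h vs in blast, rule sm) (use z h vs in auto)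
    qed
  qed
  moreover have "asum (\<lambda>u. asum (\<lambda>w zs. ?D u w zs)) vs = asum (\<lambda>u. asum (\<lambda>w zs. ?D w u zs)) vs"
  proof (rule asum_cong, rule asum_cong)
    fix u ws w zs
    assume h: "u \<in> set vs" "set ws \<subseteq> set vs" "length vs = Suc (length ws)"
      and z: "w \<in> set ws" "set zs \<subseteq> set ws" "length ws = Suc (length zs)"
    show "?D u w zs = ?D w u zs"
      by (rule tderiv_symmetric[OF S], use z h vs in blast, use z h vs in blast, rule sm)
        (use z h vs in auto)
  qed
  ultimately show ?thesis
    using asum_antisymmetric[of "\<lambda>u w zs. ?D u w zs" vs] by simp
qed

lemma dform_mult:
  assumes S: "convex S" "x \<in> S" and vs: "set vs \<subseteq> tangent S" and f: "smooth_on S f"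
    "\<And>u. u \<in> tangent S \<Longrightarrow> tderiv S f x u = l u"
    and sm: "\<And>ws. length vs = Suc (length ws) \<Longrightarrow> set ws \<subseteq> tangent S \<Longrightarrow> smooth_on S (\<lambda>y. \<beta> y ws)"
  shows "dform S (\<lambda>x vs. f x * \<beta> x vs) x vs = f x * dform S \<beta> x vs + wedge l \<beta> x vs"
  unfolding dform_def wedge_def asum_cmult[symmetric] asum_add[symmetric]
proof (rule asum_cong)
  fix u ws assume h: "u \<in> set vs" "set ws \<subseteq> set vs" "length vs = Suc (length ws)"
  have u: "u \<in> tangent S" using h vs by auto
  have s: "smooth_on S (\<lambda>y. \<beta> y ws)" by (rule sm) (use h vs in auto)
  show "tderiv S (\<lambda>y. f y * \<beta> y ws) x u = f x * tderiv S (\<lambda>y. \<beta> y ws) x u + l u * \<beta> x ws"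
    using tderiv_mult[OF S u f(1) s] f(2)[OF u] by simp
qed

lemma dform_add:
  assumes S: "convex S" "x \<in> S" and vs: "set vs \<subseteq> tangent S"
    and sm: "\<And>ws. length vs = Suc (length ws) \<Longrightarrow> set ws \<subseteq> tangent S \<Longrightarrow> smooth_on S (\<lambda>y. \<beta> y ws)"
      "\<And>ws. length vs = Suc (length ws) \<Longrightarrow> set ws \<subseteq> tangent S \<Longrightarrow> smooth_on S (\<lambda>y. \<gamma> y ws)"
  shows "dform S (\<lambda>x vs. \<beta> x vs + \<gamma> x vs) x vs = dform S \<beta> x vs + dform S \<gamma> x vs"
  unfolding dform_def asum_add[symmetric]
  by (rule asum_cong, rule tderiv_add[OF S]) (use vs in \<open>auto intro!: sm\<close>)

lemma dform_diff:
  assumes S: "convex S" "x \<in> S" and vs: "set vs \<subseteq> tangent S"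
    and sm: "\<And>ws. length vs = Suc (length ws) \<Longrightarrow> set ws \<subseteq> tangent S \<Longrightarrow> smooth_on S (\<lambda>y. \<beta> y ws)"
      "\<And>ws. length vs = Suc (length ws) \<Longrightarrow> set ws \<subseteq> tangent S \<Longrightarrow> smooth_on S (\<lambda>y. \<gamma> y ws)"
  shows "dform S (\<lambda>x vs. \<beta> x vs - \<gamma> x vs) x vs = dform S \<beta> x vs - dform S \<gamma> x vs"
  unfolding dform_def asum_diff[symmetric]
  by (rule asum_cong, rule tderiv_diff[OF S]) (use vs in \<open>auto intro!: sm\<close>)

lemma dform_cmult:
  assumes S: "convex S" "x \<in> S" and vs: "set vs \<subseteq> tangent S"
    and sm: "\<And>ws. length vs = Suc (length ws) \<Longrightarrow> set ws \<subseteq> tangent S \<Longrightarrow> smooth_on S (\<lambda>y. \<beta> y ws)"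
  shows "dform S (\<lambda>x vs. c * \<beta> x vs) x vs = c * dform S \<beta> x vs"
  unfolding dform_def asum_cmult[symmetric]
  by (rule asum_cong, rule tderiv_cmult[OF S]) (use vs in \<open>auto intro!: sm\<close>)

lemma dform_sum:
  assumes S: "convex S" "x \<in> S" and vs: "set vs \<subseteq> tangent S"
    and sm: "\<And>i ws. i \<in> I \<Longrightarrow> length vs = Suc (length ws) \<Longrightarrow> set ws \<subseteq> tangent S \<Longrightarrow>
      smooth_on S (\<lambda>y. \<beta> i y ws)"
  shows "dform S (\<lambda>x vs. \<Sum>i\<in>I. \<beta> i x vs) x vs = (\<Sum>i\<in>I. dform S (\<beta> i) x vs)"
  unfolding dform_def asum_sum[symmetric]
  by (rule asum_cong, rule tderiv_sum[OF S]) (use vs in \<open>auto intro!: sm\<close>)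

lemma alt_form_sum_Cons:
  assumes V: "subspace V" and f: "alt_form V (Suc n) f" and vs: "length vs = n" "set vs \<subseteq> V"
    and B: "finite B" "B \<subseteq> V"
  shows "f ((\<Sum>b\<in>B. c b *\<^sub>R b) # vs) = (\<Sum>b\<in>B. c b * f (b # vs))"
  using B
proof (induct B rule: finite_induct)
  case empty
  show ?case using alt_form_scale[OF f, of "[]" vs 0 0] vs subspace_0[OF V] by simp
next
  case (insert b B)
  have "(\<Sum>b\<in>B. c b *\<^sub>R b) \<in> V" using insert V by (auto intro!: subspace_sum subspace_scale)
  then have "f ((c b *\<^sub>R b + 1 *\<^sub>R (\<Sum>b\<in>B. c b *\<^sub>R b)) # vs) =
    c b * f (b # vs) + 1 * f ((\<Sum>b\<in>B. c b *\<^sub>R b) # vs)"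
    using alt_formD1[OF f, of "[]" vs b "\<Sum>b\<in>B. c b *\<^sub>R b" "c b" 1] vs insert by simp
  then show ?case using insert by simp
qed

text \<open>The basis is orthonormal, so coefficients are inner products and thus smooth in the
  vector.\<close>

lemma tangent_basis:
  fixes S :: "'a::euclidean_space set"
  obtains B where "finite B" "B \<subseteq> tangent S" "\<And>v. v \<in> tangent S \<Longrightarrow> (\<Sum>b\<in>B. (v \<bullet> b) *\<^sub>R b) = v"
proof -
  obtain B where B: "B \<subseteq> tangent S" "pairwise orthogonal B" "\<And>x. x \<in> B \<Longrightarrow> norm x = 1"
    "independent B" "span B = tangent S"
    using orthonormal_basis_subspace[OF subspace_tangent[of S]] by metis
  have f: "finite B" using B(4) by (simp add: independent_imp_finite)
  show thesis
    using that[OF f B(1)] orthonormal_basis_expand[OF B(2) B(3) _ f] B(5) by blast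
qed

lemma form_on_expand:
  assumes f: "form_on S (Suc n) \<beta>" and vs: "length vs = n" "set vs \<subseteq> tangent S" and y: "y \<in> S"
    and B: "finite B" "B \<subseteq> tangent S" "\<And>v. v \<in> tangent S \<Longrightarrow> (\<Sum>b\<in>B. (v \<bullet> b) *\<^sub>R b) = v"
      and v: "v \<in> tangent S"
  shows "\<beta> y (v # vs) = (\<Sum>b\<in>B. (v \<bullet> b) * \<beta> y (b # vs))"
  using alt_form_sum_Cons[OF subspace_tangent form_on_alt[OF f y] vs B(1,2), of "\<lambda>b. v \<bullet> b"]
    B(3)[OF v] by simp

text \<open>In \<open>vcone\<close> the point \<open>x\<close> occurs both as end of the segment and
  in the inserted vector. The expansion separates the two into smooth factors, to which the product
  rule applies.\<close>

lemma vcone_expand: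
  assumes S: "convex S" "e \<in> S" "x \<in> S" and f: "form_on S (Suc n) \<beta>" and vs: "length vs = n"
    "set vs \<subseteq> tangent S"
    and B: "finite B" "B \<subseteq> tangent S" "\<And>v. v \<in> tangent S \<Longrightarrow> (\<Sum>b\<in>B. (v \<bullet> b) *\<^sub>R b) = v"
  shows "vcone e \<beta> x vs = (\<Sum>b\<in>B. ((x - e) \<bullet> b) * radial_int n e (\<lambda>y. \<beta> y (b # vs)) x)"
proof -
  have "vcone e \<beta> x vs = radial_int n e (\<lambda>y. \<Sum>b\<in>B. ((x - e) \<bullet> b) * \<beta> y (b # vs)) x"
    unfolding vcone_def vs(1)
    by (rule radial_int_cong[OF S], rule form_on_expand[OF f vs _ B])
      (use S in \<open>auto intro: diff_in_tangent\<close>)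
  also have "\<dots> = (\<Sum>b\<in>B. radial_int n e (\<lambda>y. ((x - e) \<bullet> b) * \<beta> y (b # vs)) x)"
    by (rule radial_int_sum[OF S], rule smooth_on_continuous, rule smooth_on_cmult,
      rule form_on_smooth[OF f])
      (use vs B in auto)
  finally show ?thesis by (simp add: radial_int_cmult)
qed

lemma smooth_on_inner_diff: "smooth_on S (\<lambda>x. (x - e) \<bullet> b)"
proof -
  have "smooth_on S (\<lambda>x. x \<bullet> b - e \<bullet> b)"
    by (intro smooth_on_diff smooth_on_const smooth_on_linear bounded_linear.linear
      bounded_linear_inner_left)
  then show ?thesis by (simp add: inner_diff_left)
qed

lemma tderiv_inner_diff:
  assumes "convex S" "x \<in> S" "v \<in> tangent S"
  shows "tderiv S (\<lambda>x. (x - e) \<bullet> b) x v = v \<bullet> b"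
  by (rule tderiv_eqI[OF assms]) (auto intro!: derivative_eq_intros)

lemma form_on_vcone:
  assumes S: "compact S" "convex S" "e \<in> S" and f: "form_on S (Suc n) \<beta>"
  shows "form_on S n (vcone e \<beta>)"
  unfolding form_on_def
proof (intro conjI ballI allI impI)
  fix x assume x: "x \<in> S"
  let ?w = "x - e"
  have w: "?w \<in> tangent S" using S x by (simp add: diff_in_tangent)
  have c: "continuous_on S (\<lambda>y. \<beta> y (?w # vs))" if "length vs = n" "set vs \<subseteq> tangent S" for vs
    by (rule smooth_on_continuous, rule form_on_smooth[OF f]) (use that w in auto)
  show "alt_form (tangent S) n (vcone e \<beta> x)"
    unfolding alt_form_def
  proof (intro conjI allI impI; elim conjE)
    fix xs ys u v a b
    assume h: "Suc (length xs + length ys) = n" "set xs \<subseteq> tangent S" "set ys \<subseteq> tangent S"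
      "u \<in> tangent S" "v \<in> tangent S"
    have "radial_int n e (\<lambda>y. \<beta> y (?w # xs @ (a *\<^sub>R u + b *\<^sub>R v) # ys)) x =
      radial_int n e (\<lambda>y. a * \<beta> y (?w # xs @ u # ys) + b * \<beta> y (?w # xs @ v # ys)) x"
      by (rule radial_int_cong[OF S(2,3) x])
        (use alt_formD1[OF form_on_alt[OF f], of _ "?w # xs" ys u v a b] h w in auto)
    also have "\<dots> = a * radial_int n e (\<lambda>y. \<beta> y (?w # xs @ u # ys)) x +
      b * radial_int n e (\<lambda>y. \<beta> y (?w # xs @ v # ys)) x"
      unfolding radial_int_cmult[symmetric]
      by (rule radial_int_add[OF S(2,3) x]; intro continuous_on_mult continuous_on_const c)
        (use h in auto)
    finally show "vcone e \<beta> x (xs @ (a *\<^sub>R u + b *\<^sub>R v) # ys) =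
      a * vcone e \<beta> x (xs @ u # ys) + b * vcone e \<beta> x (xs @ v # ys)"
      using h(1) by (simp add: vcone_def)
  next
    fix xs ys u
    assume h: "Suc (Suc (length xs + length ys)) = n" "set xs \<subseteq> tangent S" "set ys \<subseteq> tangent S"
      "u \<in> tangent S"
    have "radial_int n e (\<lambda>y. \<beta> y (?w # xs @ u # u # ys)) x = radial_int n e (\<lambda>y. 0) x"
      by (rule radial_int_cong[OF S(2,3) x])
        (use alt_formD2[OF form_on_alt[OF f], of _ "?w # xs" ys u] h w in auto)
    then show "vcone e \<beta> x (xs @ u # u # ys) = 0"
      using h(1) by (simp add: vcone_def radial_int_def)
  qed
next
  fix vs assume vs: "length vs = n \<and> set vs \<subseteq> tangent S"
  obtain B where B: "finite B" "B \<subseteq> tangent S" "\<And>v. v \<in> tangent S \<Longrightarrow> (\<Sum>b\<in>B. (v \<bullet> b) *\<^sub>R b) = v"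
    using tangent_basis by blast
  have "smooth_on S (\<lambda>x. \<Sum>b\<in>B. ((x - e) \<bullet> b) * radial_int n e (\<lambda>y. \<beta> y (b # vs)) x)"
    by (intro smooth_on_sum smooth_on_mult smooth_on_inner_diff smooth_on_radial_int(1)[OF S]
      form_on_smooth[OF f])
      (use vs B in auto)
  then show "smooth_on S (\<lambda>x. vcone e \<beta> x vs)"
    by (rule smooth_on_cong) (use vcone_expand[OF S(2,3) _ f _ _ B] vs in auto)
qed

text \<open>The product rule: the first term differentiates the inserted vector
  \<open>x - e\<close>, the second the end of the segment, which raises the weight.\<close>

lemma tderiv_vcone:
  assumes S: "compact S" "convex S" "e \<in> S" and f: "form_on S (Suc n) \<beta>"
    and vs: "length vs = n" "set vs \<subseteq> tangent S" and x: "x \<in> S" and u: "u \<in> tangent S"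
  shows "tderiv S (\<lambda>y. vcone e \<beta> y vs) x u =
    radial_int n e (\<lambda>y. \<beta> y (u # vs)) x + radial_int (Suc n) e (\<lambda>y. tderiv S (\<lambda>z. \<beta> z ((x - e)
      # vs)) y u) x"
proof -
  obtain B where B: "finite B" "B \<subseteq> tangent S" "\<And>v. v \<in> tangent S \<Longrightarrow> (\<Sum>b\<in>B. (v \<bullet> b) *\<^sub>R b) = v"
    using tangent_basis by blast
  have w: "x - e \<in> tangent S" using S x by (simp add: diff_in_tangent)
  have sm: "smooth_on S (\<lambda>y. \<beta> y (b # vs))" if "b \<in> tangent S" for b
    by (rule form_on_smooth[OF f]) (use vs that in auto)
  have smB: "smooth_on S (\<lambda>y. \<beta> y (b # vs))" if "b \<in> B" for b using sm B that by blast
  have smr: "smooth_on S (radial_int n e (\<lambda>y. \<beta> y (b # vs)))" if "b \<in> B" for b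
    by (rule smooth_on_radial_int(1)[OF S smB[OF that]])
  have "tderiv S (\<lambda>y. vcone e \<beta> y vs) x u = tderiv S (\<lambda>x. \<Sum>b\<in>B. ((x - e) \<bullet> b)
    * radial_int n e (\<lambda>y. \<beta> y (b # vs)) x) x u"
    by (rule tderiv_cong[OF x]) (rule vcone_expand[OF S(2,3) _ f vs B])
  also have "\<dots> = (\<Sum>b\<in>B. tderiv S (\<lambda>x. ((x - e) \<bullet> b) * radial_int n e (\<lambda>y. \<beta> y (b # vs)) x) x u)"
    by (rule tderiv_sum[OF S(2) x u]) (intro smooth_on_mult smooth_on_inner_diff smr)
  also have "\<dots> = (\<Sum>b\<in>B. ((x - e) \<bullet> b) * radial_int (Suc n) e (\<lambda>y. tderiv S (\<lambda>z. \<beta> z (b # vs)) y u) x +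
       (u \<bullet> b) * radial_int n e (\<lambda>y. \<beta> y (b # vs)) x)"
    by (rule sum.cong) (simp_all add: tderiv_mult[OF S(2) x u smooth_on_inner_diff smr]
      tderiv_inner_diff[OF S(2) x u]
        smooth_on_radial_int(2)[OF S smB x u])
  also have "\<dots> = radial_int (Suc n) e (\<lambda>y. \<Sum>b\<in>B. ((x - e) \<bullet> b) * tderiv S (\<lambda>z. \<beta> z (b # vs)) y u) x +
     radial_int n e (\<lambda>y. \<Sum>b\<in>B. (u \<bullet> b) * \<beta> y (b # vs)) x"
    unfolding sum.distrib
    by (subst (1 2) radial_int_sum[OF S(2,3) x])
      (simp_all add: radial_int_cmult smooth_on_continuous smooth_on_cmult smB smooth_on_tderiv[OF
        S(2) u])
  also have "radial_int n e (\<lambda>y. \<Sum>b\<in>B. (u \<bullet> b) * \<beta> y (b # vs)) x = radial_int n e (\<lambda>y. \<beta> y (u # vs)) x"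
    by (rule radial_int_cong[OF S(2,3) x]) (simp add: form_on_expand[OF f vs _ B u])
  also have "radial_int (Suc n) e (\<lambda>y. \<Sum>b\<in>B. ((x - e) \<bullet> b) * tderiv S (\<lambda>z. \<beta> z (b # vs)) y u) x =
     radial_int (Suc n) e (\<lambda>y. tderiv S (\<lambda>z. \<beta> z ((x - e) # vs)) y u) x"
  proof (rule radial_int_cong[OF S(2,3) x])
    fix y assume y: "y \<in> S"
    have "tderiv S (\<lambda>z. \<beta> z ((x - e) # vs)) y u = tderiv S (\<lambda>z. \<Sum>b\<in>B. ((x - e) \<bullet> b) * \<beta> z (b # vs)) y u"
      by (rule tderiv_cong[OF y]) (rule form_on_expand[OF f vs _ B w])
    also have "\<dots> = (\<Sum>b\<in>B. tderiv S (\<lambda>z. ((x - e) \<bullet> b) * \<beta> z (b # vs)) y u)"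
      by (rule tderiv_sum[OF S(2) y u]) (intro smooth_on_cmult smB)
    also have "\<dots> = (\<Sum>b\<in>B. ((x - e) \<bullet> b) * tderiv S (\<lambda>z. \<beta> z (b # vs)) y u)"
      by (rule sum.cong) (simp_all add: tderiv_cmult[OF S(2) y u smB])
    finally show "(\<Sum>b\<in>B. ((x - e) \<bullet> b) * tderiv S (\<lambda>z. \<beta> z (b # vs)) y u) =
      tderiv S (\<lambda>z. \<beta> z ((x - e) # vs)) y u"
      by simp
  qed
  finally show ?thesis by simp
qed

text \<open>Of the two terms of \<open>tderiv_vcone\<close>, the first sums up to
  \<open>Suc n\<close> times a radial integral by \<open>asum_insert\<close>, while the second,
  \<open>?R\<close>, cancels against the same sum in the cone of the derivative. What remains is the
  derivative in the radial direction together with the multiple of the radial integral, which is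
  \<open>radial_int_ftc_Suc\<close>.\<close>

lemma vcone_homotopy:
  assumes S: "compact S" "convex S" "e \<in> S" and f: "form_on S (Suc n) \<beta>"
    and vs: "length vs = Suc n" "set vs \<subseteq> tangent S" and x: "x \<in> S"
  shows "dform S (vcone e \<beta>) x vs + vcone e (dform S \<beta>) x vs = \<beta> x vs"
proof -
  let ?w = "x - e"
  have w: "?w \<in> tangent S" using S x by (simp add: diff_in_tangent)
  have sm: "smooth_on S (\<lambda>y. \<beta> y ws)" if "length ws = Suc n" "set ws \<subseteq> tangent S" for ws
    by (rule form_on_smooth[OF f that])
  let ?R = "\<lambda>u ws. radial_int (Suc n) e (\<lambda>y. tderiv S (\<lambda>z. \<beta> z (?w # ws)) y u) x"
  have "dform S (vcone e \<beta>) x vs = asum (\<lambda>u ws. radial_int n e (\<lambda>y. \<beta> y (u # ws)) x + ?R u ws) vs"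
    unfolding dform_def by (rule asum_cong, rule tderiv_vcone[OF S f]) (use vs x in auto)
  also have "\<dots> = asum (\<lambda>u ws. radial_int n e (\<lambda>y. \<beta> y (u # ws)) x) vs + asum ?R vs"
    by (rule asum_add)
  also have "asum (\<lambda>u ws. radial_int n e (\<lambda>y. \<beta> y (u # ws)) x) vs =
    radial_int n e (\<lambda>y. asum (\<lambda>u ws. \<beta> y (u # ws)) vs) x"
    by (rule radial_int_asum[OF S(2,3) x, symmetric], rule sm) (use vs in auto)
  also have "\<dots> = radial_int n e (\<lambda>y. real (Suc n) * \<beta> y vs) x"
    by (rule radial_int_cong[OF S(2,3) x])
      (use asum_insert[OF subspace_tangent form_on_alt[OF f], of _ "[]" vs] vs in simp)
  finally have 1: "dform S (vcone e \<beta>) x vs = real (Suc n) * radial_int n e (\<lambda>y. \<beta> y vs) x + asum ?R vs"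
    by (simp only: radial_int_cmult)
  have smd: "smooth_on S (\<lambda>y. tderiv S (\<lambda>z. \<beta> z (?w # ws)) y u)" if "u \<in> set vs" "set ws \<subseteq> set vs"
    "length vs = Suc (length ws)" for u ws
    by (rule smooth_on_tderiv[OF S(2)], use that vs in blast, rule sm) (use that vs w in auto)
  have "vcone e (dform S \<beta>) x vs = radial_int (Suc n) e
      (\<lambda>y. tderiv S (\<lambda>z. \<beta> z vs) y ?w - asum (\<lambda>u ws. tderiv S (\<lambda>z. \<beta> z (?w # ws)) y u) vs) x"
    using vs(1) by (simp add: vcone_def dform_def)
  also have "\<dots> = radial_int (Suc n) e (\<lambda>y. tderiv S (\<lambda>z. \<beta> z vs) y ?w) x -
      radial_int (Suc n) e (\<lambda>y. asum (\<lambda>u ws. tderiv S (\<lambda>z. \<beta> z (?w # ws)) y u) vs) x"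
    by (rule radial_int_diff[OF S(2,3) x])
      (auto intro!: smooth_on_continuous smooth_on_tderiv[OF S(2) w] sm vs smooth_on_asum smd)
  also have "radial_int (Suc n) e (\<lambda>y. asum (\<lambda>u ws. tderiv S (\<lambda>z. \<beta> z (?w # ws)) y u) vs) x =
    asum ?R vs"
    by (rule radial_int_asum[OF S(2,3) x]) (rule smd)
  finally have "dform S (vcone e \<beta>) x vs + vcone e (dform S \<beta>) x vs =
      radial_int (Suc n) e (\<lambda>y. tderiv S (\<lambda>z. \<beta> z vs) y ?w) x + real (Suc n)
        * radial_int n e (\<lambda>y. \<beta> y vs) x"
    using 1 by simp
  also have "\<dots> = \<beta> x vs" by (rule radial_int_ftc_Suc[OF S(2,3) x sm[OF vs]])
  finally show ?thesis .
qed

text \<open>In degree 0 the value at the apex is left over. After iterated contractions these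
  leftovers become the coefficients of \<open>proj\<close>.\<close>

lemma vcone_homotopy_0:
  assumes S: "convex S" "e \<in> S" and f: "form_on S 0 \<beta>" and x: "x \<in> S"
  shows "vcone e (dform S \<beta>) x [] = \<beta> x [] - \<beta> e []"
  using radial_int_ftc_0[OF S x form_on_smooth[OF f]] by (simp add: vcone_def dform_def)

text \<open>With apex and point in \<open>T\<close>, the segment lies in \<open>T\<close> and the
  inserted vector is tangent to \<open>T\<close>, so only the form on \<open>T\<close> enters. With
  \<open>T\<close> the whole simplex it serves as a congruence rule.\<close>

lemma vcone_restrict:
  assumes T: "convex T" "e \<in> T" "x \<in> T"
    and eq: "\<And>y ws. y \<in> T \<Longrightarrow> length ws = Suc (length vs) \<Longrightarrow> set ws \<subseteq> tangent T \<Longrightarrow> \<beta> y ws = \<gamma> y ws"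
    and vs: "set vs \<subseteq> tangent T"
  shows "vcone e \<beta> x vs = vcone e \<gamma> x vs"
  unfolding vcone_def
  by (rule radial_int_cong[OF T], rule eq) (use vs T in \<open>auto intro: diff_in_tangent\<close>)

lemma vcone_diff:
  assumes S: "convex S" "e \<in> S" "x \<in> S" and f: "form_on S (Suc n) \<beta>" "form_on S (Suc n) \<gamma>"
    and vs: "length vs = n" "set vs \<subseteq> tangent S"
  shows "vcone e (\<lambda>x vs. \<beta> x vs - \<gamma> x vs) x vs = vcone e \<beta> x vs - vcone e \<gamma> x vs"
  unfolding vcone_def
  by (rule radial_int_diff[OF S]; rule smooth_on_continuous)
    (use f vs S in \<open>auto intro!: form_on_smooth[where n="Suc n"] diff_in_tangent\<close>)

section \<open>Barycentric homotopy operators\<close>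

text \<open>The differential of the barycentric coordinate of \<open>i\<close>, which falls from 1
  at \<open>i\<close> to 0 at each other vertex. The linear map is determined by this only along the
  simplex; a choice on the whole space is convenient.\<close>

definition dbary :: "'a::euclidean_space set \<Rightarrow> 'a \<Rightarrow> 'a \<Rightarrow> real" where
  "dbary V i = (SOME l. linear l \<and> (\<forall>v\<in>V - {i}. l (v - i) = -1))"

definition bary :: "'a::euclidean_space set \<Rightarrow> 'a \<Rightarrow> 'a \<Rightarrow> real" where
  "bary V i x = 1 + dbary V i (x - i)"

lemma dbary:
  assumes V: "\<not> affine_dependent V" and i: "i \<in> V"
  shows "linear (dbary V i)" "\<And>v. v \<in> V - {i} \<Longrightarrow> dbary V i (v - i) = -1"
proof -
  have "independent ((\<lambda>x. - i + x) ` (V - {i}))"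
    using V affine_dependent_iff_dependent2[OF i] by simp
  from linear_independent_extend[OF this, of "\<lambda>x. -1::real"]
  obtain l :: "'a \<Rightarrow> real" where "linear l" "\<And>x. x \<in> (\<lambda>x. - i + x) ` (V - {i}) \<Longrightarrow> l x = -1" by blast
  then have "\<exists>l. linear l \<and> (\<forall>v\<in>V - {i}. l (v - i) = (-1::real))" by auto
  then have "linear (dbary V i) \<and> (\<forall>v\<in>V - {i}. dbary V i (v - i) = -1)"
    unfolding dbary_def by (rule someI_ex)
  then show "linear (dbary V i)" "\<And>v. v \<in> V - {i} \<Longrightarrow> dbary V i (v - i) = -1" by auto
qed

text \<open>Reduces identities between barycentric coordinates to their values at the
  vertices.\<close>

lemma linear_const_on_hull:
  fixes l :: "'a::real_vector \<Rightarrow> real"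
  assumes l: "linear l" and V: "\<And>v. v \<in> V \<Longrightarrow> l v = c" and x: "x \<in> convex hull V"
  shows "l x = c"
proof -
  have "convex {x. l x = c}"
    by (auto simp: convex_def linear_add[OF l] linear_cmul[OF l] distrib_right[symmetric])
  then have "convex hull V \<subseteq> {x. l x = c}" using V by (intro hull_minimal) auto
  then show ?thesis using x by blast
qed

lemma linear_zero_on_tangent:
  fixes l :: "'a::real_vector \<Rightarrow> real"
  assumes l: "linear l" and V: "\<And>v. v \<in> V \<Longrightarrow> l v = c" and u: "u \<in> tangent (convex hull V)"
  shows "l u = 0"
proof (rule linear_eq_0_on_span[OF l _ u[unfolded tangent_def]])
  fix w assume "w \<in> {y - x |x y. x \<in> convex hull V \<and> y \<in> convex hull V}"
  then show "l w = 0" using linear_const_on_hull[OF l V] by (auto simp: linear_diff[OF l])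
qed

lemma bary_vertex:
  assumes "\<not> affine_dependent V" "i \<in> V" "v \<in> V"
  shows "bary V i v = (if v = i then 1 else 0)"
  using dbary[OF assms(1,2)] assms(3) linear_0[OF dbary(1)[OF assms(1,2)]] by (auto simp: bary_def)

lemma dbary_conv_bary:
  assumes "\<not> affine_dependent V" "i \<in> V"
  shows "dbary V i x = bary V i x - 1 + dbary V i i"
  using linear_diff[OF dbary(1)[OF assms]] by (simp add: bary_def)

lemma
  assumes V: "\<not> affine_dependent V"
  shows sum_bary: "x \<in> convex hull V \<Longrightarrow> (\<Sum>i\<in>V. bary V i x) = 1"
    and sum_dbary: "u \<in> tangent (convex hull V) \<Longrightarrow> (\<Sum>i\<in>V. dbary V i u) = 0"
proof -
  have f: "finite V" using V by (rule aff_independent_finite)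
  \<comment> \<open>\<open>?c\<close> is the value of \<open>?L\<close> at a vertex, where the
    coordinates add up to 1.\<close>
  let ?L = "\<lambda>x. \<Sum>i\<in>V. dbary V i x" and ?c = "1 + (\<Sum>i\<in>V. dbary V i i) - real (card V)"
  have l: "linear ?L" using dbary(1)[OF V] by (intro linear_compose_sum) auto
  have e: "?L x = (\<Sum>i\<in>V. bary V i x) - real (card V) + (\<Sum>i\<in>V. dbary V i i)" for x
    by (subst sum.cong[OF refl dbary_conv_bary[OF V]]) (simp_all add: sum.distrib sum_subtractf)
  have c: "?L v = ?c" if "v \<in> V" for v
  proof -
    have "(\<Sum>i\<in>V. bary V i v) = (\<Sum>i\<in>V. if v = i then 1 else 0)"
      by (rule sum.cong) (simp_all add: bary_vertex[OF V _ that])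
    then show ?thesis unfolding e using f that by simp
  qed
  show "(\<Sum>i\<in>V. bary V i x) = 1" if x: "x \<in> convex hull V"
  proof -
    have "?L x = ?c" by (rule linear_const_on_hull[OF l c x])
    then show ?thesis using e[of x] by linarith
  qed
  show "u \<in> tangent (convex hull V) \<Longrightarrow> (\<Sum>i\<in>V. dbary V i u) = 0"
    by (rule linear_zero_on_tangent[OF l c])
qed

text \<open>On a face, sums over all vertices thereby collapse to sums over the vertices of the
  face; this is the source of all compatibility with faces below.\<close>

lemma
  assumes V: "\<not> affine_dependent V" "W \<subseteq> V" "i \<in> V" "i \<notin> W"
  shows bary_off_face: "x \<in> convex hull W \<Longrightarrow> bary V i x = 0"
    and dbary_off_face: "u \<in> tangent (convex hull W) \<Longrightarrow> dbary V i u = 0"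
proof -
  have c: "dbary V i v = dbary V i i - 1" if "v \<in> W" for v
  proof -
    have "v \<in> V" "v \<noteq> i" using that V by auto
    then have "bary V i v = 0" using bary_vertex[OF V(1,3)] by simp
    then show ?thesis using dbary_conv_bary[OF V(1,3), of v] by linarith
  qed
  show "bary V i x = 0" if x: "x \<in> convex hull W"
  proof -
    have "dbary V i x = dbary V i i - 1" by (rule linear_const_on_hull[OF dbary(1)[OF V(1,3)] c x])
    then show ?thesis using dbary_conv_bary[OF V(1,3), of x] by linarith
  qed
  show "u \<in> tangent (convex hull W) \<Longrightarrow> dbary V i u = 0"
    by (rule linear_zero_on_tangent[OF dbary(1)[OF V(1,3)] c])
qed

lemma
  assumes V: "\<not> affine_dependent V" "W \<subseteq> V" "i \<in> W"
  shows bary_face: "x \<in> convex hull W \<Longrightarrow> bary V i x = bary W i x"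
    and dbary_face: "u \<in> tangent (convex hull W) \<Longrightarrow> dbary V i u = dbary W i u"
proof -
  have W: "\<not> affine_dependent W" using V affine_independent_subset by blast
  have iV: "i \<in> V" using V by blast
  let ?L = "\<lambda>x. dbary V i x - dbary W i x"
  have l: "linear ?L" using dbary(1)[OF V(1) iV] dbary(1)[OF W V(3)] by (rule linear_compose_sub)
  have c: "?L v = ?L i" if "v \<in> W" for v
  proof -
    have "v \<in> V" using that V(2) by blast
    then have "bary V i v = bary W i v" using bary_vertex[OF V(1) iV] bary_vertex[OF W V(3) that]
      by simp
    then show ?thesis using dbary_conv_bary[OF V(1) iV, of v] dbary_conv_bary[OF W V(3), of v]
      by linarith
  qed
  show "bary V i x = bary W i x" if x: "x \<in> convex hull W"
  proof -
    have "?L x = ?L i" by (rule linear_const_on_hull[OF l c x])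
    then show ?thesis using dbary_conv_bary[OF V(1) iV, of x] dbary_conv_bary[OF W V(3), of x]
      by linarith
  qed
  show "dbary V i u = dbary W i u" if u: "u \<in> tangent (convex hull W)"
  proof -
    have "?L u = 0" by (rule linear_zero_on_tangent[OF l c u])
    then show ?thesis by simp
  qed
qed

lemma smooth_on_bary:
  assumes "\<not> affine_dependent V" "i \<in> V"
  shows "smooth_on S (bary V i)"
proof -
  have "smooth_on S (\<lambda>x. dbary V i x + (1 - dbary V i i))"
    by (intro smooth_on_add smooth_on_linear smooth_on_const dbary assms)
  moreover have "dbary V i x + (1 - dbary V i i) = bary V i x" for x
    using dbary_conv_bary[OF assms, of x] by linarith
  ultimately show ?thesis by simp
qed

lemma tderiv_bary:
  assumes V: "\<not> affine_dependent V" "i \<in> V" and S: "convex S" "x \<in> S" "u \<in> tangent S"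
  shows "tderiv S (bary V i) x u = dbary V i u"
proof -
  have "bary V i y = dbary V i y + (1 - dbary V i i)" for y
    using dbary_conv_bary[OF V, of y] by linarith
  then have "tderiv S (bary V i) x u = tderiv S (\<lambda>x. dbary V i x + (1 - dbary V i i)) x u"
    by (intro tderiv_cong[OF S(2)])
  also have "\<dots> = dbary V i u"
    using tderiv_add[OF S smooth_on_linear[OF dbary(1)[OF V]] smooth_on_const]
      tderiv_of_linear[OF S dbary(1)[OF V]] tderiv_const[OF S]
    by simp
  finally show ?thesis .
qed

text \<open>A variant of Dupont's simplicial homotopy operator, obtained by iterating the contractions
  to the vertices weighted with the barycentric coordinates.\<close>

primrec hop :: "'a::euclidean_space set \<Rightarrow> nat \<Rightarrow> ('a \<Rightarrow> 'a list \<Rightarrow> real) \<Rightarrow> 'a \<Rightarrow> 'a list \<Rightarrow> real" where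
  "hop V 0 \<alpha> = (\<lambda>x vs. 0)"
| "hop V (Suc k) \<alpha> = (\<lambda>x vs. \<Sum>i\<in>V. bary V i x * vcone i \<alpha> x vs + wedge (dbary V i)
  (hop V k (vcone i \<alpha>)) x vs)"

text \<open>The remainder that the homotopy formula forces. In degree 0 it interpolates the vertex
  values affinely; the sign in the recursion arises because the term changes sides in that
  formula.\<close>

primrec proj :: "'a::euclidean_space set \<Rightarrow> nat \<Rightarrow> ('a \<Rightarrow> 'a list \<Rightarrow> real) \<Rightarrow> 'a \<Rightarrow> 'a list \<Rightarrow> real" where
  "proj V 0 \<alpha> = (\<lambda>x vs. \<Sum>j\<in>V. \<alpha> j vs * bary V j x)"
| "proj V (Suc k) \<alpha> = (\<lambda>x vs. \<Sum>i\<in>V. - wedge (dbary V i) (proj V k (vcone i \<alpha>)) x vs)"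

declare hop.simps(2) [simp del] proj.simps(2) [simp del]

lemma wedge_zero: "wedge l (\<lambda>x vs. 0) x vs = 0"
  by (simp add: wedge_def asum_zero)

lemma hull_props:
  fixes V :: "'a::euclidean_space set"
  assumes V: "\<not> affine_dependent V"
  shows "compact (convex hull V)" "convex (convex hull V)" "i \<in> V \<Longrightarrow> i \<in> convex hull V" "finite V"
  using aff_independent_finite[OF V] by (auto simp: finite_imp_compact_convex_hull hull_inc)

lemma form_on_hop:
  assumes V: "\<not> affine_dependent V"
  shows "form_on (convex hull V) (Suc k) \<alpha> \<Longrightarrow> form_on (convex hull V) k (hop V (Suc k) \<alpha>)"
proof (induct k arbitrary: \<alpha>)
  case 0
  have "form_on (convex hull V) 0 (\<lambda>x vs. \<Sum>i\<in>V. bary V i x * vcone i \<alpha> x vs)"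
    by (intro form_on_sum form_on_mult smooth_on_bary[OF V] form_on_vcone hull_props[OF V] 0)
  then show ?case by (simp add: wedge_zero hop.simps(2))
next
  case (Suc k)
  have c: "form_on (convex hull V) (Suc k) (vcone i \<alpha>)" if "i \<in> V" for i
    by (intro form_on_vcone hull_props[OF V] that Suc.prems)
  show ?case
    unfolding hop.simps(2)[of V "Suc k"]
    by (intro form_on_sum form_on_add form_on_mult smooth_on_bary[OF V]
      form_on_wedge dbary(1)[OF V] c Suc.hyps)
qed

lemma smooth_on_hop:
  assumes V: "\<not> affine_dependent V" and f: "form_on (convex hull V) n \<alpha>"
    and vs: "n = Suc (length vs)" "set vs \<subseteq> tangent (convex hull V)"
  shows "smooth_on (convex hull V) (\<lambda>x. hop V n \<alpha> x vs)"
  using form_on_smooth[OF form_on_hop[OF V]] f vs by metis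

lemma form_on_scalar:
  assumes "smooth_on S f"
  shows "form_on S 0 (\<lambda>x vs. f x)"
  using assms by (simp add: form_on_def alt_form_def)

text \<open>Vertices outside the face drop out with their coordinates and differentials, and
  contractions to the other vertices see only the face. For \<open>W = V\<close> this is the
  congruence rule of \<open>hop\<close>.\<close>

lemma hop_restrict:
  assumes V: "\<not> affine_dependent V" "W \<subseteq> V" and x: "x \<in> convex hull W"
  shows "(\<And>y ws. y \<in> convex hull W \<Longrightarrow> length ws = n \<Longrightarrow> set ws \<subseteq> tangent (convex hull W) \<Longrightarrow> \<alpha> y ws =
    \<beta> y ws) \<Longrightarrow>
    n = Suc (length vs) \<Longrightarrow> set vs \<subseteq> tangent (convex hull W) \<Longrightarrow> hop V n \<alpha> x vs = hop W n \<beta> x vs"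
proof (induct n arbitrary: \<alpha> \<beta> vs)
  case 0
  then show ?case by simp
next
  case (Suc n)
  have W: "\<not> affine_dependent W" using V affine_independent_subset by blast
  have cc: "vcone i \<alpha> y ws = vcone i \<beta> y ws"
    if "i \<in> W" "y \<in> convex hull W" "length ws = n" "set ws \<subseteq> tangent (convex hull W)" for i y ws
    by (rule vcone_restrict[of "convex hull W"]) (use that hull_props[OF W] Suc.prems(1) in auto)
  have "hop V (Suc n) \<alpha> x vs = (\<Sum>i\<in>W. bary V i x * vcone i \<alpha> x vs + wedge (dbary V i)
    (hop V n (vcone i \<alpha>)) x vs)"
    unfolding hop.simps
  proof (rule sum.mono_neutral_right)
    show "finite V" by (rule hull_props[OF V(1)])
    show "\<forall>i\<in>V - W. bary V i x * vcone i \<alpha> x vs + wedge (dbary V i) (hop V n (vcone i \<alpha>)) x vs = 0"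
    proof
      fix i assume i: "i \<in> V - W"
      have "wedge (dbary V i) (hop V n (vcone i \<alpha>)) x vs = asum (\<lambda>u ws. 0) vs"
        unfolding wedge_def
        by (rule asum_cong) (use dbary_off_face[OF V, of i] i Suc.prems(3) in auto)
      then show "bary V i x * vcone i \<alpha> x vs + wedge (dbary V i) (hop V n (vcone i \<alpha>)) x vs = 0"
        using bary_off_face[OF V, of i x] i x by (simp add: asum_zero)
    qed
  qed (rule V(2))
  also have "\<dots> = hop W (Suc n) \<beta> x vs"
    unfolding hop.simps
  proof (rule sum.cong[OF refl])
    fix i assume i: "i \<in> W"
    have "wedge (dbary V i) (hop V n (vcone i \<alpha>)) x vs = wedge (dbary W i) (hop W n (vcone i \<beta>)) x vs"
    proof (rule wedge_cong)
      show "dbary V i u = dbary W i u" if "u \<in> set vs" for u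
        using dbary_face[OF V i] that Suc.prems(3) by blast
      show "hop V n (vcone i \<alpha>) x ws = hop W n (vcone i \<beta>) x ws" if "length vs = Suc (length ws)"
        "set ws \<subseteq> set vs" for ws
        by (rule Suc.hyps) (use that Suc.prems cc[OF i] in auto)
    qed
    moreover have "vcone i \<alpha> x vs = vcone i \<beta> x vs" by (rule cc[OF i x]) (use Suc.prems in auto)
    ultimately show "bary V i x * vcone i \<alpha> x vs + wedge (dbary V i) (hop V n (vcone i \<alpha>)) x vs =
       bary W i x * vcone i \<beta> x vs + wedge (dbary W i) (hop W n (vcone i \<beta>)) x vs"
      using bary_face[OF V i x] by simp
  qed
  finally show ?case .
qed

lemma wedge_diff:
  "wedge l (\<lambda>x vs. \<beta> x vs - \<gamma> x vs) x vs = wedge l \<beta> x vs - wedge l \<gamma> x vs"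
  by (simp add: wedge_def asum_diff[symmetric] algebra_simps)

lemma wedge_add:
  "wedge l (\<lambda>x vs. \<beta> x vs + \<gamma> x vs) x vs = wedge l \<beta> x vs + wedge l \<gamma> x vs"
  by (simp add: wedge_def asum_add[symmetric] algebra_simps)

text \<open>Serves the induction for the homotopy formula, where the operator meets a difference of
  two forms. Smoothness ensures that the integrals involved are additive.\<close>

lemma hop_diff:
  assumes V: "\<not> affine_dependent V" and x: "x \<in> convex hull V"
  shows "form_on (convex hull V) n \<alpha> \<Longrightarrow> form_on (convex hull V) n \<beta> \<Longrightarrow> n = Suc (length vs) \<Longrightarrow>
    set vs \<subseteq> tangent (convex hull V) \<Longrightarrow>
    hop V n (\<lambda>x vs. \<alpha> x vs - \<beta> x vs) x vs = hop V n \<alpha> x vs - hop V n \<beta> x vs"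
proof (induct n arbitrary: \<alpha> \<beta> vs)
  case 0
  then show ?case by simp
next
  case (Suc n)
  let ?S = "convex hull V"
  have cd: "vcone i (\<lambda>x vs. \<alpha> x vs - \<beta> x vs) y ws = vcone i \<alpha> y ws - vcone i \<beta> y ws"
    if "i \<in> V" "y \<in> ?S" "length ws = n" "set ws \<subseteq> tangent ?S" for i y ws
    by (rule vcone_diff[OF _ _ _ Suc.prems(1,2)]) (use that hull_props[OF V] in auto)
  have cf: "form_on ?S n (vcone i \<alpha>)" "form_on ?S n (vcone i \<beta>)" if "i \<in> V" for i
    by (intro form_on_vcone hull_props[OF V] that Suc.prems(1,2))+
  have "wedge (dbary V i) (hop V n (vcone i (\<lambda>x vs. \<alpha> x vs - \<beta> x vs))) x vs =
    wedge (dbary V i) (hop V n (vcone i \<alpha>)) x vs - wedge (dbary V i) (hop V n (vcone i \<beta>)) x vs"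
      if i: "i \<in> V" for i
    unfolding wedge_diff[symmetric]
  proof (rule wedge_cong[OF refl])
    fix ws assume ws: "length vs = Suc (length ws)" "set ws \<subseteq> set vs"
    have "hop V n (vcone i (\<lambda>x vs. \<alpha> x vs - \<beta> x vs)) x ws =
      hop V n (\<lambda>x vs. vcone i \<alpha> x vs - vcone i \<beta> x vs) x ws"
      by (rule hop_restrict[OF V subset_refl x]) (use cd[OF i] ws Suc.prems in auto)
    also have "\<dots> = hop V n (vcone i \<alpha>) x ws - hop V n (vcone i \<beta>) x ws"
      by (rule Suc.hyps[OF cf[OF i]]) (use ws Suc.prems in auto)
    finally show "hop V n (vcone i (\<lambda>x vs. \<alpha> x vs - \<beta> x vs)) x ws =
      hop V n (vcone i \<alpha>) x ws - hop V n (vcone i \<beta>) x ws" .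
  qed
  moreover have "vcone i (\<lambda>x vs. \<alpha> x vs - \<beta> x vs) x vs = vcone i \<alpha> x vs - vcone i \<beta> x vs"
    if "i \<in> V" for i
    by (rule cd[OF that x]) (use Suc.prems in auto)
  ultimately show ?case
    unfolding hop.simps sum_subtractf[symmetric] by (intro sum.cong refl) (simp add: right_diff_distrib)
qed

text \<open>The coordinates add up to a constant, so their differentials cancel. In the homotopy
  formula this removes the terms in which \<open>hop\<close> is applied to \<alpha> itself.\<close>

lemma sum_wedge_dbary:
  assumes V: "\<not> affine_dependent V" and vs: "set vs \<subseteq> tangent (convex hull V)"
  shows "(\<Sum>i\<in>V. wedge (dbary V i) \<beta> x vs) = 0"
proof -
  have "(\<Sum>i\<in>V. wedge (dbary V i) \<beta> x vs) = asum (\<lambda>u ws. \<Sum>i\<in>V. dbary V i u * \<beta> x ws) vs"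
    by (simp add: wedge_def asum_sum)
  also have "\<dots> = asum (\<lambda>u ws. 0) vs"
    by (rule asum_cong) (use sum_dbary[OF V] vs in \<open>auto simp: sum_distrib_right[symmetric]\<close>)
  finally show ?thesis by (simp add: asum_zero)
qed

text \<open>Induction on the degree. In the derivative of \<open>hop V (Suc n) \<alpha>\<close> the
  contraction formula returns \<alpha> weighted with coordinates that add up to 1, and the induction
  hypothesis for \<open>vcone i \<alpha>\<close> treats the product terms. The derivative is passed
  as a separate form \<delta>, which has to agree with it on tangent lists only; thus the given form
  \<omega> can take its place.\<close>

theorem hop_homotopy:
  assumes V: "\<not> affine_dependent V"
  shows "form_on (convex hull V) n \<alpha> \<Longrightarrow> form_on (convex hull V) (Suc n) \<delta> \<Longrightarrow>
    (\<And>x vs. x \<in> convex hull V \<Longrightarrow> length vs = Suc n \<Longrightarrow> set vs \<subseteq> tangent (convex hull V) \<Longrightarrow>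
      dform (convex hull V) \<alpha> x vs = \<delta> x vs) \<Longrightarrow>
    x \<in> convex hull V \<Longrightarrow> length vs = n \<Longrightarrow> set vs \<subseteq> tangent (convex hull V) \<Longrightarrow>
    \<alpha> x vs = dform (convex hull V) (hop V n \<alpha>) x vs + hop V (Suc n) \<delta> x vs + proj V n \<alpha> x vs"
proof (induct n arbitrary: \<alpha> \<delta> x vs)
  case 0
  let ?S = "convex hull V"
  note S = hull_props[OF V]
  have vs: "vs = []" using 0 by simp
  have "vcone i \<delta> x [] = \<alpha> x [] - \<alpha> i []" if i: "i \<in> V" for i
  proof -
    have "vcone i \<delta> x [] = vcone i (dform ?S \<alpha>) x []"
      by (rule vcone_restrict[OF S(2) S(3)[OF i] 0(4)]) (use 0(3) in auto)
    then show ?thesis using vcone_homotopy_0[OF S(2) S(3)[OF i] 0(1,4)] by simp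
  qed
  then have "hop V (Suc 0) \<delta> x vs = (\<Sum>i\<in>V. bary V i x * (\<alpha> x [] - \<alpha> i []))"
    unfolding vs by (simp add: wedge_def hop.simps(2))
  also have "\<dots> = (\<Sum>i\<in>V. bary V i x) * \<alpha> x [] - (\<Sum>i\<in>V. \<alpha> i [] * bary V i x)"
    unfolding sum_distrib_right sum_subtractf[symmetric] by (simp add: algebra_simps)
  finally have "hop V (Suc 0) \<delta> x vs = (\<Sum>i\<in>V. bary V i x) * \<alpha> x [] - (\<Sum>i\<in>V. \<alpha> i [] * bary V i x)" .
  then show ?case
    using sum_bary[OF V 0(4)] unfolding vs by (simp add: dform_def)
next
  case (Suc n)
  let ?S = "convex hull V"
  note S = hull_props[OF V]
  note x = Suc.prems(4) and vs = Suc.prems(5,6)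
  have cf: "form_on ?S n (vcone i \<alpha>)" "form_on ?S (Suc n) (vcone i \<delta>)" if "i \<in> V" for i
    by (intro form_on_vcone S that Suc.prems(1,2))+
  \<comment> \<open>The derivative of \<open>vcone i \<alpha>\<close>, according to the contraction
    formula.\<close>
  define \<delta>' where "\<delta>' i = (\<lambda>x vs. \<alpha> x vs - vcone i \<delta> x vs)" for i
  have f\<delta>: "form_on ?S (Suc n) (\<delta>' i)" if "i \<in> V" for i
    unfolding \<delta>'_def by (rule form_on_diff[OF Suc.prems(1) cf(2)[OF that]])
  have dc: "dform ?S (vcone i \<alpha>) y ws = \<delta>' i y ws"
    if i: "i \<in> V" and y: "y \<in> ?S" and ws: "length ws = Suc n" "set ws \<subseteq> tangent ?S" for i y ws
  proof -
    have "vcone i (dform ?S \<alpha>) y ws = vcone i \<delta> y ws"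
      by (rule vcone_restrict[OF S(2) S(3)[OF i] y]) (use Suc.prems(3) ws in auto)
    then show ?thesis
      using vcone_homotopy[OF S(1,2) S(3)[OF i] Suc.prems(1) ws y] by (simp add: \<delta>'_def)
  qed
  have IH: "vcone i \<alpha> x ws - dform ?S (hop V n (vcone i \<alpha>)) x ws =
      hop V (Suc n) \<alpha> x ws - hop V (Suc n) (vcone i \<delta>) x ws + proj V n (vcone i \<alpha>) x ws"
    if i: "i \<in> V" and ws: "length ws = n" "set ws \<subseteq> tangent ?S" for i ws
  proof -
    have "vcone i \<alpha> x ws = dform ?S (hop V n (vcone i \<alpha>)) x ws + hop V (Suc n) (\<delta>' i) x ws +
      proj V n (vcone i \<alpha>) x ws"
      by (rule Suc.hyps[OF cf(1)[OF i] f\<delta>[OF i] dc[OF i] x ws])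
    moreover have "hop V (Suc n) (\<delta>' i) x ws = hop V (Suc n) \<alpha> x ws - hop V (Suc n) (vcone i \<delta>) x ws"
      unfolding \<delta>'_def by (rule hop_diff[OF V x Suc.prems(1) cf(2)[OF i]]) (use ws in auto)
    ultimately show ?thesis by linarith
  qed
  have smc: "smooth_on ?S (\<lambda>y. vcone i \<alpha> y ws)" if "i \<in> V" "length ws = n" "set ws \<subseteq> tangent ?S"
    for i ws
    using form_on_smooth[OF cf(1)] that by blast
  have smh: "smooth_on ?S (\<lambda>y. hop V n (vcone i \<alpha>) y ws)" if "i \<in> V" "n = Suc (length ws)"
    "set ws \<subseteq> tangent ?S" for i ws
    using smooth_on_hop[OF V cf(1)] that by blast
  have sml: "smooth_on ?S (\<lambda>y. bary V i y * vcone i \<alpha> y ws)" if "i \<in> V" "length ws = n"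
    "set ws \<subseteq> tangent ?S" for i ws
    by (intro smooth_on_mult smooth_on_bary[OF V] smc that)
  have smw: "smooth_on ?S (\<lambda>y. wedge (dbary V i) (hop V n (vcone i \<alpha>)) y ws)" if "i \<in> V"
    "length ws = n" "set ws \<subseteq> tangent ?S" for i ws
    unfolding wedge_def by (intro smooth_on_asum smooth_on_cmult smh) (use that in auto)
  have "dform ?S (hop V (Suc n) \<alpha>) x vs =
      (\<Sum>i\<in>V. dform ?S (\<lambda>x vs. bary V i x * vcone i \<alpha> x vs + wedge (dbary V i)
        (hop V n (vcone i \<alpha>)) x vs) x vs)"
    unfolding hop.simps by (rule dform_sum[OF S(2) x vs(2)])
      (use sml smw vs in \<open>auto intro: smooth_on_add\<close>)
  also have "\<dots> = (\<Sum>i\<in>V. bary V i x * (\<alpha> x vs - vcone i \<delta> x vs) + (wedge (dbary V i) (vcone i \<alpha>) x vs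
        - wedge (dbary V i) (dform ?S (hop V n (vcone i \<alpha>))) x vs))"
  proof (rule sum.cong[OF refl])
    fix i assume i: "i \<in> V"
    have "dform ?S (\<lambda>x vs. bary V i x * vcone i \<alpha> x vs + wedge (dbary V i) (hop V n (vcone i \<alpha>))
      x vs) x vs =
      dform ?S (\<lambda>x vs. bary V i x * vcone i \<alpha> x vs) x vs + dform ?S (wedge (dbary V i)
        (hop V n (vcone i \<alpha>))) x vs"
      by (rule dform_add[OF S(2) x vs(2)]) (use sml[OF i] smw[OF i] vs in auto)
    also have "dform ?S (\<lambda>x vs. bary V i x * vcone i \<alpha> x vs) x vs =
        bary V i x * dform ?S (vcone i \<alpha>) x vs + wedge (dbary V i) (vcone i \<alpha>) x vs"
      by (rule dform_mult[OF S(2) x vs(2) smooth_on_bary[OF V i] tderiv_bary[OF V i S(2) x]])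
        (use smc[OF i] vs in auto)
    also have "dform ?S (wedge (dbary V i) (hop V n (vcone i \<alpha>))) x vs =
      - wedge (dbary V i) (dform ?S (hop V n (vcone i \<alpha>))) x vs"
      by (rule dform_wedge[OF S(2) x vs(2)]) (use smh[OF i] vs in auto)
    finally show "dform ?S (\<lambda>x vs. bary V i x * vcone i \<alpha> x vs + wedge (dbary V i)
      (hop V n (vcone i \<alpha>)) x vs) x vs =
      bary V i x * (\<alpha> x vs - vcone i \<delta> x vs) + (wedge (dbary V i) (vcone i \<alpha>) x vs
        - wedge (dbary V i) (dform ?S (hop V n (vcone i \<alpha>))) x vs)"
      using dc[OF i x vs] by (simp add: \<delta>'_def)
  qed
  also have "\<dots> = (\<Sum>i\<in>V. bary V i x * (\<alpha> x vs - vcone i \<delta> x vs) + (wedge (dbary V i) (hop V (Suc n)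
    \<alpha>) x vs
        - wedge (dbary V i) (hop V (Suc n) (vcone i \<delta>)) x vs + wedge (dbary V i)
          (proj V n (vcone i \<alpha>)) x vs))"
  proof (rule sum.cong[OF refl])
    fix i assume i: "i \<in> V"
    have "wedge (dbary V i) (\<lambda>x vs. vcone i \<alpha> x vs - dform ?S (hop V n (vcone i \<alpha>)) x vs) x vs =
      wedge (dbary V i) (\<lambda>x vs. hop V (Suc n) \<alpha> x vs - hop V (Suc n) (vcone i \<delta>) x vs +
        proj V n (vcone i \<alpha>) x vs) x vs"
      by (rule wedge_cong[OF refl], rule IH[OF i]) (use vs in auto)
    then show "bary V i x * (\<alpha> x vs - vcone i \<delta> x vs) + (wedge (dbary V i) (vcone i \<alpha>) x vs
        - wedge (dbary V i) (dform ?S (hop V n (vcone i \<alpha>))) x vs) =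
      bary V i x * (\<alpha> x vs - vcone i \<delta> x vs) + (wedge (dbary V i) (hop V (Suc n) \<alpha>) x vs
        - wedge (dbary V i) (hop V (Suc n) (vcone i \<delta>)) x vs + wedge (dbary V i)
          (proj V n (vcone i \<alpha>)) x vs)"
      unfolding wedge_diff wedge_add by simp
  qed
  \<comment> \<open>The \<delta> terms reassemble to \<open>hop\<close> one degree higher and the
    last terms to \<open>proj\<close>, with its sign.\<close>
  also have "\<dots> = (\<Sum>i\<in>V. bary V i x) * \<alpha> x vs + (\<Sum>i\<in>V. wedge (dbary V i) (hop V (Suc n) \<alpha>) x vs)
      - hop V (Suc (Suc n)) \<delta> x vs - proj V (Suc n) \<alpha> x vs"
    unfolding hop.simps(2)[of V "Suc n" \<delta>] proj.simps
    by (simp add: sum.distrib sum_subtractf sum_negf sum_distrib_right sum_distrib_left algebra_simps)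
  finally show ?case
    using sum_bary[OF V x] sum_wedge_dbary[OF V vs(2)] by simp
qed

section \<open>Finite rank of the projection and bounds for its coefficients\<close>

lemma sum_lists_Suc:
  assumes "finite V"
  shows "(\<Sum>J | set J \<subseteq> V \<and> length J = Suc n. f J) = (\<Sum>i\<in>V. \<Sum>J | set J \<subseteq> V \<and> length J = n. f (i # J))"
proof -
  have "(\<Sum>i\<in>V. \<Sum>J | set J \<subseteq> V \<and> length J = n. f (i # J)) =
      (\<Sum>(i, J)\<in>V \<times> {J. set J \<subseteq> V \<and> length J = n}. f (i # J))"
    by (rule sum.cartesian_product)
  also have "\<dots> = (\<Sum>J | set J \<subseteq> V \<and> length J = Suc n. f J)"
    by (rule sum.reindex_bij_witness[where i="\<lambda>J. (hd J, tl J)" and j="\<lambda>(i, J). i # J"])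
      (auto simp: length_Suc_conv)
  finally show ?thesis ..
qed

text \<open>The operator \<open>proj\<close> has finite rank. The list \<open>J\<close> ends with the vertex at which the iterated
  contraction, a function, is evaluated.\<close>

primrec coef :: "'a::euclidean_space list \<Rightarrow> ('a \<Rightarrow> 'a list \<Rightarrow> real) \<Rightarrow> real" where
  "coef [] \<alpha> = 0"
| "coef (i # J) \<alpha> = (if J = [] then \<alpha> i [] else coef J (vcone i \<alpha>))"

text \<open>Up to sign, the products of differentials of barycentric coordinates with one final
  coordinate as factor, as in Whitney's elementary forms. The empty list is a default: a form of
  degree n belongs to lists of length \<open>Suc n\<close>.\<close>

primrec wbase :: "'a::euclidean_space set \<Rightarrow> 'a list \<Rightarrow> 'a \<Rightarrow> 'a list \<Rightarrow> real" where
  "wbase V [] = (\<lambda>x vs. 0)"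
| "wbase V (i # J) = (if J = [] then (\<lambda>x vs. bary V i x) else (\<lambda>x vs. - wedge (dbary V i)
  (wbase V J) x vs))"

lemma proj_expand:
  assumes V: "finite V"
  shows "length vs = n \<Longrightarrow> proj V n \<alpha> x vs = (\<Sum>J | set J \<subseteq> V \<and> length J =
    Suc n. coef J \<alpha> * wbase V J x vs)"
proof (induct n arbitrary: \<alpha> vs)
  case 0
  have "{J. J = [] \<and> set J \<subseteq> V} = {[]}" by auto
  then show ?case using 0 by (simp add: sum_lists_Suc[OF V] conj_commute)
next
  case (Suc n)
  have "proj V (Suc n) \<alpha> x vs = (\<Sum>i\<in>V. \<Sum>J | set J \<subseteq> V \<and> length J =
    Suc n. coef (i # J) \<alpha> * wbase V (i # J) x vs)"
    unfolding proj.simps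
  proof (rule sum.cong[OF refl])
    fix i assume i: "i \<in> V"
    have "wedge (dbary V i) (proj V n (vcone i \<alpha>)) x vs =
      wedge (dbary V i) (\<lambda>x vs. \<Sum>J | set J \<subseteq> V \<and> length J =
        Suc n. coef J (vcone i \<alpha>) * wbase V J x vs) x vs"
      by (rule wedge_cong[OF refl], rule Suc.hyps) (use Suc.prems in auto)
    also have "\<dots> = (\<Sum>J | set J \<subseteq> V \<and> length J = Suc n. coef J (vcone i \<alpha>) * wedge (dbary V i)
      (wbase V J) x vs)"
      by (simp add: wedge_def asum_cmult[symmetric] asum_sum[symmetric] sum_distrib_left algebra_simps)
    finally show "- wedge (dbary V i) (proj V n (vcone i \<alpha>)) x vs =
        (\<Sum>J | set J \<subseteq> V \<and> length J = Suc n. coef (i # J) \<alpha> * wbase V (i # J) x vs)"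
      unfolding sum_negf[symmetric] by (auto simp: sum_negf[symmetric] intro!: sum.cong)
  qed
  then show ?case by (simp add: sum_lists_Suc[OF V] del: coef.simps wbase.simps)
qed

lemma form_on_wbase:
  assumes V: "\<not> affine_dependent V"
  shows "set J \<subseteq> V \<Longrightarrow> length J = Suc n \<Longrightarrow> form_on S n (wbase V J)"
proof (induct n arbitrary: J)
  case 0
  then obtain i where "J = [i]" "i \<in> V" by (cases J) auto
  then show ?case by (simp add: form_on_scalar smooth_on_bary[OF V])
next
  case (Suc n)
  then obtain i J' where J: "J = i # J'" "i \<in> V" "set J' \<subseteq> V" "length J' = Suc n" by (cases J) auto
  have "form_on S (Suc n) (\<lambda>x vs. (-1) * wedge (dbary V i) (wbase V J') x vs)"
    by (intro form_on_cmult form_on_wedge dbary(1)[OF V J(2)] Suc.hyps J(3,4))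
  then show ?case using J by auto
qed

lemma wbase_face:
  assumes V: "\<not> affine_dependent V" "W \<subseteq> V" and x: "x \<in> convex hull W"
  shows "set J \<subseteq> W \<Longrightarrow> length J = Suc (length vs) \<Longrightarrow> set vs \<subseteq> tangent (convex hull W) \<Longrightarrow>
    wbase V J x vs = wbase W J x vs"
proof (induct J arbitrary: vs)
  case (Cons i J)
  show ?case
  proof (cases "J = []")
    case True
    then show ?thesis using bary_face[OF V _ x] Cons.prems by simp
  next
    case False
    have "wedge (dbary V i) (wbase V J) x vs = wedge (dbary W i) (wbase W J) x vs"
    proof (rule wedge_cong)
      show "dbary V i u = dbary W i u" if "u \<in> set vs" for u
        using dbary_face[OF V, of i u] that Cons.prems by auto
      show "wbase V J x ws = wbase W J x ws" if "length vs = Suc (length ws)" "set ws \<subseteq> set vs" for ws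
        by (rule Cons.hyps) (use that Cons.prems in auto)
    qed
    then show ?thesis using False by simp
  qed
qed simp

text \<open>Some entry of \<open>J\<close> is not a vertex of the face; its coordinate or
  differential is a factor of the form and vanishes along the face.\<close>

lemma wbase_off_face:
  assumes V: "\<not> affine_dependent V" "W \<subseteq> V" and x: "x \<in> convex hull W"
  shows "set J \<subseteq> V \<Longrightarrow> \<not> set J \<subseteq> W \<Longrightarrow> set vs \<subseteq> tangent (convex hull W) \<Longrightarrow> wbase V J x vs = 0"
proof (induct J arbitrary: vs)
  case (Cons i J)
  show ?case
  proof (cases "J = []")
    case True
    then show ?thesis using bary_off_face[OF V _ _ x] Cons.prems by auto
  next
    case False
    have "wedge (dbary V i) (wbase V J) x vs = asum (\<lambda>u ws. 0) vs"
      unfolding wedge_def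
    proof (rule asum_cong)
      fix u ws assume h: "u \<in> set vs" "set ws \<subseteq> set vs" "length vs = Suc (length ws)"
      show "dbary V i u * wbase V J x ws = 0"
      proof (cases "i \<in> W")
        case True
        then have "wbase V J x ws = 0" by (intro Cons.hyps) (use Cons.prems h in auto)
        then show ?thesis by simp
      next
        case i: False
        have "dbary V i u = 0" by (rule dbary_off_face[OF V _ i]) (use Cons.prems h in auto)
        then show ?thesis by simp
      qed
    qed
    then show ?thesis using False by (simp add: asum_zero)
  qed
qed simp

text \<open>All contractions run along segments inside \<open>T\<close>, so a coefficient belonging
  to a face is read off from the form on that face. This lets coefficients computed on different
  simplices be compared.\<close>

lemma coef_cong:
  assumes T: "convex T"
  shows "set J \<subseteq> T \<Longrightarrow> length J = Suc n \<Longrightarrow>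
    (\<And>y ws. y \<in> T \<Longrightarrow> length ws = n \<Longrightarrow> set ws \<subseteq> tangent T \<Longrightarrow> \<alpha> y ws = \<beta> y ws) \<Longrightarrow> coef J \<alpha> = coef J \<beta>"
proof (induct n arbitrary: J \<alpha> \<beta>)
  case 0
  then obtain i where "J = [i]" "i \<in> T" by (cases J) auto
  then show ?case using 0 by simp
next
  case (Suc n)
  then obtain i J' where J: "J = i # J'" "i \<in> T" "set J' \<subseteq> T" "length J' = Suc n" by (cases J) auto
  have "coef J' (vcone i \<alpha>) = coef J' (vcone i \<beta>)"
    by (rule Suc.hyps[OF J(3,4)], rule vcone_restrict[OF T J(2)]) (use Suc.prems(3) in auto)
  then show ?case using J by auto
qed

text \<open>Uniform in the index and the point, in the Euclidean norm. A bound for every radius is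
  required because a contraction inserts vectors \<open>x - e\<close> that may be longer than the
  given ones.\<close>

definition bounded_family :: "'a::euclidean_space set \<Rightarrow> nat \<Rightarrow> 'g set \<Rightarrow> ('g \<Rightarrow> 'a \<Rightarrow> 'a list \<Rightarrow> real)
  \<Rightarrow> bool" where
  "bounded_family S n G A \<longleftrightarrow> (\<forall>r. \<exists>C. \<forall>g\<in>G. \<forall>x\<in>S. \<forall>vs.
     length vs = n \<and> set vs \<subseteq> tangent S \<inter> cball 0 r \<longrightarrow> \<bar>A g x vs\<bar> \<le> C)"

lemma abs_radial_int_le:
  assumes S: "convex S" "e \<in> S" "x \<in> S" and f: "continuous_on S f" and C: "\<And>y. y \<in> S \<Longrightarrow> \<bar>f y\<bar> \<le> C"
  shows "\<bar>radial_int n e f x\<bar> \<le> C"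
proof -
  have "continuous_on {0..1} (\<lambda>t. t ^ n * f (e + t *\<^sub>R (x - e)))"
    by (intro continuous_intros continuous_on_compose2[OF f, of "{0..1}" "\<lambda>t. e + t *\<^sub>R (x - e)"])
      (auto simp: S segment_in_convex)
  moreover have "norm (t ^ n * f (e + t *\<^sub>R (x - e))) \<le> C" if t: "t \<in> {0..1}" for t
  proof -
    have "\<bar>t ^ n\<bar> * \<bar>f (e + t *\<^sub>R (x - e))\<bar> \<le> 1 * C"
      by (intro mult_mono C segment_in_convex[OF S t]) (use t in \<open>auto simp: power_le_one\<close>)
    then show ?thesis by (simp add: abs_mult)
  qed
  ultimately have "norm (integral {0..1} (\<lambda>t. t ^ n * f (e + t *\<^sub>R (x - e)))) \<le> C * (1 - 0)"
    by (intro integral_bound) auto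
  then show ?thesis by (simp add: radial_int_def)
qed

lemma bounded_family_vcone:
  assumes S: "compact S" "convex S" "e \<in> S" and A: "\<And>g. g \<in> G \<Longrightarrow> form_on S (Suc n) (A g)"
    and b: "bounded_family S (Suc n) G A"
  shows "bounded_family S n G (\<lambda>g. vcone e (A g))"
  unfolding bounded_family_def
proof
  fix r
  obtain D where D: "\<And>x. x \<in> S \<Longrightarrow> norm (x - e) \<le> D"
  proof -
    have "bounded ((\<lambda>x. x - e) ` S)"
      by (intro compact_imp_bounded compact_continuous_image continuous_intros S)
    then show thesis using that unfolding bounded_iff by auto
  qed
  \<comment> \<open>The enlarged radius admits the inserted vector as well.\<close>
  obtain C where C: "\<And>g x vs. g \<in> G \<Longrightarrow> x \<in> S \<Longrightarrow> length vs = Suc n \<Longrightarrow>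
    set vs \<subseteq> tangent S \<inter> cball 0 (max r D) \<Longrightarrow> \<bar>A g x vs\<bar> \<le> C"
    using b unfolding bounded_family_def by meson
  have "\<bar>vcone e (A g) x vs\<bar> \<le> C"
    if g: "g \<in> G" and x: "x \<in> S" and vs: "length vs = n" "set vs \<subseteq> tangent S \<inter> cball 0 r" for g x vs
    unfolding vcone_def
  proof (rule abs_radial_int_le[OF S(2,3) x])
    have w: "set ((x - e) # vs) \<subseteq> tangent S \<inter> cball 0 (max r D)"
      using vs(2) D[OF x] diff_in_tangent[OF x S(3)] by fastforce
    show "continuous_on S (\<lambda>y. A g y ((x - e) # vs))"
      by (rule smooth_on_continuous, rule form_on_smooth[OF A[OF g]]) (use w vs in auto)
    show "\<bar>A g y ((x - e) # vs)\<bar> \<le> C" if "y \<in> S" for y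
      by (rule C[OF g that]) (use w vs in auto)
  qed
  then show "\<exists>C. \<forall>g\<in>G. \<forall>x\<in>S. \<forall>vs. length vs = n \<and> set vs \<subseteq> tangent S \<inter> cball 0 r \<longrightarrow> \<bar>vcone e (A g)
    x vs\<bar> \<le> C"
    by blast
qed

lemma bounded_coef:
  assumes S: "compact S" "convex S"
  shows "set J \<subseteq> S \<Longrightarrow> length J = Suc n \<Longrightarrow> (\<And>g. g \<in> G \<Longrightarrow> form_on S n (A g)) \<Longrightarrow> bounded_family S n G A \<Longrightarrow>
    bounded ((\<lambda>g. coef J (A g)) ` G)"
proof (induct n arbitrary: J A)
  case 0
  then obtain i where i: "J = [i]" "i \<in> S" by (cases J) auto
  obtain C where C: "\<forall>g\<in>G. \<forall>x\<in>S. \<forall>vs. length vs = 0 \<and> set vs \<subseteq> tangent S \<inter> cball 0 0 \<longrightarrow> \<bar>A g x vs\<bar> \<le> C"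
    using 0(4) unfolding bounded_family_def by blast
  show ?case unfolding bounded_iff using C i by auto
next
  case (Suc n)
  then obtain i J' where J: "J = i # J'" "i \<in> S" "set J' \<subseteq> S" "length J' = Suc n" by (cases J) auto
  have "bounded ((\<lambda>g. coef J' (vcone i (A g))) ` G)"
  proof (rule Suc.hyps[OF J(3,4)])
    show "form_on S n (vcone i (A g))" if "g \<in> G" for g
      by (rule form_on_vcone[OF S J(2) Suc.prems(3)[OF that]])
    show "bounded_family S n G (\<lambda>g. vcone i (A g))"
      by (rule bounded_family_vcone[OF S J(2) Suc.prems(3,4)])
  qed
  moreover have "coef J (A g) = coef J' (vcone i (A g))" for g using J by auto
  ultimately show ?case by simp
qed

section \<open>Boundedness and cohomology classes\<close>

lemma alt_form_bounded:
  fixes V :: "'a::euclidean_space set"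
  assumes V: "subspace V" and B: "finite B" "B \<subseteq> V" "\<And>v. v \<in> V \<Longrightarrow> (\<Sum>b\<in>B. (v \<bullet> b) *\<^sub>R b) = v"
  shows "alt_form V n f \<Longrightarrow> \<exists>C. \<forall>vs. length vs = n \<and> set vs \<subseteq> V \<inter> cball 0 r \<longrightarrow> \<bar>f vs\<bar> \<le> C"
proof (induct n arbitrary: f)
  case 0
  show ?case by (rule exI[of _ "\<bar>f []\<bar>"]) auto
next
  case (Suc n)
  have "\<forall>b\<in>B. \<exists>C. \<forall>vs. length vs = n \<and> set vs \<subseteq> V \<inter> cball 0 r \<longrightarrow> \<bar>f (b # vs)\<bar> \<le> C"
    using Suc.hyps[OF alt_form_Cons[OF Suc.prems]] B(2) by blast
  then obtain C where C: "\<And>b vs. b \<in> B \<Longrightarrow> length vs = n \<Longrightarrow> set vs \<subseteq> V \<inter> cball 0 r \<Longrightarrow> \<bar>f (b # vs)\<bar> \<le> C b"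
    by (metis bchoice)
  have "\<bar>f vs\<bar> \<le> (\<Sum>b\<in>B. (\<bar>r\<bar> * norm b) * \<bar>C b\<bar>)" if vs: "length vs = Suc n"
    "set vs \<subseteq> V \<inter> cball 0 r" for vs
  proof -
    obtain v ws where v: "vs = v # ws" "length ws = n" using vs(1) by (cases vs) auto
    have h: "v \<in> V" "norm v \<le> r" "set ws \<subseteq> V" "set ws \<subseteq> V \<inter> cball 0 r" using vs v by auto
    have "f vs = (\<Sum>b\<in>B. (v \<bullet> b) * f (b # ws))"
      using alt_form_sum_Cons[OF V Suc.prems v(2) h(3) B(1,2), of "\<lambda>b. v \<bullet> b"] B(3)[OF h(1)] v by simp
    also have "\<bar>\<dots>\<bar> \<le> (\<Sum>b\<in>B. \<bar>(v \<bullet> b) * f (b # ws)\<bar>)" by (rule sum_abs)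
    also have "\<dots> \<le> (\<Sum>b\<in>B. (\<bar>r\<bar> * norm b) * \<bar>C b\<bar>)"
    proof (rule sum_mono)
      fix b assume b: "b \<in> B"
      have "\<bar>v \<bullet> b\<bar> \<le> norm v * norm b" by (rule Cauchy_Schwarz_ineq2)
      also have "\<dots> \<le> \<bar>r\<bar> * norm b" using h(2) by (intro mult_right_mono) auto
      finally have 1: "\<bar>v \<bullet> b\<bar> \<le> \<bar>r\<bar> * norm b" .
      have 2: "\<bar>f (b # ws)\<bar> \<le> \<bar>C b\<bar>" using C[OF b v(2) h(4)] by linarith
      show "\<bar>(v \<bullet> b) * f (b # ws)\<bar> \<le> (\<bar>r\<bar> * norm b) * \<bar>C b\<bar>"
        unfolding abs_mult by (rule mult_mono[OF 1 2]) auto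
    qed
    finally show ?thesis .
  qed
  then show ?case by blast
qed

lemma alt_form_scale_map:
  assumes V: "subspace V" and f: "alt_form V n f"
  shows "length xs + length vs = n \<Longrightarrow> set xs \<subseteq> V \<Longrightarrow> set vs \<subseteq> V \<Longrightarrow>
    f (xs @ map (\<lambda>v. c *\<^sub>R v) vs) = c ^ length vs * f (xs @ vs)"
proof (induct vs arbitrary: xs)
  case (Cons v vs)
  have "c *\<^sub>R v \<in> V" using Cons.prems V by (simp add: subspace_scale)
  then have "f ((xs @ [c *\<^sub>R v]) @ map (\<lambda>v. c *\<^sub>R v) vs) = c ^ length vs * f ((xs @ [c *\<^sub>R v]) @ vs)"
    by (intro Cons.hyps) (use Cons.prems in auto)
  also have "f ((xs @ [c *\<^sub>R v]) @ vs) = c * f (xs @ v # vs)"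
    using alt_form_scale[OF f, of xs vs v c] Cons.prems by simp
  finally show ?case by simp
qed simp

lemma linear_expand:
  fixes L :: "'a::euclidean_space \<Rightarrow> real"
  assumes V: "subspace V" and B: "finite B" "B \<subseteq> V"
    and L: "\<And>u v a b. u \<in> V \<Longrightarrow> v \<in> V \<Longrightarrow> L (a *\<^sub>R u + b *\<^sub>R v) = a * L u + b * L v"
  shows "L (\<Sum>b\<in>B. c b *\<^sub>R b) = (\<Sum>b\<in>B. c b * L b)"
  using B
proof (induct B rule: finite_induct)
  case empty
  show ?case using L[of 0 0 0 0] subspace_0[OF V] by simp
next
  case (insert b B)
  have "(\<Sum>b\<in>B. c b *\<^sub>R b) \<in> V" using insert V by (auto intro!: subspace_sum subspace_scale)
  then show ?case using insert L[of b "\<Sum>b\<in>B. c b *\<^sub>R b" "c b" 1] by simp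
qed

lemma quadratic_expand:
  fixes V :: "'a::euclidean_space set"
  assumes V: "subspace V" and B: "finite B" "B \<subseteq> V" "\<And>v. v \<in> V \<Longrightarrow> (\<Sum>b\<in>B. (v \<bullet> b) *\<^sub>R b) = v"
    and sym: "\<And>u v. u \<in> V \<Longrightarrow> v \<in> V \<Longrightarrow> h u v = h v u"
    and lin: "\<And>u v w a b. u \<in> V \<Longrightarrow> v \<in> V \<Longrightarrow> w \<in> V \<Longrightarrow> h (a *\<^sub>R u + b *\<^sub>R v) w =
      a * h u w + (b::real) * h v w"
    and v: "v \<in> V"
  shows "h v v = (\<Sum>b\<in>B. \<Sum>c\<in>B. (v \<bullet> b) * (v \<bullet> c) * h b c)"
proof -
  have e: "h v w = (\<Sum>b\<in>B. (v \<bullet> b) * h b w)" if "w \<in> V" "v \<in> V" for v w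
    using linear_expand[OF V B(1,2), of "\<lambda>v. h v w" "\<lambda>b. v \<bullet> b"] lin that B(3) by simp
  have "h v v = (\<Sum>b\<in>B. (v \<bullet> b) * h b v)" by (rule e[OF v v])
  also have "\<dots> = (\<Sum>b\<in>B. (v \<bullet> b) * (\<Sum>c\<in>B. (v \<bullet> c) * h b c))"
  proof (rule sum.cong[OF refl])
    fix b assume b: "b \<in> B"
    then have bV: "b \<in> V" using B by blast
    have "h b v = (\<Sum>c\<in>B. (v \<bullet> c) * h c b)" using sym[OF bV v] e[OF bV v] by simp
    also have "\<dots> = (\<Sum>c\<in>B. (v \<bullet> c) * h b c)" using B(2) sym bV by (intro sum.cong) auto
    finally show "(v \<bullet> b) * h b v = (v \<bullet> b) * (\<Sum>c\<in>B. (v \<bullet> c) * h b c)" by simp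
  qed
  finally show ?thesis by (simp add: sum_distrib_left mult.assoc)
qed

text \<open>By compactness \<open>h\<close> has a positive minimum m on the Euclidean unit sphere of
  \<open>V\<close>, so \<open>h v v\<close> is at least m times the square of the norm.\<close>

lemma inner_product_ball_bounded:
  fixes V :: "'a::euclidean_space set"
  assumes V: "subspace V" and B: "finite B" "B \<subseteq> V" "\<And>v. v \<in> V \<Longrightarrow> (\<Sum>b\<in>B. (v \<bullet> b) *\<^sub>R b) = v"
    and sym: "\<And>u v. u \<in> V \<Longrightarrow> v \<in> V \<Longrightarrow> h u v = h v u"
    and lin: "\<And>u v w a b. u \<in> V \<Longrightarrow> v \<in> V \<Longrightarrow> w \<in> V \<Longrightarrow> h (a *\<^sub>R u + b *\<^sub>R v) w =
      a * h u w + (b::real) * h v w"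
    and pos: "\<And>u. u \<in> V \<Longrightarrow> u \<noteq> 0 \<Longrightarrow> h u u > 0"
  shows "\<exists>r. \<forall>v\<in>V. h v v \<le> 1 \<longrightarrow> norm v \<le> r"
\<comment> \<open>An empty sphere means that \<open>V\<close> is the zero space, where there is no
  minimum to take.\<close>
proof (cases "V \<inter> sphere 0 1 = {}")
  case True
  have "v = 0" if "v \<in> V" for v
  proof (rule ccontr)
    assume "v \<noteq> 0"
    then have "(1 / norm v) *\<^sub>R v \<in> V \<inter> sphere 0 1" using V that by (simp add: subspace_scale)
    then show False using True by blast
  qed
  then show ?thesis by (intro exI[of _ 0]) auto
next
  case False
  let ?q = "\<lambda>v. \<Sum>b\<in>B. \<Sum>c\<in>B. (v \<bullet> b) * (v \<bullet> c) * h b c"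
  have q: "h v v = ?q v" if "v \<in> V" for v by (rule quadratic_expand[OF V B sym lin that])
  have K: "compact (V \<inter> sphere 0 1)" using closed_subspace[OF V] by (simp add: closed_Int_compact)
  have "continuous_on (V \<inter> sphere 0 1) ?q" by (intro continuous_intros)
  then obtain z where z: "z \<in> V \<inter> sphere 0 1" "\<And>v. v \<in> V \<inter> sphere 0 1 \<Longrightarrow> ?q z \<le> ?q v"
    using continuous_attains_inf[OF K False] by blast
  define m where "m = h z z"
  have "z \<noteq> 0" using z(1) by auto
  then have m: "m > 0" unfolding m_def using pos[of z] z(1) by blast
  have "norm v \<le> sqrt (1 / m)" if v: "v \<in> V" "h v v \<le> 1" for v
  proof (cases "v = 0")
    case True then show ?thesis using m by simp
  next
    case v0: False
    let ?u = "(1 / norm v) *\<^sub>R v"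
    have u: "?u \<in> V \<inter> sphere 0 1" using V v v0 by (simp add: subspace_scale)
    have "m \<le> h ?u ?u" using z(2)[OF u] q u z(1) by (simp add: m_def)
    also have "h ?u ?u = (1 / norm v) * h v ?u"
      using lin[of v v ?u "1 / norm v" 0] u v by simp
    also have "h v ?u = (1 / norm v) * h v v"
      using lin[of v v v "1 / norm v" 0] sym[of v ?u] u v by simp
    finally have "m * (norm v)\<^sup>2 \<le> h v v" using v0 by (simp add: power2_eq_square field_simps)
    then have "(norm v)\<^sup>2 \<le> 1 / m" using v(2) m by (simp add: field_simps)
    then show ?thesis by (simp add: real_le_rsqrt)
  qed
  then show ?thesis by blast
qed

text \<open>A real supremum bounds its members only if they are bounded above. They are, since the
  unit ball of \<open>h\<close> is bounded and a multilinear form is bounded on bounded sets; lists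
  of a wrong length contribute 0.\<close>

lemma abs_le_form_norm:
  fixes V :: "'a::euclidean_space set"
  assumes V: "subspace V" and B: "finite B" "B \<subseteq> V" "\<And>v. v \<in> V \<Longrightarrow> (\<Sum>b\<in>B. (v \<bullet> b) *\<^sub>R b) = v"
    and sym: "\<And>u v. u \<in> V \<Longrightarrow> v \<in> V \<Longrightarrow> h u v = h v u"
    and lin: "\<And>u v w a b. u \<in> V \<Longrightarrow> v \<in> V \<Longrightarrow> w \<in> V \<Longrightarrow> h (a *\<^sub>R u + b *\<^sub>R v) w =
      a * h u w + (b::real) * h v w"
    and pos: "\<And>u. u \<in> V \<Longrightarrow> u \<noteq> 0 \<Longrightarrow> h u u > 0"
    and f: "alternating_form V (int n) f" and vs: "\<forall>v\<in>set vs. v \<in> V \<and> h v v \<le> 1"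
  shows "\<bar>f vs\<bar> \<le> form_norm V h f"
  unfolding form_norm_def
proof (rule cSUP_upper)
  obtain r where r: "\<And>v. v \<in> V \<Longrightarrow> h v v \<le> 1 \<Longrightarrow> norm v \<le> r"
    using inner_product_ball_bounded[OF V B sym lin pos] by blast
  obtain C where C: "\<And>ws. length ws = n \<Longrightarrow> set ws \<subseteq> V \<inter> cball 0 r \<Longrightarrow> \<bar>f ws\<bar> \<le> C"
    using alt_form_bounded[OF V B alternating_form_imp_alt_form[OF f]] by blast
  show "bdd_above ((\<lambda>vs. \<bar>f vs\<bar>) ` {vs. \<forall>v\<in>set vs. v \<in> V \<and> h v v \<le> 1})"
  proof (rule bdd_aboveI2)
    fix ws assume ws: "ws \<in> {vs. \<forall>v\<in>set vs. v \<in> V \<and> h v v \<le> 1}"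
    show "\<bar>f ws\<bar> \<le> max C 0"
    proof (cases "length ws = n")
      case True
      have "set ws \<subseteq> V \<inter> cball 0 r" using ws r by auto
      then show ?thesis using C[OF True] by (simp add: le_max_iff_disj)
    next
      case False
      then have "f ws = 0" using f unfolding alternating_form_def by auto
      then show ?thesis by simp
    qed
  qed
qed (use vs in auto)

text \<open>Over a compact simplex the metric coefficients are bounded, so the metric is at most a
  constant \<open>N\<close> times the Euclidean one. A fixed scaling then moves the ball of radius
  \<open>r\<close> into all metric unit balls, and homogeneity of degree n undoes it.\<close>

lemma riemannian_bounded_family:
  fixes S :: "'a::euclidean_space set"
  assumes g: "riemannian_metric K g" and S: "S \<in> K" "compact S"
    and A: "\<And>y x. y \<in> G \<Longrightarrow> x \<in> S \<Longrightarrow> alternating_form (tangent S) (int n) (A y x)"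
    and C: "\<And>y x. y \<in> G \<Longrightarrow> x \<in> S \<Longrightarrow> form_norm (tangent S) (g S x) (A y x) \<le> C"
  shows "bounded_family S n G A"
  unfolding bounded_family_def
proof
  fix r :: real
  let ?V = "tangent S"
  obtain B where B: "finite B" "B \<subseteq> ?V" "\<And>v. v \<in> ?V \<Longrightarrow> (\<Sum>b\<in>B. (v \<bullet> b) *\<^sub>R b) = v"
    using tangent_basis by blast
  note R = g[unfolded riemannian_metric_def]
  note R1 = bspec[OF bspec[OF conjunct1[OF R] S(1)]]
  have sym: "g S x u v = g S x v u" if "x \<in> S" "u \<in> ?V" "v \<in> ?V" for x u v
    using conjunct1[OF R1[OF that(1)]] that by blast
  have lin: "g S x (a *\<^sub>R u + b *\<^sub>R v) w = a * g S x u w + b * g S x v w"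
    if "x \<in> S" "u \<in> ?V" "v \<in> ?V" "w \<in> ?V" for x u v w a b
    using conjunct1[OF conjunct2[OF R1[OF that(1)]]] that by blast
  have pos: "g S x u u > 0" if "x \<in> S" "u \<in> ?V" "u \<noteq> 0" for x u
    using conjunct2[OF conjunct2[OF R1[OF that(1)]]] that by blast
  have smooth: "smooth_on S (\<lambda>x. g S x u v)" if "u \<in> ?V" "v \<in> ?V" for u v
    using bspec[OF conjunct1[OF conjunct2[OF R]] S(1)] that by blast
  have "\<exists>M. \<forall>x\<in>S. \<bar>g S x b c\<bar> \<le> M" if "b \<in> B" "c \<in> B" for b c
  proof -
    have "compact ((\<lambda>x. g S x b c) ` S)"
      by (intro compact_continuous_image smooth_on_continuous smooth S) (use that B in auto)
    then have "bounded ((\<lambda>x. g S x b c) ` S)" by (rule compact_imp_bounded)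
    then show ?thesis unfolding bounded_iff by auto
  qed
  then obtain M where M: "\<And>b c x. b \<in> B \<Longrightarrow> c \<in> B \<Longrightarrow> x \<in> S \<Longrightarrow> \<bar>g S x b c\<bar> \<le> M b c" by metis
  define N where "N = (\<Sum>b\<in>B. \<Sum>c\<in>B. norm b * norm c * \<bar>M b c\<bar>)"
  have N: "g S x v v \<le> (norm v)\<^sup>2 * N" if x: "x \<in> S" and v: "v \<in> ?V" for x v
  proof -
    have "g S x v v = (\<Sum>b\<in>B. \<Sum>c\<in>B. (v \<bullet> b) * (v \<bullet> c) * g S x b c)"
      by (rule quadratic_expand[OF subspace_tangent B sym[OF x] lin[OF x] v])
    also have "\<dots> \<le> (\<Sum>b\<in>B. \<Sum>c\<in>B. (norm v)\<^sup>2 * (norm b * norm c * \<bar>M b c\<bar>))"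
    proof (intro sum_mono)
      fix b c assume bc: "b \<in> B" "c \<in> B"
      have "(v \<bullet> b) * (v \<bullet> c) * g S x b c \<le> \<bar>v \<bullet> b\<bar> * \<bar>v \<bullet> c\<bar> * \<bar>g S x b c\<bar>"
        by (metis abs_ge_self abs_mult)
      also have "\<dots> \<le> (norm v * norm b) * (norm v * norm c) * \<bar>M b c\<bar>"
        using M[OF bc x] by (intro mult_mono Cauchy_Schwarz_ineq2) auto
      finally show "(v \<bullet> b) * (v \<bullet> c) * g S x b c \<le> (norm v)\<^sup>2 * (norm b * norm c * \<bar>M b c\<bar>)"
        by (simp add: power2_eq_square mult_ac)
    qed
    finally show ?thesis by (simp add: N_def sum_distrib_left)
  qed
  have N0: "N \<ge> 0" unfolding N_def by (intro sum_nonneg) auto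
  \<comment> \<open>Scaled vectors have norm at most 1 / (N + 1), hence metric square at most N / (N
    + 1)^2, which is below 1; the added ones prevent division by 0.\<close>
  define c where "c = 1 / ((\<bar>r\<bar> + 1) * (N + 1))"
  have c: "c > 0" using N0 by (simp add: c_def)
  have "\<bar>A y x vs\<bar> \<le> C / c ^ n"
    if y: "y \<in> G" and x: "x \<in> S" and vs: "length vs = n" "set vs \<subseteq> ?V \<inter> cball 0 r" for y x vs
  proof -
    let ?ws = "map (\<lambda>v. c *\<^sub>R v) vs"
    have ball: "\<forall>v\<in>set ?ws. v \<in> ?V \<and> g S x v v \<le> 1"
    proof
      fix w assume "w \<in> set ?ws"
      then obtain v where v: "v \<in> set vs" "w = c *\<^sub>R v" by auto
      have vV: "v \<in> ?V" "norm v \<le> r" using vs v by auto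
      have w: "w \<in> ?V" using vV v by (simp add: subspace_scale subspace_tangent)
      have "norm w \<le> c * (\<bar>r\<bar> + 1)" using v(2) vV(2) c by simp
      also have "\<dots> = 1 / (N + 1)" by (simp add: c_def)
      finally have "(norm w)\<^sup>2 \<le> (1 / (N + 1))\<^sup>2" by (intro power_mono) auto
      then have "(norm w)\<^sup>2 * N \<le> (1 / (N + 1))\<^sup>2 * N" using N0 by (intro mult_right_mono)
      also have "\<dots> = (1 / (N + 1)) * (N / (N + 1))" by (simp add: power2_eq_square)
      also have "\<dots> \<le> 1 * 1" using N0 by (intro mult_mono) auto
      finally show "w \<in> ?V \<and> g S x w w \<le> 1" using N[OF x w] w by linarith
    qed
    have "\<bar>A y x ?ws\<bar> \<le> form_norm ?V (g S x) (A y x)"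
      by (rule abs_le_form_norm[OF subspace_tangent B sym[OF x] lin[OF x] pos[OF x] A[OF y x] ball])
    then have "\<bar>A y x ?ws\<bar> \<le> C" using C[OF y x] by linarith
    moreover have "A y x ?ws = c ^ n * A y x vs"
      using alt_form_scale_map[OF subspace_tangent alternating_form_imp_alt_form[OF A[OF y x]],
        of "[]" vs c] vs by auto
    ultimately show ?thesis using c by (simp add: abs_mult field_simps)
  qed
  then show "\<exists>C. \<forall>y\<in>G. \<forall>x\<in>S. \<forall>vs. length vs = n \<and> set vs \<subseteq> ?V \<inter> cball 0 r \<longrightarrow> \<bar>A y x vs\<bar> \<le> C"
    by blast
qed

section \<open>Vertices of the simplices of a complex\<close>

definition verts :: "'a::euclidean_space set \<Rightarrow> 'a set" where
  "verts S = {x. x extreme_point_of S}"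

lemma
  assumes K: "simplicial_complex K" and S: "S \<in> K"
  shows verts_independent: "\<not> affine_dependent (verts S)"
    and verts_hull: "convex hull (verts S) = S"
proof -
  obtain n where "n simplex S" using K S unfolding simplicial_complex_def by blast
  then obtain C where C: "\<not> affine_dependent C" "S = convex hull C" by (auto simp: simplex)
  then have "verts S = C" by (simp add: verts_def extreme_point_of_convex_hull_affine_independent)
  then show "\<not> affine_dependent (verts S)" "convex hull (verts S) = S" using C by auto
qed

lemma simplex_compact_convex:
  assumes "simplicial_complex K" "S \<in> K"
  shows "compact S" "convex S"
  using hull_props(1,2)[OF verts_independent[OF assms]] verts_hull[OF assms] by auto

text \<open>In a simplicial complex a contained simplex is a face, being its own intersection with
  the larger one, and extreme points of a face are extreme in the whole.\<close>

lemma verts_mono: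
  assumes K: "simplicial_complex K" and S: "S \<in> K" "T \<in> K" "T \<subseteq> S"
  shows "verts T \<subseteq> verts S"
proof -
  have "S \<inter> T = T" using S by blast
  then have "T face_of S" using K S unfolding simplicial_complex_def by metis
  then show ?thesis by (auto simp: verts_def extreme_point_of_face)
qed

section \<open>Forms on a complex and their cohomology classes\<close>

lemma formsI:
  assumes "\<And>s x. \<not> (s \<in> D \<and> x \<in> p ` s) \<Longrightarrow> \<omega> s x = (\<lambda>vs. 0)"
    and "\<And>s x. s \<in> D \<Longrightarrow> x \<in> p ` s \<Longrightarrow> alternating_form (tangent (p ` s)) k (\<omega> s x)"
    and "\<And>s vs. s \<in> D \<Longrightarrow> set vs \<subseteq> tangent (p ` s) \<Longrightarrow> smooth_on (p ` s) (\<lambda>x. \<omega> s x vs)"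
    and "\<And>s t x vs. s \<in> D \<Longrightarrow> t \<in> D \<Longrightarrow> t \<subseteq> s \<Longrightarrow> x \<in> p ` t \<Longrightarrow> set vs \<subseteq> tangent (p ` t) \<Longrightarrow> \<omega> s x vs = \<omega> t x vs"
  shows "\<omega> \<in> forms D p k"
  unfolding forms_def mem_Collect_eq by (intro conjI allI ballI impI assms)

lemma forms_outside: "\<omega> \<in> forms D p k \<Longrightarrow> \<not> (s \<in> D \<and> x \<in> p ` s) \<Longrightarrow> \<omega> s x = (\<lambda>vs. 0)"
  unfolding forms_def mem_Collect_eq by (elim conjE) (erule allE, erule allE, erule mp)

lemma forms_alternating:
  "\<omega> \<in> forms D p k \<Longrightarrow> s \<in> D \<Longrightarrow> x \<in> p ` s \<Longrightarrow> alternating_form (tangent (p ` s)) k (\<omega> s x)"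
  unfolding forms_def mem_Collect_eq by (elim conjE) (drule (1) bspec, drule (1) bspec)

lemma forms_smooth:
  "\<omega> \<in> forms D p k \<Longrightarrow> s \<in> D \<Longrightarrow> set vs \<subseteq> tangent (p ` s) \<Longrightarrow> smooth_on (p ` s) (\<lambda>x. \<omega> s x vs)"
  unfolding forms_def mem_Collect_eq by blast

lemma forms_compatible:
  "\<omega> \<in> forms D p k \<Longrightarrow> s \<in> D \<Longrightarrow> t \<in> D \<Longrightarrow> t \<subseteq> s \<Longrightarrow> x \<in> p ` t \<Longrightarrow> set vs \<subseteq> tangent (p ` t) \<Longrightarrow>
    \<omega> s x vs = \<omega> t x vs"
  unfolding forms_def mem_Collect_eq by blast

lemma form_on_forms:
  assumes "\<omega> \<in> forms D p (int n)" "s \<in> D"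
  shows "form_on (p ` s) n (\<omega> s)"
  unfolding form_on_def
  using alternating_form_imp_alt_form[OF forms_alternating[OF assms]] forms_smooth[OF assms] by blast

lemma ext_deriv_conv_dform:
  "ext_deriv D p \<omega> s x vs = (if s \<in> D \<and> x \<in> p ` s \<and> set vs \<subseteq> tangent (p ` s) then dform (p ` s)
    (\<omega> s) x vs else 0)"
  unfolding ext_deriv_def dform_def asum_conv_sum tderiv_def by simp

lemma alternating_form_outside:
  "alternating_form V k f \<Longrightarrow> \<not> (int (length vs) = k \<and> set vs \<subseteq> V) \<Longrightarrow> f vs = 0"
  unfolding alternating_form_def by (elim conjE) (erule allE, erule mp)

lemma alternating_form_lincomb:
  assumes "alternating_form V k f" "alternating_form V k g"
  shows "alternating_form V k (\<lambda>vs. a * f vs + b * g vs)"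
  unfolding alternating_form_def
proof (intro conjI allI impI)
  fix vs assume "\<not> (int (length vs) = k \<and> set vs \<subseteq> V)"
  then show "a * f vs + b * g vs = 0"
    using alternating_form_outside[OF assms(1)] alternating_form_outside[OF assms(2)] by simp
next
  fix vs i u w c d
  assume "int (length vs) = k \<and> set vs \<subseteq> V \<and> i < length vs \<and> u \<in> V \<and> w \<in> V"
  then have "f (vs[i := c *\<^sub>R u + d *\<^sub>R w]) = c * f (vs[i := u]) + d * f (vs[i := w])"
    "g (vs[i := c *\<^sub>R u + d *\<^sub>R w]) = c * g (vs[i := u]) + d * g (vs[i := w])"
    by (rule assms(1)[unfolded alternating_form_def, THEN conjunct2, THEN conjunct1, rule_format],
        rule assms(2)[unfolded alternating_form_def, THEN conjunct2, THEN conjunct1, rule_format])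
  then show "a * f (vs[i := c *\<^sub>R u + d *\<^sub>R w]) + b * g (vs[i := c *\<^sub>R u + d *\<^sub>R w]) =
    c * (a * f (vs[i := u]) + b * g (vs[i := u])) + d * (a * f (vs[i := w]) + b * g (vs[i := w]))"
    by (simp add: algebra_simps)
next
  fix vs i j
  assume "int (length vs) = k \<and> set vs \<subseteq> V \<and> i < j \<and> j < length vs \<and> vs ! i = vs ! j"
  then have "f vs = 0" "g vs = 0"
    by (rule assms(1)[unfolded alternating_form_def, THEN conjunct2, THEN conjunct2, rule_format],
        rule assms(2)[unfolded alternating_form_def, THEN conjunct2, THEN conjunct2, rule_format])
  then show "a * f vs + b * g vs = 0" by simp
qed

lemma forms_lincomb:
  assumes "\<beta> \<in> forms D p k" "\<gamma> \<in> forms D p k"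
  shows "(\<lambda>s x vs. a * \<beta> s x vs + b * \<gamma> s x vs) \<in> forms D p k"
proof (rule formsI)
  fix s x assume "\<not> (s \<in> D \<and> x \<in> p ` s)"
  then show "(\<lambda>vs. a * \<beta> s x vs + b * \<gamma> s x vs) = (\<lambda>vs. 0)"
    using forms_outside[OF assms(1)] forms_outside[OF assms(2)] by simp
next
  fix s x assume "s \<in> D" "x \<in> p ` s"
  then show "alternating_form (tangent (p ` s)) k (\<lambda>vs. a * \<beta> s x vs + b * \<gamma> s x vs)"
    by (intro alternating_form_lincomb forms_alternating[OF assms(1)] forms_alternating[OF assms(2)])
next
  fix s vs assume "s \<in> D" "set vs \<subseteq> tangent (p ` s)"
  then show "smooth_on (p ` s) (\<lambda>x. a * \<beta> s x vs + b * \<gamma> s x vs)"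
    by (intro smooth_on_add smooth_on_cmult forms_smooth[OF assms(1)] forms_smooth[OF assms(2)])
next
  fix s t x vs
  assume "s \<in> D" "t \<in> D" "t \<subseteq> s" "x \<in> p ` t" "set vs \<subseteq> tangent (p ` t)"
  then show "a * \<beta> s x vs + b * \<gamma> s x vs = a * \<beta> t x vs + b * \<gamma> t x vs"
    using forms_compatible[OF assms(1)] forms_compatible[OF assms(2)] by metis
qed

lemma ext_deriv_lincomb:
  assumes D: "\<forall>s\<in>D. convex (p ` s)" and f: "\<beta> \<in> forms D p k" "\<gamma> \<in> forms D p k"
  shows "ext_deriv D p (\<lambda>s x vs. a * \<beta> s x vs + b * \<gamma> s x vs) =
    (\<lambda>s x vs. a * ext_deriv D p \<beta> s x vs + b * ext_deriv D p \<gamma> s x vs)"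
proof (intro ext)
  fix s x vs
  show "ext_deriv D p (\<lambda>s x vs. a * \<beta> s x vs + b * \<gamma> s x vs) s x vs =
    a * ext_deriv D p \<beta> s x vs + b * ext_deriv D p \<gamma> s x vs"
  proof (cases "s \<in> D \<and> x \<in> p ` s \<and> set vs \<subseteq> tangent (p ` s)")
    case True
    then have c: "convex (p ` s)" "x \<in> p ` s" "set vs \<subseteq> tangent (p ` s)" using D by auto
    have sm: "smooth_on (p ` s) (\<lambda>y. \<beta> s y ws)" "smooth_on (p ` s) (\<lambda>y. \<gamma> s y ws)"
      if "set ws \<subseteq> tangent (p ` s)" for ws
      using forms_smooth[OF f(1)] forms_smooth[OF f(2)] True that by blast+
    have "dform (p ` s) (\<lambda>x vs. a * \<beta> s x vs + b * \<gamma> s x vs) x vs =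
      dform (p ` s) (\<lambda>x vs. a * \<beta> s x vs) x vs + dform (p ` s) (\<lambda>x vs. b * \<gamma> s x vs) x vs"
      by (rule dform_add[OF c]) (auto intro: smooth_on_cmult sm)
    also have "dform (p ` s) (\<lambda>x vs. a * \<beta> s x vs) x vs = a * dform (p ` s) (\<beta> s) x vs"
      by (rule dform_cmult[OF c]) (rule sm)
    also have "dform (p ` s) (\<lambda>x vs. b * \<gamma> s x vs) x vs = b * dform (p ` s) (\<gamma> s) x vs"
      by (rule dform_cmult[OF c]) (rule sm)
    finally show ?thesis using True by (simp add: ext_deriv_conv_dform)
  qed (auto simp: ext_deriv_conv_dform)
qed

lemma zero_form_in_forms: "zero_form \<in> forms D p k"
  by (rule formsI) (simp_all add: zero_form_def alternating_form_def smooth_on_const)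

lemma ext_deriv_zero_form:
  assumes "\<forall>s\<in>D. convex (p ` s)"
  shows "ext_deriv D p zero_form = zero_form"
  using ext_deriv_lincomb[OF assms zero_form_in_forms zero_form_in_forms, of 0 0]
    by (simp add: zero_form_def)

lemma equiv_cohomologous:
  assumes D: "\<forall>s\<in>D. convex (p ` s)"
  shows "equiv (closed_forms D p k) (cohomologous D p k)"
proof (rule equivI)
  show "cohomologous D p k \<subseteq> closed_forms D p k \<times> closed_forms D p k"
    by (auto simp: cohomologous_def)
  have "(\<omega>, \<omega>) \<in> cohomologous D p k" if "\<omega> \<in> closed_forms D p k" for \<omega>
    using that zero_form_in_forms[of D p "k - 1"] ext_deriv_zero_form[OF D]
    by (auto simp: cohomologous_def zero_form_def intro!: bexI[of _ zero_form])
  then show "refl_on (closed_forms D p k) (cohomologous D p k)"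
    by (auto simp: refl_on_def)
  show "sym (cohomologous D p k)"
  proof (rule symI)
    fix \<omega> \<omega>' assume h: "(\<omega>, \<omega>') \<in> cohomologous D p k"
    then obtain \<beta> where b: "\<beta> \<in> forms D p (k - 1)" "ext_deriv D p \<beta> = (\<lambda>s x vs. \<omega>' s x vs - \<omega> s x vs)"
      by (auto simp: cohomologous_def)
    show "(\<omega>', \<omega>) \<in> cohomologous D p k"
      using h forms_lincomb[OF b(1) b(1), of "-1" 0] ext_deriv_lincomb[OF D b(1) b(1), of "-1" 0]
      by (auto simp: cohomologous_def b(2) intro!: bexI[of _ "\<lambda>s x vs. (-1) * \<beta> s x vs + 0 * \<beta> s x vs"])
  qed
  show "trans (cohomologous D p k)"
  proof (rule transI)
    fix \<omega> \<omega>' \<omega>'' assume h: "(\<omega>, \<omega>') \<in> cohomologous D p k" "(\<omega>', \<omega>'') \<in> cohomologous D p k"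
    obtain \<beta> where b: "\<beta> \<in> forms D p (k - 1)" "ext_deriv D p \<beta> = (\<lambda>s x vs. \<omega>' s x vs - \<omega> s x vs)"
      using h(1) by (auto simp: cohomologous_def)
    obtain \<gamma> where c: "\<gamma> \<in> forms D p (k - 1)" "ext_deriv D p \<gamma> = (\<lambda>s x vs. \<omega>'' s x vs - \<omega>' s x vs)"
      using h(2) by (auto simp: cohomologous_def)
    show "(\<omega>, \<omega>'') \<in> cohomologous D p k"
      using h forms_lincomb[OF b(1) c(1), of 1 1] ext_deriv_lincomb[OF D b(1) c(1), of 1 1]
      by (auto simp: cohomologous_def b(2) c(2) intro!: bexI[of _ "\<lambda>s x vs. 1 * \<beta> s x vs +
        1 * \<gamma> s x vs"])
  qed
qed

lemma cohomology_class_eq_zero: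
  assumes D: "\<forall>s\<in>D. convex (p ` s)" and w: "w \<in> cohomology D p k" "\<omega> \<in> w"
    and b: "\<beta> \<in> forms D p (k - 1)" "ext_deriv D p \<beta> = \<omega>"
  shows "w = cohomology_zero D p k"
proof -
  obtain \<omega>0 where w0: "w = cohomologous D p k `` {\<omega>0}"
    using w(1) unfolding cohomology_def by (auto elim: quotientE)
  then have 1: "(\<omega>0, \<omega>) \<in> cohomologous D p k" using w(2) by simp
  have "zero_form \<in> closed_forms D p k"
    unfolding closed_forms_def using zero_form_in_forms ext_deriv_zero_form[OF D] by blast
  moreover have "\<omega> \<in> closed_forms D p k" using 1 by (simp add: cohomologous_def)
  ultimately have 2: "(zero_form, \<omega>) \<in> cohomologous D p k"
    using b by (auto simp: cohomologous_def zero_form_def intro!: bexI[of _ \<beta>])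
  have "(\<omega>0, zero_form) \<in> cohomologous D p k"
    using equiv_cohomologous[OF D, of k] 1 2 unfolding equiv_def by (meson symD transD)
  then show ?thesis
    unfolding w0 cohomology_zero_def by (rule equiv_class_eq[OF equiv_cohomologous[OF D]])
qed

section \<open>Averaging primitives\<close>

text \<open>The constant loops at two points are freely homotopic, and following one parameter value
  through the homotopy gives a path.\<close>

lemma simply_connected_imp_path_connected_general:
  assumes "simply_connected S"
  shows "path_connected S"
  unfolding path_connected_component
proof (intro ballI)
  fix x y assume "x \<in> S" "y \<in> S"
  then have "homotopic_loops S (\<lambda>t. x) (\<lambda>t. y)"
    by (intro assms[unfolded simply_connected_def, rule_format])
      (auto simp: path_def path_image_def pathstart_def pathfinish_def)
  then show "path_component S x y"
    using homotopic_loops_imp_path_component_value[of S "\<lambda>t. x" "\<lambda>t. y" 0] by simp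
qed

lemma sheet_lifted:
  fixes p :: "'b::topological_space \<Rightarrow> 'a::euclidean_space"
  assumes cov: "covering_space Xt p X" and S: "S \<in> K" "compact S" "convex S" "S \<subseteq> X"
    and y: "y \<in> Xt" "p y \<in> S"
  shows "sheet Xt p S y \<in> lifted_simplices K Xt p" "p ` sheet Xt p S y = S"
proof -
  obtain s q where s: "s \<subseteq> Xt" "y \<in> s" "homeomorphism s S p q" using sheet_ex[OF cov S(2-4) y] by blast
  have e: "sheet Xt p S y = s" by (rule sheet_eq[OF cov convex_connected[OF S(3)] s])
  show "sheet Xt p S y \<in> lifted_simplices K Xt p"
    unfolding e lifted_simplices_def using s S(1) by blast
  show "p ` sheet Xt p S y = S" unfolding e using s(3) by (simp add: homeomorphism_def)
qed

text \<open>On a simplex, each sheet yields the primitive \<alpha> - d h \<alpha> of \<omega>, and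
  these primitives differ in finitely many coefficients only. Their means no longer refer to a
  sheet.\<close>

lemma primitive_descends:
  fixes K :: "'a::euclidean_space set set" and p :: "'b::topological_space \<Rightarrow> 'a"
  assumes K: "simplicial_complex K" and cov: "covering_space Xt p (\<Union>K)"
    and X: "path_connected (\<Union>K)" "x0 \<in> \<Union>K" and am: "amenable (fundamental_group (\<Union>K) x0)"
    and \<omega>: "\<omega> \<in> forms K id (int (Suc n))"
    and \<alpha>: "\<alpha> \<in> forms (lifted_simplices K Xt p) p (int n)"
    and d\<alpha>: "ext_deriv (lifted_simplices K Xt p) p \<alpha> = pullback_form K Xt p \<omega>"
    and g: "riemannian_metric K g" and bd: "bounded_form (lifted_simplices K Xt p)
      p (lifted_metric p g) \<alpha>"
  shows "\<exists>\<beta>\<in>forms K id (int n). ext_deriv K id \<beta> = \<omega>"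
proof -
  let ?X = "\<Union>K" and ?L = "lifted_simplices K Xt p"
  obtain M :: "'a \<Rightarrow> ('b \<Rightarrow> real) \<Rightarrow> real" where
    M_lin: "\<And>b f h c d. b \<in> ?X \<Longrightarrow> bounded (f ` fibre Xt p b) \<Longrightarrow> bounded (h ` fibre Xt p b) \<Longrightarrow>
      M b (\<lambda>y. c * f y + d * h y) = c * M b f + d * M b h" and
    M_cong: "\<And>b f h. b \<in> ?X \<Longrightarrow> bounded (f ` fibre Xt p b) \<Longrightarrow> (\<And>y. y \<in> fibre Xt p b \<Longrightarrow> f y = h y) \<Longrightarrow>
      M b f = M b h" and
    M_one: "\<And>b. b \<in> ?X \<Longrightarrow> M b (\<lambda>y. 1) = 1" and
    M_inv: "\<And>q f. path q \<Longrightarrow> path_image q \<subseteq> ?X \<Longrightarrow> bounded (f ` fibre Xt p (pathfinish q)) \<Longrightarrow>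
      M (pathstart q) (\<lambda>y. f (transport Xt p q y)) = M (pathfinish q) f"
    using amenable_imp_transport_invariant_mean[OF cov X am] by blast
  have b1: "bounded ((\<lambda>y. c) ` A)" for c :: real and A :: "'b set"
    by (rule bounded_subset[of "{c}"]) auto
  have M_const: "M b (\<lambda>y. c) = c" if "b \<in> ?X" for b c
    using M_lin[OF that b1 b1, of c 1 0 1] M_one[OF that] by simp
  \<comment> \<open>Boundedness is carried along because linearity of the mean is available for
    bounded functions only.\<close>
  have M_sum: "bounded ((\<lambda>y. \<Sum>j\<in>I. d j * f j y) ` fibre Xt p b) \<and> M b (\<lambda>y. \<Sum>j\<in>I. d j * f j y) =
    (\<Sum>j\<in>I. d j * M b (f j))"
    if "b \<in> ?X" "finite I" "\<And>j. j \<in> I \<Longrightarrow> bounded (f j ` fibre Xt p b)" for b and I :: "'a list set"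
      and d f
    using that(2,3)
  proof (induct I rule: finite_induct)
    case empty
    then show ?case using b1 M_const[OF that(1)] by simp
  next
    case (insert j I)
    let ?s = "\<lambda>y. \<Sum>j\<in>I. d j * f j y"
    have bj: "bounded (f j ` fibre Xt p b)" and bI: "bounded (?s ` fibre Xt p b)" and e: "M b ?s =
      (\<Sum>j\<in>I. d j * M b (f j))"
      using insert by auto
    have "bounded ((\<lambda>y. d j * f j y) ` fibre Xt p b)"
      using bounded_scaling[OF bj, of "d j"] by (simp add: image_image)
    then have "bounded ((\<lambda>y. d j * f j y + ?s y) ` fibre Xt p b)"
      using bounded_plus_comp[of "\<lambda>y. d j * f j y" "fibre Xt p b" ?s] bI by simp
    then show ?case using M_lin[OF that(1) bj bI, of "d j" 1] e insert by simp
  qed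
  \<comment> \<open>The fibre over a base point indexes the sheets of a simplex. The empty simplex,
    a face of every other, has no base point, hence the recurring assumption
    \<open>x \<in> S\<close>.\<close>
  define b where "b S = (SOME x. x \<in> S)" for S :: "'a set"
  have b: "b S \<in> S" if "x \<in> S" for S x unfolding b_def using that by (rule someI)
  have SX: "S \<subseteq> ?X" if "S \<in> K" for S using that by blast
  note cc = simplex_compact_convex[OF K]
  note vi = verts_independent[OF K] and vh = verts_hull[OF K]
  have vS: "verts S \<subseteq> S" if "S \<in> K" for S
    using hull_subset[of "verts S" convex] vh[OF that] by simp
  define L where "L S y = sheet Xt p S y" for S y
  have L: "L S y \<in> ?L" "p ` L S y = S" if "S \<in> K" "x \<in> S" "y \<in> fibre Xt p (b S)" for S x y
    using sheet_lifted[OF cov that(1) cc[OF that(1)] SX[OF that(1)], of y] b[OF that(2)] that(3)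
    by (auto simp: L_def fibre_def)
  have f\<omega>: "form_on S (Suc n) (\<omega> S)" if "S \<in> K" for S
    using form_on_forms[OF \<omega> that] by simp
  have f\<alpha>: "form_on S n (\<alpha> (L S y))" if "S \<in> K" "x \<in> S" "y \<in> fibre Xt p (b S)" for S x y
    using form_on_forms[OF \<alpha> L(1)[OF that]] L(2)[OF that] by simp
  have d\<alpha>': "dform S (\<alpha> (L S y)) x vs = \<omega> S x vs"
    if S: "S \<in> K" "x \<in> S" and y: "y \<in> fibre Xt p (b S)" and vs: "set vs \<subseteq> tangent S" for S y x vs
  proof -
    have "ext_deriv ?L p \<alpha> (L S y) x vs = dform S (\<alpha> (L S y)) x vs"
      using L[OF S y] S vs by (simp add: ext_deriv_conv_dform)
    then show ?thesis using L[OF S y] by (simp add: d\<alpha> pullback_form_def)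
  qed
  \<comment> \<open>Boundedness of \<alpha> enters here. The lifted metric depends on the image of a
    sheet only, so all sheets over \<open>S\<close> are measured by the same metric.\<close>
  have fam: "bounded_family S n (fibre Xt p (b S)) (\<lambda>y. \<alpha> (L S y))" if S: "S \<in> K" "x \<in> S" for S x
  proof -
    obtain C where C: "\<And>s x. s \<in> ?L \<Longrightarrow> x \<in> p ` s \<Longrightarrow> form_norm (tangent (p ` s)) (g (p ` s) x) (\<alpha> s x) \<le> C"
      using bd unfolding bounded_form_def lifted_metric_def by blast
    show ?thesis
    proof (rule riemannian_bounded_family[OF g S(1) cc(1)[OF S(1)]])
      fix y z assume y: "y \<in> fibre Xt p (b S)" and z: "z \<in> S"
      show "alternating_form (tangent S) (int n) (\<alpha> (L S y) z)"
        using forms_alternating[OF \<alpha> L(1)[OF S y], of z] L(2)[OF S y] z by simp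
      show "form_norm (tangent S) (g S z) (\<alpha> (L S y) z) \<le> C"
        using C[OF L(1)[OF S y], of z] L(2)[OF S y] z by simp
    qed
  qed
  let ?I = "\<lambda>S. {J. set J \<subseteq> verts S \<and> length J = Suc n}"
  have finI: "finite (?I S)" if "S \<in> K" for S
    by (rule finite_lists_length_eq) (rule hull_props(4)[OF vi[OF that]])
  have bcoef: "bounded ((\<lambda>y. coef J (\<alpha> (L S y))) ` fibre Xt p (b S))"
    if S: "S \<in> K" "x \<in> S" and J: "set J \<subseteq> S" "length J = Suc n" for S x J
    by (rule bounded_coef[OF cc[OF S(1)] J f\<alpha>[OF S] fam[OF S]])
  define c where "c S J = M (b S) (\<lambda>y. coef J (\<alpha> (L S y)))" for S J
  define \<beta>' where "\<beta>' S x vs = hop (verts S) (Suc n) (\<omega> S) x vs +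
    (\<Sum>J\<in>?I S. c S J * wbase (verts S) J x vs)" for S x vs
  have fhop: "form_on S n (hop (verts S) (Suc n) (\<omega> S))" if "S \<in> K" for S
    using form_on_hop[OF vi[OF that], of n "\<omega> S"] f\<omega>[OF that] vh[OF that] by simp
  have fw: "form_on S n (wbase (verts S) J)" if "S \<in> K" "J \<in> ?I S" for S J
    using form_on_wbase[OF vi[OF that(1)]] that(2) by simp
  have f\<beta>': "form_on S n (\<beta>' S)" if "S \<in> K" for S
    unfolding \<beta>'_def[abs_def] by (intro form_on_add fhop form_on_sum form_on_cmult fw that)
  \<comment> \<open>Arbitrary coefficients \<open>e\<close>, since this is applied to those of a
    single sheet and to the averaged ones.\<close>
  have comb: "dform S (\<lambda>x vs. hop (verts S) (Suc n) (\<omega> S) x vs + (\<Sum>J\<in>?I S. e J * wbase (verts S)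
    J x vs)) x vs =
      dform S (hop (verts S) (Suc n) (\<omega> S)) x vs + (\<Sum>J\<in>?I S. e J * dform S (wbase (verts S) J) x vs)"
    if S: "S \<in> K" "x \<in> S" and vs: "length vs = Suc n" "set vs \<subseteq> tangent S" for S x vs e
  proof -
    have sw: "smooth_on S (\<lambda>y. wbase (verts S) J y ws)" if "J \<in> ?I S" "length vs =
      Suc (length ws)" "set ws \<subseteq> tangent S" for J ws
      by (rule form_on_smooth[OF fw[OF S(1) that(1)]]) (use that vs in auto)
    have sh: "smooth_on S (\<lambda>y. hop (verts S) (Suc n) (\<omega> S) y ws)" if "length vs = Suc (length ws)"
      "set ws \<subseteq> tangent S" for ws
      by (rule form_on_smooth[OF fhop[OF S(1)]]) (use that vs in auto)
    have "dform S (\<lambda>x vs. hop (verts S) (Suc n) (\<omega> S) x vs + (\<Sum>J\<in>?I S. e J * wbase (verts S)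
      J x vs)) x vs =
      dform S (hop (verts S) (Suc n) (\<omega> S)) x vs + dform S (\<lambda>x vs. \<Sum>J\<in>?I S. e J * wbase (verts S)
        J x vs) x vs"
      by (rule dform_add[OF cc(2)[OF S(1)] S(2) vs(2) sh])
        (auto intro!: smooth_on_sum smooth_on_cmult sw)
    also have "dform S (\<lambda>x vs. \<Sum>J\<in>?I S. e J * wbase (verts S) J x vs) x vs =
      (\<Sum>J\<in>?I S. dform S (\<lambda>x vs. e J * wbase (verts S) J x vs) x vs)"
      by (rule dform_sum[OF cc(2)[OF S(1)] S(2) vs(2)]) (intro smooth_on_cmult sw)
    also have "\<dots> = (\<Sum>J\<in>?I S. e J * dform S (wbase (verts S) J) x vs)"
      by (rule sum.cong[OF refl], rule dform_cmult[OF cc(2)[OF S(1)] S(2) vs(2)]) (rule sw)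
    finally show ?thesis .
  qed
  have d\<beta>': "dform S (\<beta>' S) x vs = \<omega> S x vs"
    if S: "S \<in> K" "x \<in> S" and vs: "length vs = Suc n" "set vs \<subseteq> tangent S" for S x vs
  proof -
    let ?D = "dform S (hop (verts S) (Suc n) (\<omega> S)) x vs" and ?W =
      "\<lambda>J. dform S (wbase (verts S) J) x vs"
    have bS: "b S \<in> ?X" using b[OF S(2)] S(1) by blast
    \<comment> \<open>By the homotopy formula the left side is the derivative of \<alpha> - d h
      \<alpha> on the sheet, and d d = 0.\<close>
    have eq: "?D + (\<Sum>J\<in>?I S. ?W J * coef J (\<alpha> (L S y))) = \<omega> S x vs" if y: "y \<in> fibre Xt p (b S)" for y
    proof -
      let ?a = "\<alpha> (L S y)"
      note fa = f\<alpha>[OF S y]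
      have "?D + (\<Sum>J\<in>?I S. coef J ?a * ?W J) =
        dform S (\<lambda>x vs. hop (verts S) (Suc n) (\<omega> S) x vs + (\<Sum>J\<in>?I S. coef J ?a * wbase (verts S)
          J x vs)) x vs"
        by (rule comb[OF S vs, symmetric])
      also have "\<dots> = dform S (\<lambda>x vs. ?a x vs - dform S (hop (verts S) n ?a) x vs) x vs"
      proof (rule dform_cong[OF S(2) vs(2)])
        fix z ws assume z: "z \<in> S" and ws: "length vs = Suc (length ws)" "set ws \<subseteq> tangent S"
        have lw: "length ws = n" using ws vs by simp
        have "?a z ws = dform S (hop (verts S) n ?a) z ws + hop (verts S) (Suc n) (\<omega> S) z ws +
          proj (verts S) n ?a z ws"
          using hop_homotopy[OF vi[OF S(1)], unfolded vh[OF S(1)], OF fa f\<omega>[OF S(1)] _ z lw ws(2)]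
            d\<alpha>'[OF S(1) _ y] by blast
        then show "hop (verts S) (Suc n) (\<omega> S) z ws + (\<Sum>J\<in>?I S. coef J ?a * wbase (verts S) J z ws) =
            ?a z ws - dform S (hop (verts S) n ?a) z ws"
          using proj_expand[OF hull_props(4)[OF vi[OF S(1)]] lw, of ?a z] by simp
      qed
      also have "\<dots> = dform S ?a x vs - dform S (dform S (hop (verts S) n ?a)) x vs"
      proof (rule dform_diff[OF cc(2)[OF S(1)] S(2) vs(2)])
        fix ws assume ws: "length vs = Suc (length ws)" "set ws \<subseteq> tangent S"
        show "smooth_on S (\<lambda>y. ?a y ws)" by (rule form_on_smooth[OF fa]) (use ws vs in auto)
        show "smooth_on S (\<lambda>z. dform S (hop (verts S) n ?a) z ws)"
          unfolding dform_def
        proof (rule smooth_on_asum, rule smooth_on_tderiv[OF cc(2)[OF S(1)]])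
          fix u zs assume h: "u \<in> set ws" "set zs \<subseteq> set ws" "length ws = Suc (length zs)"
          show "u \<in> tangent S" using h ws by blast
          show "smooth_on S (\<lambda>y. hop (verts S) n ?a y zs)"
            using smooth_on_hop[OF vi[OF S(1)], unfolded vh[OF S(1)], OF fa, of zs] h ws vs by auto
        qed
      qed
      also have "dform S (dform S (hop (verts S) n ?a)) x vs = 0"
        by (rule dform_dform[OF cc(2)[OF S(1)] S(2) vs(2)], rule smooth_on_hop[OF vi[OF S(1)],
          unfolded vh[OF S(1)], OF fa])
          (use vs in auto)
      also have "dform S ?a x vs = \<omega> S x vs" by (rule d\<alpha>'[OF S y vs(2)])
      finally show ?thesis by (simp add: mult.commute)
    qed
    have bJ: "bounded ((\<lambda>y. coef J (\<alpha> (L S y))) ` fibre Xt p (b S))" if "J \<in> ?I S" for J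
      by (rule bcoef[OF S]) (use that vS[OF S(1)] in auto)
    have Ms: "bounded ((\<lambda>y. \<Sum>J\<in>?I S. ?W J * coef J (\<alpha> (L S y))) ` fibre Xt p (b S)) \<and>
      M (b S) (\<lambda>y. \<Sum>J\<in>?I S. ?W J * coef J (\<alpha> (L S y))) =
        (\<Sum>J\<in>?I S. ?W J * M (b S) (\<lambda>y. coef J (\<alpha> (L S y))))"
      by (rule M_sum[OF bS finI[OF S(1)]]) (rule bJ)
    then have "(\<Sum>J\<in>?I S. ?W J * c S J) = M (b S) (\<lambda>y. \<Sum>J\<in>?I S. ?W J * coef J (\<alpha> (L S y)))"
      unfolding c_def by simp
    \<comment> \<open>On the fibre the sum is constant by \<open>eq\<close>, so only the mean of a
      constant has to be known.\<close>
    also have "\<dots> = M (b S) (\<lambda>y. \<omega> S x vs - ?D)"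
    proof (rule M_cong[OF bS conjunct1[OF Ms]])
      show "(\<Sum>J\<in>?I S. ?W J * coef J (\<alpha> (L S y))) = \<omega> S x vs - ?D" if "y \<in> fibre Xt p (b S)" for y
        using eq[OF that] by linarith
    qed
    also have "\<dots> = \<omega> S x vs - ?D" by (rule M_const[OF bS])
    finally show ?thesis
      unfolding \<beta>'_def[abs_def] comb[OF S vs] by (simp add: mult.commute)
  qed
  \<comment> \<open>The coefficient on a sheet over \<open>S\<close> equals the one on its face over
    \<open>T\<close>, which is found by transport along the segment of base points; invariance of
    the mean then removes the transport.\<close>
  have c_face: "c S J = c T J" if ST: "S \<in> K" "T \<in> K" "T \<subseteq> S" and x: "x \<in> T"
    and J: "set J \<subseteq> verts T" "length J = Suc n" for S T x J
  proof -
    have xS: "x \<in> S" using x ST by blast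
    have bb: "b S \<in> S" "b T \<in> T" using b x xS by blast+
    let ?q = "linepath (b S) (b T)"
    have qS: "path_image ?q \<subseteq> S"
      using closed_segment_subset[OF _ _ cc(2)[OF ST(1)], of "b S" "b T"] bb ST by auto
    have JT: "set J \<subseteq> T" using J vS[OF ST(2)] by blast
    have tr: "transport Xt p ?q y \<in> fibre Xt p (b T)" if y: "y \<in> fibre Xt p (b S)" for y
      using transport_in_fibre[OF cov, of ?q y] y qS SX[OF ST(1)] by auto
    have "coef J (\<alpha> (L S y)) = coef J (\<alpha> (L T (transport Xt p ?q y)))"
      if y: "y \<in> fibre Xt p (b S)" for y
    proof (rule coef_cong[OF cc(2)[OF ST(2)] JT J(2)])
      fix z ws assume z: "z \<in> T" "set ws \<subseteq> tangent T"
      have "L T (transport Xt p ?q y) \<subseteq> L S y"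
        unfolding L_def by (rule sheet_face[OF cov cc[OF ST(1)] SX[OF ST(1)] cc(2)[OF ST(2)] ST(3)
          bb y])
      then show "\<alpha> (L S y) z ws = \<alpha> (L T (transport Xt p ?q y)) z ws"
        using forms_compatible[OF \<alpha> L(1)[OF ST(1) xS y] L(1)[OF ST(2) x tr[OF y]]] L(2)[OF ST(2)
          x tr[OF y]] z by simp
    qed
    then have "c S J = M (b S) (\<lambda>y. coef J (\<alpha> (L T (transport Xt p ?q y))))"
      unfolding c_def by (intro M_cong bcoef[OF ST(1) xS]) (use bb ST J JT in auto)
    also have "\<dots> = M (b T) (\<lambda>y. coef J (\<alpha> (L T y)))"
      using M_inv[of ?q "\<lambda>y. coef J (\<alpha> (L T y))"] bcoef[OF ST(2) x JT J(2)] qS SX[OF ST(1)] by auto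
    finally show ?thesis by (simp add: c_def)
  qed
  have \<beta>'_face: "\<beta>' S x vs = \<beta>' T x vs"
    if ST: "S \<in> K" "T \<in> K" "T \<subseteq> S" and x: "x \<in> T" and vs: "length vs = n" "set vs \<subseteq> tangent T"
      for S T x vs
  proof -
    note vm = verts_mono[OF K ST] and hT = vh[OF ST(2)]
    have xh: "x \<in> convex hull (verts T)" and vsh: "set vs \<subseteq> tangent (convex hull (verts T))"
      using x vs hT by auto
    have "hop (verts S) (Suc n) (\<omega> S) x vs = hop (verts T) (Suc n) (\<omega> T) x vs"
      by (rule hop_restrict[OF vi[OF ST(1)] vm xh _ _ vsh])
        (use forms_compatible[OF \<omega> ST] vs hT in auto)
    moreover have "(\<Sum>J\<in>?I S. c S J * wbase (verts S) J x vs) =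
      (\<Sum>J\<in>?I T. c S J * wbase (verts S) J x vs)"
    proof (rule sum.mono_neutral_right[OF finI[OF ST(1)]])
      show "?I T \<subseteq> ?I S" using vm by auto
      show "\<forall>J\<in>?I S - ?I T. c S J * wbase (verts S) J x vs = 0"
        using wbase_off_face[OF vi[OF ST(1)] vm xh _ _ vsh] by auto
    qed
    moreover have "(\<Sum>J\<in>?I T. c S J * wbase (verts S) J x vs) =
      (\<Sum>J\<in>?I T. c T J * wbase (verts T) J x vs)"
      by (rule sum.cong[OF refl])
        (use wbase_face[OF vi[OF ST(1)] vm xh _ _ vsh] c_face[OF ST x] vs in auto)
    ultimately show ?thesis by (simp add: \<beta>'_def)
  qed
  \<comment> \<open>The cut-off provides the value 0 that \<open>forms\<close> prescribes at all
    other arguments.\<close>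
  define \<beta> where "\<beta> S x = (if S \<in> K \<and> x \<in> S then (\<lambda>vs. if length vs =
    n \<and> set vs \<subseteq> tangent S then \<beta>' S x vs else 0) else (\<lambda>vs. 0))" for S x
  have "\<beta> \<in> forms K id (int n)"
  proof (rule formsI)
    fix S x assume "\<not> (S \<in> K \<and> x \<in> id ` S)"
    then show "\<beta> S x = (\<lambda>vs. 0)" by (auto simp: \<beta>_def)
  next
    fix S x assume "S \<in> K" "x \<in> id ` S"
    then show "alternating_form (tangent (id ` S)) (int n) (\<beta> S x)"
      using alt_form_imp_alternating_form[OF subspace_tangent form_on_alt[OF f\<beta>']] by (simp add: \<beta>_def)
  next
    fix S vs assume S: "S \<in> K" and vs: "set vs \<subseteq> tangent (id ` S)"
    show "smooth_on (id ` S) (\<lambda>x. \<beta> S x vs)"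
    proof (cases "length vs = n")
      case True
      have "smooth_on S (\<lambda>x. \<beta>' S x vs)" by (rule form_on_smooth[OF f\<beta>'[OF S] True]) (use vs in simp)
      then have "smooth_on S (\<lambda>x. \<beta> S x vs)"
        by (rule smooth_on_cong) (use S vs True in \<open>auto simp: \<beta>_def\<close>)
      then show ?thesis by simp
    next
      case False
      show ?thesis by (rule smooth_on_cong[OF smooth_on_const[of _ 0]])
        (use False in \<open>auto simp: \<beta>_def\<close>)
    qed
  next
    fix S T x vs assume h: "S \<in> K" "T \<in> K" "T \<subseteq> S" "x \<in> id ` T" "set vs \<subseteq> tangent (id ` T)"
    then have "x \<in> S" "set vs \<subseteq> tangent S" using tangent_mono[OF h(3)] by auto
    then show "\<beta> S x vs = \<beta> T x vs" using h \<beta>'_face[OF h(1-3)] by (auto simp: \<beta>_def)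
  qed
  moreover have "ext_deriv K id \<beta> = \<omega>"
  proof (intro ext)
    fix S x vs
    show "ext_deriv K id \<beta> S x vs = \<omega> S x vs"
    proof (cases "S \<in> K \<and> x \<in> S \<and> set vs \<subseteq> tangent S")
      case True
      then have S: "S \<in> K" "x \<in> S" and vs: "set vs \<subseteq> tangent S" by auto
      have e: "ext_deriv K id \<beta> S x vs = dform S (\<beta> S) x vs"
        using True by (simp add: ext_deriv_conv_dform)
      show ?thesis
      proof (cases "length vs = Suc n")
        case len: True
        have "dform S (\<beta> S) x vs = dform S (\<beta>' S) x vs"
          by (rule dform_cong[OF S(2) vs]) (use S len in \<open>auto simp: \<beta>_def\<close>)
        then show ?thesis using e d\<beta>'[OF S len vs] by simp
      next
        \<comment> \<open>In a wrong degree both sides vanish: the derivative sees only values that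
          were cut off, and \<omega> is 0 on such lists.\<close>
        case len: False
        have "dform S (\<beta> S) x vs = dform S (\<lambda>x vs. 0) x vs"
          by (rule dform_cong[OF S(2) vs]) (use S len in \<open>auto simp: \<beta>_def\<close>)
        also have "\<dots> = asum (\<lambda>u ws. 0) vs"
          unfolding dform_def by (rule asum_cong) (use tderiv_const[OF cc(2)[OF S(1)] S(2)] vs in auto)
        finally have "ext_deriv K id \<beta> S x vs = 0" by (simp add: e asum_zero)
        moreover have "\<omega> S x vs = 0"
          by (rule alternating_form_outside[OF forms_alternating[OF \<omega> S(1)]]) (use S len in auto)
        ultimately show ?thesis by simp
      qed
    next
      case False
      have "\<omega> S x vs = 0"
      proof (cases "S \<in> K \<and> x \<in> S")
        case True
        then show ?thesis
          using False alternating_form_outside[OF forms_alternating[OF \<omega>, of S x]] by auto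
      next
        case False
        then show ?thesis using forms_outside[OF \<omega>, of S x] by auto
      qed
      then show ?thesis using False by (auto simp: ext_deriv_conv_dform)
    qed
  qed
  ultimately show ?thesis by blast
qed

text \<open>On the empty list an exterior derivative is an empty sum, hence 0, and each point of
  each simplex lies under some sheet of that simplex.\<close>

lemma degree_zero_form_trivial:
  fixes K :: "'a::euclidean_space set set" and p :: "'b::topological_space \<Rightarrow> 'a"
  assumes K: "simplicial_complex K" and cov: "covering_space Xt p (\<Union>K)"
    and \<omega>: "\<omega> \<in> forms K id 0"
    and d\<alpha>: "ext_deriv (lifted_simplices K Xt p) p \<alpha> = pullback_form K Xt p \<omega>"
  shows "\<omega> = zero_form"
proof (intro ext)
  fix S x vs
  show "\<omega> S x vs = zero_form S x vs"
  proof (cases "S \<in> K \<and> x \<in> S \<and> vs = []")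
    case True
    then have S: "S \<in> K" "x \<in> S" and vs: "vs = []" by auto
    have "x \<in> p ` Xt" unfolding covering_space_imp_surjective[OF cov] using S by (rule UnionI)
    then obtain y where y: "y \<in> Xt" "p y = x" by (rule imageE) simp
    note L = sheet_lifted[OF cov S(1) simplex_compact_convex[OF K S(1)] _ y(1)]
    have l: "sheet Xt p S y \<in> lifted_simplices K Xt p" "p ` sheet Xt p S y = S" using L S y by auto
    have "ext_deriv (lifted_simplices K Xt p) p \<alpha> (sheet Xt p S y) x [] = 0"
      by (simp add: ext_deriv_def)
    then show ?thesis using l by (simp add: d\<alpha> pullback_form_def zero_form_def vs)
  next
    case False
    have "\<omega> S x vs = 0"
    proof (cases "S \<in> K \<and> x \<in> S")
      case True
      then have "alternating_form (tangent (id ` S)) 0 (\<omega> S x)" by (intro forms_alternating[OF \<omega>]) auto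
      then show ?thesis by (rule alternating_form_outside) (use True False in auto)
    next
      case False
      then show ?thesis using forms_outside[OF \<omega>, of S x] by simp
    qed
    then show ?thesis by (simp add: zero_form_def)
  qed
qed

lemma riemannian_metric_inner: "riemannian_metric K (\<lambda>S x u v. u \<bullet> v)"
  unfolding riemannian_metric_def
  by (intro conjI ballI allI impI) (simp_all add: inner_commute inner_add_right smooth_on_const)

lemma form_norm_zero: "form_norm V h (\<lambda>vs. 0) = 0"
proof -
  have "[] \<in> {vs. \<forall>v\<in>set vs. v \<in> V \<and> h v v \<le> 1}" by simp
  then have "{vs. \<forall>v\<in>set vs. v \<in> V \<and> h v v \<le> 1} \<noteq> {}" by blast
  from cSUP_const[OF this, of "\<bar>0::real\<bar>"] show ?thesis by (simp add: form_norm_def)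
qed

theorem theorem3p2:
  fixes K :: "'a::euclidean_space set set"
    and Xt :: "'b::topological_space set"
    and p :: "'b \<Rightarrow> 'a"
    and x0 :: 'a
    and k :: int
  assumes "simplicial_complex K"
    and "connected (\<Union>K)"
    and "x0 \<in> \<Union>K"
    and "universal_covering Xt p (\<Union>K)"
    and "amenable (fundamental_group (\<Union>K) x0)"
    and "k \<ge> 0"
  shows "hyperbolic_classes K Xt p k = {cohomology_zero K id k}"
proof -
  let ?L = "lifted_simplices K Xt p"
  have cov: "covering_space Xt p (\<Union>K)" and sc: "simply_connected Xt"
    using assms(4) by (auto simp: universal_covering_def)
  have pc: "path_connected (\<Union>K)"
    using path_connected_continuous_image[OF covering_space_imp_continuous[OF cov]
        simply_connected_imp_path_connected_general[OF sc]] covering_space_imp_surjective[OF cov]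
          by simp
  have D: "\<forall>S\<in>K. convex (id ` S)" using simplex_compact_convex(2)[OF assms(1)] by simp
  have DL: "\<forall>s\<in>?L. convex (p ` s)"
    using simplex_compact_convex(2)[OF assms(1)] by (auto simp: lifted_simplices_def homeomorphism_def)
  have "w = cohomology_zero K id k" if hyp: "w \<in> hyperbolic_classes K Xt p k" for w
  proof -
    obtain \<omega> \<alpha> g where w: "w \<in> cohomology K id k" "\<omega> \<in> w" and \<alpha>: "\<alpha> \<in> forms ?L p (k - 1)"
      "ext_deriv ?L p \<alpha> = pullback_form K Xt p \<omega>" and g: "riemannian_metric K g"
        "bounded_form ?L p (lifted_metric p g) \<alpha>"
      using hyp unfolding hyperbolic_classes_def by blast
    have "\<omega> \<in> closed_forms K id k"
      using w unfolding cohomology_def by (auto elim!: quotientE simp: cohomologous_def)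
    then have \<omega>: "\<omega> \<in> forms K id k" by (simp add: closed_forms_def)
    have "\<exists>\<beta>\<in>forms K id (k - 1). ext_deriv K id \<beta> = \<omega>"
    proof (cases "k = 0")
      case True
      have "\<omega> = zero_form" using degree_zero_form_trivial[OF assms(1) cov _ \<alpha>(2)] \<omega> True by simp
      then show ?thesis using zero_form_in_forms ext_deriv_zero_form[OF D] by blast
    next
      case False
      then obtain n where n: "k = int (Suc n)" using assms(6)
        by (metis int_nat_eq nat_0_iff not0_implies_Suc not_less_iff_gr_or_eq order_le_less
          zero_less_nat_eq)
      then have n': "k - 1 = int n" by simp
      show ?thesis
        using primitive_descends[OF assms(1) cov pc assms(3,5) _ _ \<alpha>(2) g, of n] \<omega> \<alpha>(1) n n' by metis
    qed
    then show ?thesis using cohomology_class_eq_zero[OF D w] by blast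
  qed
  \<comment> \<open>Equality of sets also needs the zero class to be hyperbolic; the zero form is
    its own bounded primitive, with the Euclidean metric as witness.\<close>
  moreover have "cohomology_zero K id k \<in> hyperbolic_classes K Xt p k"
  proof -
    have z: "zero_form \<in> closed_forms K id k"
      unfolding closed_forms_def using zero_form_in_forms ext_deriv_zero_form[OF D] by blast
    have "zero_form \<in> cohomology_zero K id k"
      unfolding cohomology_zero_def using equiv_class_self[OF equiv_cohomologous[OF D] z] .
    moreover have "cohomology_zero K id k \<in> cohomology K id k"
      unfolding cohomology_zero_def cohomology_def using z by (rule quotientI)
    moreover have "ext_deriv ?L p zero_form = pullback_form K Xt p zero_form"
      unfolding ext_deriv_zero_form[OF DL] by (auto simp: pullback_form_def zero_form_def)
    moreover have "bounded_form ?L p (lifted_metric p (\<lambda>S x u v. u \<bullet> v)) zero_form"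
      unfolding bounded_form_def zero_form_def by (auto simp: form_norm_zero)
    ultimately show ?thesis
      unfolding hyperbolic_classes_def using zero_form_in_forms riemannian_metric_inner by blast
  qed
  ultimately show ?thesis by blast
qed

end
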